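(* Let $R$ be a commutative ring, let $\mathcal{A}$ and $\mathcal{B}$ be $R$-linear abelian categories, and let $M\colon\mathcal{A}^{\mathrm{op}}\otimes\mathcal{B}\to\mathrm{mod}\text{-}R$ be an $R$-linear bifunctor such that $M(A,-)\colon\mathcal{B}\to\mathrm{mod}\text{-}R$ and $M(-,B)\colon\mathcal{A}^{\mathrm{op}}\to\mathrm{mod}\text{-}R$ are left exact for all $A\in\mathcal{A}$, $B\in\mathcal{B}$. Let $I_{\mathcal{A}}\colon D(\mathcal{A})\to D(\mathcal{A}\times_M\mathcal{B})$ and $I_{\mathcal{B}}\colon D(\mathcal{B})\to D(\mathcal{A}\times_M\mathcal{B})$ be the derived embeddings induced by the exact functors $A\mapsto(A,0,0)$ and $B\mapsto(0,B,0)$. Then the triangulated category $D(\mathcal{A}\times_M\mathcal{B})$ admits a semiorthogonal decomposition $$D(\mathcal{A}\times_M\mathcal{B})=\langle I_{\mathcal{A}}(D(\mathcal{A})),\,I_{\mathcal{B}}(D(\mathcal{B}))\rangle .$$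
   Context: $D(-)$ denotes the unbounded derived category of an abelian category. The glued category $\mathcal{A}\times_M\mathcal{B}$ has objects triples $(A,B,\mu)$ with $A\in\mathcal{A}$, $B\in\mathcal{B}$, $\mu\in M(A,B)$; a morphism $(A,B,\mu)\to(A',B',\mu')$ is a pair $(f\colon A\to A',g\colon B\to B')$ with $M(\mathrm{id}_A,g)(\mu)=M(f,\mathrm{id}_{B'})(\mu')$ in $M(A,B')$; composition is componentwise. Under the stated left-exactness hypotheses it is abelian, with kernels and cokernels computed componentwise. A semiorthogonal decomposition $\mathcal{T}=\langle\mathcal{A}',\mathcal{B}'\rangle$ of a triangulated category consists of full triangulated subcategories with $\mathrm{Hom}_{\mathcal{T}}(B,A)=0$ for $B\in\mathcal{B}'$, $A\in\mathcal{A}'$, such that every $E\in\mathcal{T}$ fits in a triangle $B\to E\to A\to B[1]$ with $A\in\mathcal{A}'$, $B\in\mathcal{B}'$. *)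

theory Defs
  imports "HOL-Algebra.Module"
begin

section \<open>Categories and functors\<close>

text \<open>
  A category has a set of objects inside a type and, for every pair of objects, a set of arrows
  inside a type.  Hom sets of different pairs may overlap, and composition and identities do not
  depend on the chosen endpoints.  Up to isomorphism this is no restriction (arrows can be tagged
  with their endpoints), and it lets chain maps and arrows of a glued category be plain families
  and plain pairs.
\<close>

record ('o, 'm) cat =
  Obj :: "'o set"
  Hom :: "'o \<Rightarrow> 'o \<Rightarrow> 'm set"
  Ident :: "'o \<Rightarrow> 'm"
  Comp :: "'m \<Rightarrow> 'm \<Rightarrow> 'm"  (infixl \<open>\<cdot>\<index>\<close> 70)

locale category =
  fixes C :: "('o, 'm, 'z) cat_scheme" (structure)
  assumes ident_closed: "X \<in> Obj C \<Longrightarrow> Ident C X \<in> Hom C X X"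
    and comp_closed:
      "\<lbrakk>X \<in> Obj C; Y \<in> Obj C; Z \<in> Obj C; f \<in> Hom C X Y; g \<in> Hom C Y Z\<rbrakk> \<Longrightarrow> g \<cdot> f \<in> Hom C X Z"
    and comp_ident_right: "\<lbrakk>X \<in> Obj C; Y \<in> Obj C; f \<in> Hom C X Y\<rbrakk> \<Longrightarrow> f \<cdot> Ident C X = f"
    and comp_ident_left: "\<lbrakk>X \<in> Obj C; Y \<in> Obj C; f \<in> Hom C X Y\<rbrakk> \<Longrightarrow> Ident C Y \<cdot> f = f"
    and comp_assoc:
      "\<lbrakk>W \<in> Obj C; X \<in> Obj C; Y \<in> Obj C; Z \<in> Obj C; f \<in> Hom C W X; g \<in> Hom C X Y; h \<in> Hom C Y Z\<rbrakk>
        \<Longrightarrow> (h \<cdot> g) \<cdot> f = h \<cdot> (g \<cdot> f)"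

definition is_inverse :: "('o, 'm, 'z) cat_scheme \<Rightarrow> 'o \<Rightarrow> 'o \<Rightarrow> 'm \<Rightarrow> 'm \<Rightarrow> bool" where
  "is_inverse C X Y f g \<longleftrightarrow>
     f \<in> Hom C X Y \<and> g \<in> Hom C Y X \<and> g \<cdot>\<^bsub>C\<^esub> f = Ident C X \<and> f \<cdot>\<^bsub>C\<^esub> g = Ident C Y"

definition is_iso :: "('o, 'm, 'z) cat_scheme \<Rightarrow> 'o \<Rightarrow> 'o \<Rightarrow> 'm \<Rightarrow> bool" where
  "is_iso C X Y f \<longleftrightarrow> (\<exists>g. is_inverse C X Y f g)"

definition isomorphic :: "('o, 'm, 'z) cat_scheme \<Rightarrow> 'o \<Rightarrow> 'o \<Rightarrow> bool" where
  "isomorphic C X Y \<longleftrightarrow> (\<exists>f. is_iso C X Y f)"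

definition is_zero_object :: "('o, 'm, 'z) cat_scheme \<Rightarrow> 'o \<Rightarrow> bool" where
  "is_zero_object C Z \<longleftrightarrow> Z \<in> Obj C \<and>
     (\<forall>X\<in>Obj C. (\<exists>!f. f \<in> Hom C X Z) \<and> (\<exists>!f. f \<in> Hom C Z X))"

definition zero_object :: "('o, 'm, 'z) cat_scheme \<Rightarrow> 'o" where
  "zero_object C = (SOME Z. is_zero_object C Z)"

definition is_zero_morphism :: "('o, 'm, 'z) cat_scheme \<Rightarrow> 'o \<Rightarrow> 'o \<Rightarrow> 'm \<Rightarrow> bool" where
  "is_zero_morphism C X Y f \<longleftrightarrow>
     (\<exists>Z g h. is_zero_object C Z \<and> g \<in> Hom C X Z \<and> h \<in> Hom C Z Y \<and> f = h \<cdot>\<^bsub>C\<^esub> g)"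

record ('o, 'm, 'p, 'n) functor_data =
  fob :: "'o \<Rightarrow> 'p"
  fmor :: "'m \<Rightarrow> 'n"

definition is_functor ::
  "('o, 'm, 'y) cat_scheme \<Rightarrow> ('p, 'n, 'z) cat_scheme \<Rightarrow> ('o, 'm, 'p, 'n) functor_data \<Rightarrow> bool" where
  "is_functor C D F \<longleftrightarrow>
     (\<forall>X\<in>Obj C. fob F X \<in> Obj D \<and> fmor F (Ident C X) = Ident D (fob F X)) \<and>
     (\<forall>X\<in>Obj C. \<forall>Y\<in>Obj C. \<forall>f\<in>Hom C X Y. fmor F f \<in> Hom D (fob F X) (fob F Y)) \<and>
     (\<forall>X\<in>Obj C. \<forall>Y\<in>Obj C. \<forall>Z\<in>Obj C. \<forall>f\<in>Hom C X Y. \<forall>g\<in>Hom C Y Z.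
        fmor F (g \<cdot>\<^bsub>C\<^esub> f) = fmor F g \<cdot>\<^bsub>D\<^esub> fmor F f)"

definition fully_faithful ::
  "('o, 'm, 'y) cat_scheme \<Rightarrow> ('p, 'n, 'z) cat_scheme \<Rightarrow> ('o, 'm, 'p, 'n) functor_data \<Rightarrow> bool" where
  "fully_faithful C D F \<longleftrightarrow> is_functor C D F \<and>
     (\<forall>X\<in>Obj C. \<forall>Y\<in>Obj C. bij_betw (fmor F) (Hom C X Y) (Hom D (fob F X) (fob F Y)))"

text \<open>Full subcategories are represented by their sets of objects.\<close>

definition ess_image ::
  "('o, 'm, 'y) cat_scheme \<Rightarrow> ('p, 'n, 'z) cat_scheme \<Rightarrow> ('o, 'm, 'p, 'n) functor_data \<Rightarrow> 'p set" where
  "ess_image C D F = {Y \<in> Obj D. \<exists>X\<in>Obj C. isomorphic D (fob F X) Y}"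


section \<open>Linear and abelian categories\<close>

definition linear_map ::
  "('r, 'x) ring_scheme \<Rightarrow> ('r, 'u) module \<Rightarrow> ('r, 'v) module \<Rightarrow> ('u \<Rightarrow> 'v) \<Rightarrow> bool" where
  "linear_map R M N h \<longleftrightarrow>
     h \<in> carrier M \<rightarrow> carrier N \<and>
     (\<forall>x\<in>carrier M. \<forall>y\<in>carrier M. h (x \<oplus>\<^bsub>M\<^esub> y) = h x \<oplus>\<^bsub>N\<^esub> h y) \<and>
     (\<forall>r\<in>carrier R. \<forall>x\<in>carrier M. h (r \<odot>\<^bsub>M\<^esub> x) = r \<odot>\<^bsub>N\<^esub> h x)"

record ('o, 'm, 'r) lincat = "('o, 'm) cat" +
  hzero :: "'o \<Rightarrow> 'o \<Rightarrow> 'm"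
  hadd :: "'o \<Rightarrow> 'o \<Rightarrow> 'm \<Rightarrow> 'm \<Rightarrow> 'm"
  hsmult :: "'o \<Rightarrow> 'o \<Rightarrow> 'r \<Rightarrow> 'm \<Rightarrow> 'm"

text \<open>The multiplicative fields of a module record carry no meaning and are left undefined.\<close>

definition Hom_mod :: "('o, 'm, 'r, 'z) lincat_scheme \<Rightarrow> 'o \<Rightarrow> 'o \<Rightarrow> ('r, 'm) module" where
  "Hom_mod C X Y =
     \<lparr>carrier = Hom C X Y, mult = undefined, one = undefined,
      zero = hzero C X Y, add = hadd C X Y, smult = hsmult C X Y\<rparr>"

locale linear_category = R?: cring R + category C
  for R :: "('r, 'x) ring_scheme" (structure)
    and C :: "('o, 'm, 'r, 'z) lincat_scheme" (structure) +
  assumes Hom_module: "\<lbrakk>X \<in> Obj C; Y \<in> Obj C\<rbrakk> \<Longrightarrow> module R (Hom_mod C X Y)"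
    and comp_linear_left:
      "\<lbrakk>X \<in> Obj C; Y \<in> Obj C; Z \<in> Obj C; f \<in> Hom C X Y\<rbrakk>
        \<Longrightarrow> linear_map R (Hom_mod C Y Z) (Hom_mod C X Z) (\<lambda>g. g \<cdot>\<^bsub>C\<^esub> f)"
    and comp_linear_right:
      "\<lbrakk>X \<in> Obj C; Y \<in> Obj C; Z \<in> Obj C; g \<in> Hom C Y Z\<rbrakk>
        \<Longrightarrow> linear_map R (Hom_mod C X Y) (Hom_mod C X Z) (\<lambda>f. g \<cdot>\<^bsub>C\<^esub> f)"

definition is_kernel :: "('o, 'm, 'r, 'z) lincat_scheme \<Rightarrow> 'o \<Rightarrow> 'o \<Rightarrow> 'm \<Rightarrow> 'o \<Rightarrow> 'm \<Rightarrow> bool" where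
  "is_kernel C X Y f K k \<longleftrightarrow>
     X \<in> Obj C \<and> Y \<in> Obj C \<and> K \<in> Obj C \<and> f \<in> Hom C X Y \<and> k \<in> Hom C K X \<and>
     f \<cdot>\<^bsub>C\<^esub> k = hzero C K Y \<and>
     (\<forall>T\<in>Obj C. \<forall>t\<in>Hom C T X. f \<cdot>\<^bsub>C\<^esub> t = hzero C T Y \<longrightarrow>
        (\<exists>!u. u \<in> Hom C T K \<and> k \<cdot>\<^bsub>C\<^esub> u = t))"

definition is_cokernel :: "('o, 'm, 'r, 'z) lincat_scheme \<Rightarrow> 'o \<Rightarrow> 'o \<Rightarrow> 'm \<Rightarrow> 'o \<Rightarrow> 'm \<Rightarrow> bool" where
  "is_cokernel C X Y f Q q \<longleftrightarrow>
     X \<in> Obj C \<and> Y \<in> Obj C \<and> Q \<in> Obj C \<and> f \<in> Hom C X Y \<and> q \<in> Hom C Y Q \<and>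
     q \<cdot>\<^bsub>C\<^esub> f = hzero C X Q \<and>
     (\<forall>T\<in>Obj C. \<forall>t\<in>Hom C Y T. t \<cdot>\<^bsub>C\<^esub> f = hzero C X T \<longrightarrow>
        (\<exists>!u. u \<in> Hom C Q T \<and> u \<cdot>\<^bsub>C\<^esub> q = t))"

definition is_mono :: "('o, 'm, 'z) cat_scheme \<Rightarrow> 'o \<Rightarrow> 'o \<Rightarrow> 'm \<Rightarrow> bool" where
  "is_mono C X Y f \<longleftrightarrow> f \<in> Hom C X Y \<and>
     (\<forall>T\<in>Obj C. \<forall>s\<in>Hom C T X. \<forall>t\<in>Hom C T X. f \<cdot>\<^bsub>C\<^esub> s = f \<cdot>\<^bsub>C\<^esub> t \<longrightarrow> s = t)"

definition is_epi :: "('o, 'm, 'z) cat_scheme \<Rightarrow> 'o \<Rightarrow> 'o \<Rightarrow> 'm \<Rightarrow> bool" where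
  "is_epi C X Y f \<longleftrightarrow> f \<in> Hom C X Y \<and>
     (\<forall>T\<in>Obj C. \<forall>s\<in>Hom C Y T. \<forall>t\<in>Hom C Y T. s \<cdot>\<^bsub>C\<^esub> f = t \<cdot>\<^bsub>C\<^esub> f \<longrightarrow> s = t)"

record ('o, 'm) biproduct =
  vertex :: 'o
  inj1 :: 'm
  inj2 :: 'm
  prj1 :: 'm
  prj2 :: 'm

definition is_biproduct ::
  "('o, 'm, 'r, 'z) lincat_scheme \<Rightarrow> 'o \<Rightarrow> 'o \<Rightarrow> ('o, 'm) biproduct \<Rightarrow> bool" where
  "is_biproduct C X Y P \<longleftrightarrow>
     vertex P \<in> Obj C \<and>
     inj1 P \<in> Hom C X (vertex P) \<and> inj2 P \<in> Hom C Y (vertex P) \<and>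
     prj1 P \<in> Hom C (vertex P) X \<and> prj2 P \<in> Hom C (vertex P) Y \<and>
     prj1 P \<cdot>\<^bsub>C\<^esub> inj1 P = Ident C X \<and> prj2 P \<cdot>\<^bsub>C\<^esub> inj2 P = Ident C Y \<and>
     prj1 P \<cdot>\<^bsub>C\<^esub> inj2 P = hzero C Y X \<and> prj2 P \<cdot>\<^bsub>C\<^esub> inj1 P = hzero C X Y \<and>
     (inj1 P \<cdot>\<^bsub>C\<^esub> prj1 P) \<oplus>\<^bsub>Hom_mod C (vertex P) (vertex P)\<^esub> (inj2 P \<cdot>\<^bsub>C\<^esub> prj2 P) = Ident C (vertex P)"

definition biprod :: "('o, 'm, 'r, 'z) lincat_scheme \<Rightarrow> 'o \<Rightarrow> 'o \<Rightarrow> ('o, 'm) biproduct" where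
  "biprod C X Y = (SOME P. is_biproduct C X Y P)"

locale abelian_category = linear_category R C
  for R :: "('r, 'x) ring_scheme" (structure)
    and C :: "('o, 'm, 'r, 'z) lincat_scheme" (structure) +
  assumes zero_object_exists: "\<exists>Z. is_zero_object C Z"
    and biproduct_exists: "\<lbrakk>X \<in> Obj C; Y \<in> Obj C\<rbrakk> \<Longrightarrow> \<exists>P. is_biproduct C X Y P"
    and kernel_exists:
      "\<lbrakk>X \<in> Obj C; Y \<in> Obj C; f \<in> Hom C X Y\<rbrakk> \<Longrightarrow> \<exists>K k. is_kernel C X Y f K k"
    and cokernel_exists:
      "\<lbrakk>X \<in> Obj C; Y \<in> Obj C; f \<in> Hom C X Y\<rbrakk> \<Longrightarrow> \<exists>Q q. is_cokernel C X Y f Q q"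
    and mono_normal:
      "\<lbrakk>X \<in> Obj C; Y \<in> Obj C; is_mono C X Y f\<rbrakk> \<Longrightarrow> \<exists>Z g. is_kernel C Y Z g X f"
    and epi_normal:
      "\<lbrakk>X \<in> Obj C; Y \<in> Obj C; is_epi C X Y f\<rbrakk> \<Longrightarrow> \<exists>W g. is_cokernel C W X g Y f"


section \<open>Complexes, cohomology and cones\<close>

record ('o, 'm) cochain =
  cob :: "int \<Rightarrow> 'o"
  cdiff :: "int \<Rightarrow> 'm"

definition is_complex :: "('o, 'm, 'r, 'z) lincat_scheme \<Rightarrow> ('o, 'm) cochain \<Rightarrow> bool" where
  "is_complex C X \<longleftrightarrow>
     (\<forall>n. cob X n \<in> Obj C \<and> cdiff X n \<in> Hom C (cob X n) (cob X (n + 1)) \<and>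
          cdiff X (n + 1) \<cdot>\<^bsub>C\<^esub> cdiff X n = hzero C (cob X n) (cob X (n + 2)))"

definition is_chain_map ::
  "('o, 'm, 'r, 'z) lincat_scheme \<Rightarrow> ('o, 'm) cochain \<Rightarrow> ('o, 'm) cochain \<Rightarrow> (int \<Rightarrow> 'm) \<Rightarrow> bool" where
  "is_chain_map C X Y f \<longleftrightarrow>
     (\<forall>n. f n \<in> Hom C (cob X n) (cob Y n) \<and>
          f (n + 1) \<cdot>\<^bsub>C\<^esub> cdiff X n = cdiff Y n \<cdot>\<^bsub>C\<^esub> f n)"

definition Ch :: "('o, 'm, 'r, 'z) lincat_scheme \<Rightarrow> (('o, 'm) cochain, int \<Rightarrow> 'm) cat" where
  "Ch C =
     \<lparr>Obj = {X. is_complex C X},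
      Hom = (\<lambda>X Y. {f. is_chain_map C X Y f}),
      Ident = (\<lambda>X n. Ident C (cob X n)),
      Comp = (\<lambda>g f n. g n \<cdot>\<^bsub>C\<^esub> f n)\<rparr>"

text \<open>
  \<open>H\<^sup>n(X)\<close> is the cokernel of the arrow \<open>X\<^sup>n\<^sup>-\<^sup>1 \<rightarrow> Z\<^sup>n(X)\<close> induced by the differential, where
  \<open>Z\<^sup>n(X) \<rightarrow> X\<^sup>n\<close> is the kernel of \<open>X\<^sup>n \<rightarrow> X\<^sup>n\<^sup>+\<^sup>1\<close>.  Kernels and cokernels are chosen.
\<close>

definition cocycles :: "('o, 'm, 'r, 'z) lincat_scheme \<Rightarrow> ('o, 'm) cochain \<Rightarrow> int \<Rightarrow> 'o \<times> 'm" where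
  "cocycles C X n =
     (SOME (K, k). is_kernel C (cob X n) (cob X (n + 1)) (cdiff X n) K k)"

definition boundary_arrow :: "('o, 'm, 'r, 'z) lincat_scheme \<Rightarrow> ('o, 'm) cochain \<Rightarrow> int \<Rightarrow> 'm" where
  "boundary_arrow C X n =
     (THE b. b \<in> Hom C (cob X (n - 1)) (fst (cocycles C X n)) \<and>
             snd (cocycles C X n) \<cdot>\<^bsub>C\<^esub> b = cdiff X (n - 1))"

definition cohomology :: "('o, 'm, 'r, 'z) lincat_scheme \<Rightarrow> ('o, 'm) cochain \<Rightarrow> int \<Rightarrow> 'o \<times> 'm" where
  "cohomology C X n =
     (SOME (H, q). is_cokernel C (cob X (n - 1)) (fst (cocycles C X n)) (boundary_arrow C X n) H q)"

definition cohomology_map ::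
  "('o, 'm, 'r, 'z) lincat_scheme \<Rightarrow> ('o, 'm) cochain \<Rightarrow> ('o, 'm) cochain \<Rightarrow> (int \<Rightarrow> 'm) \<Rightarrow> int \<Rightarrow> 'm" where
  "cohomology_map C X Y f n =
     (THE h. h \<in> Hom C (fst (cohomology C X n)) (fst (cohomology C Y n)) \<and>
        (\<exists>u \<in> Hom C (fst (cocycles C X n)) (fst (cocycles C Y n)).
           snd (cocycles C Y n) \<cdot>\<^bsub>C\<^esub> u = f n \<cdot>\<^bsub>C\<^esub> snd (cocycles C X n) \<and>
           h \<cdot>\<^bsub>C\<^esub> snd (cohomology C X n) = snd (cohomology C Y n) \<cdot>\<^bsub>C\<^esub> u))"

definition quasi_isos ::
  "('o, 'm, 'r, 'z) lincat_scheme \<Rightarrow> ('o, 'm) cochain \<Rightarrow> ('o, 'm) cochain \<Rightarrow> (int \<Rightarrow> 'm) set" where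
  "quasi_isos C X Y =
     {f. is_chain_map C X Y f \<and>
         (\<forall>n. is_iso C (fst (cohomology C X n)) (fst (cohomology C Y n)) (cohomology_map C X Y f n))}"

definition shift_functor ::
  "('o, 'm, 'r, 'z) lincat_scheme \<Rightarrow>
     (('o, 'm) cochain, int \<Rightarrow> 'm, ('o, 'm) cochain, int \<Rightarrow> 'm) functor_data" where
  "shift_functor C =
     \<lparr>fob = (\<lambda>X. \<lparr>cob = (\<lambda>n. cob X (n + 1)),
                  cdiff = (\<lambda>n. \<ominus>\<^bsub>Hom_mod C (cob X (n + 1)) (cob X (n + 2))\<^esub> cdiff X (n + 1))\<rparr>),
      fmor = (\<lambda>f n. f (n + 1))\<rparr>"

text \<open>
  The cone of \<open>f : X \<rightarrow> Y\<close> is \<open>X[1] \<oplus> Y\<close> with differential \<open>(x, y) \<mapsto> (- d x, f x + d y)\<close>.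
\<close>

definition cone_sum ::
  "('o, 'm, 'r, 'z) lincat_scheme \<Rightarrow> ('o, 'm) cochain \<Rightarrow> ('o, 'm) cochain \<Rightarrow> int \<Rightarrow> ('o, 'm) biproduct" where
  "cone_sum C X Y n = biprod C (cob X (n + 1)) (cob Y n)"

definition cone ::
  "('o, 'm, 'r, 'z) lincat_scheme \<Rightarrow> ('o, 'm) cochain \<Rightarrow> ('o, 'm) cochain \<Rightarrow> (int \<Rightarrow> 'm) \<Rightarrow> ('o, 'm) cochain" where
  "cone C X Y f =
     \<lparr>cob = (\<lambda>n. vertex (cone_sum C X Y n)),
      cdiff = (\<lambda>n. let P = cone_sum C X Y n; Q = cone_sum C X Y (n + 1);
                       H = Hom_mod C (vertex P) (vertex Q) in
         (inj1 Q \<cdot>\<^bsub>C\<^esub> cdiff (fob (shift_functor C) X) n \<cdot>\<^bsub>C\<^esub> prj1 P)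
           \<oplus>\<^bsub>H\<^esub> (inj2 Q \<cdot>\<^bsub>C\<^esub> f (n + 1) \<cdot>\<^bsub>C\<^esub> prj1 P)
           \<oplus>\<^bsub>H\<^esub> (inj2 Q \<cdot>\<^bsub>C\<^esub> cdiff Y n \<cdot>\<^bsub>C\<^esub> prj2 P))\<rparr>"

definition cone_in ::
  "('o, 'm, 'r, 'z) lincat_scheme \<Rightarrow> ('o, 'm) cochain \<Rightarrow> ('o, 'm) cochain \<Rightarrow> int \<Rightarrow> 'm" where
  "cone_in C X Y n = inj2 (cone_sum C X Y n)"

definition cone_out ::
  "('o, 'm, 'r, 'z) lincat_scheme \<Rightarrow> ('o, 'm) cochain \<Rightarrow> ('o, 'm) cochain \<Rightarrow> int \<Rightarrow> 'm" where
  "cone_out C X Y n = prj1 (cone_sum C X Y n)"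

definition chain_functor ::
  "('o, 'm, 'p, 'n) functor_data \<Rightarrow>
     (('o, 'm) cochain, int \<Rightarrow> 'm, ('p, 'n) cochain, int \<Rightarrow> 'n) functor_data" where
  "chain_functor F =
     \<lparr>fob = (\<lambda>X. \<lparr>cob = (\<lambda>n. fob F (cob X n)), cdiff = (\<lambda>n. fmor F (cdiff X n))\<rparr>),
      fmor = (\<lambda>f n. fmor F (f n))\<rparr>"


section \<open>Localization of a category\<close>

text \<open>
  The localization at a class \<open>W\<close> of arrows has the same objects; its arrows are finite
  zigzags modulo the congruence that makes the embedding of arrows functorial and every arrow of
  \<open>W\<close> invertible.  \<open>Fwd X f Y\<close> is an arrow \<open>f : X \<rightarrow> Y\<close>, and \<open>Bwd X w Y\<close> is the formal
  inverse of \<open>w : X \<rightarrow> Y\<close>, leading from \<open>Y\<close> to \<open>X\<close>.  Zigzags list their steps in the order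
  of traversal.
\<close>

datatype ('o, 'm) step = Fwd 'o 'm 'o | Bwd 'o 'm 'o

inductive zigzag ::
  "('o, 'm, 'z) cat_scheme \<Rightarrow> ('o \<Rightarrow> 'o \<Rightarrow> 'm set) \<Rightarrow> 'o \<Rightarrow> ('o, 'm) step list \<Rightarrow> 'o \<Rightarrow> bool"
  for C :: "('o, 'm, 'z) cat_scheme" and W :: "'o \<Rightarrow> 'o \<Rightarrow> 'm set" where
  zz_nil: "X \<in> Obj C \<Longrightarrow> zigzag C W X [] X"
| zz_fwd: "\<lbrakk>X \<in> Obj C; Y \<in> Obj C; f \<in> Hom C X Y; zigzag C W Y p Z\<rbrakk>
    \<Longrightarrow> zigzag C W X (Fwd X f Y # p) Z"
| zz_bwd: "\<lbrakk>X \<in> Obj C; Y \<in> Obj C; w \<in> W X Y; zigzag C W X p Z\<rbrakk>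
    \<Longrightarrow> zigzag C W Y (Bwd X w Y # p) Z"

inductive zz_eq ::
  "('o, 'm, 'z) cat_scheme \<Rightarrow> ('o \<Rightarrow> 'o \<Rightarrow> 'm set) \<Rightarrow>
     'o \<Rightarrow> 'o \<Rightarrow> ('o, 'm) step list \<Rightarrow> ('o, 'm) step list \<Rightarrow> bool"
  for C :: "('o, 'm, 'z) cat_scheme" and W :: "'o \<Rightarrow> 'o \<Rightarrow> 'm set" where
  zz_refl: "zigzag C W X p Y \<Longrightarrow> zz_eq C W X Y p p"
| zz_sym: "zz_eq C W X Y p q \<Longrightarrow> zz_eq C W X Y q p"
| zz_trans: "\<lbrakk>zz_eq C W X Y p q; zz_eq C W X Y q r\<rbrakk> \<Longrightarrow> zz_eq C W X Y p r"
| zz_append: "\<lbrakk>zz_eq C W X Y p p'; zz_eq C W Y Z q q'\<rbrakk> \<Longrightarrow> zz_eq C W X Z (p @ q) (p' @ q')"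
| zz_ident: "X \<in> Obj C \<Longrightarrow> zz_eq C W X X [Fwd X (Ident C X) X] []"
| zz_comp: "\<lbrakk>X \<in> Obj C; Y \<in> Obj C; Z \<in> Obj C; f \<in> Hom C X Y; g \<in> Hom C Y Z\<rbrakk>
    \<Longrightarrow> zz_eq C W X Z [Fwd X f Y, Fwd Y g Z] [Fwd X (g \<cdot>\<^bsub>C\<^esub> f) Z]"
| zz_fwd_bwd: "\<lbrakk>X \<in> Obj C; Y \<in> Obj C; w \<in> W X Y\<rbrakk> \<Longrightarrow> zz_eq C W X X [Fwd X w Y, Bwd X w Y] []"
| zz_bwd_fwd: "\<lbrakk>X \<in> Obj C; Y \<in> Obj C; w \<in> W X Y\<rbrakk> \<Longrightarrow> zz_eq C W Y Y [Bwd X w Y, Fwd X w Y] []"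

text \<open>Arrows of the localization remember their endpoints, so that the class of the empty zigzag
  determines the object at which it is based.\<close>

type_synonym ('o, 'm) zz_arrow = "('o \<times> ('o, 'm) step list \<times> 'o) set"

definition zz_class ::
  "('o, 'm, 'z) cat_scheme \<Rightarrow> ('o \<Rightarrow> 'o \<Rightarrow> 'm set) \<Rightarrow> 'o \<Rightarrow> ('o, 'm) step list \<Rightarrow> 'o \<Rightarrow> ('o, 'm) zz_arrow" where
  "zz_class C W X p Y = {(X, q, Y) | q. zz_eq C W X Y p q}"

definition localization ::
  "('o, 'm, 'z) cat_scheme \<Rightarrow> ('o \<Rightarrow> 'o \<Rightarrow> 'm set) \<Rightarrow> ('o, ('o, 'm) zz_arrow) cat" where
  "localization C W =
     \<lparr>Obj = Obj C,
      Hom = (\<lambda>X Y. {zz_class C W X p Y | p. zigzag C W X p Y}),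
      Ident = (\<lambda>X. zz_class C W X [] X),
      Comp = (\<lambda>\<beta> \<alpha>. \<Union>{zz_class C W X (p @ q) Z | X p Y q Z. (X, p, Y) \<in> \<alpha> \<and> (Y, q, Z) \<in> \<beta>})\<rparr>"

primrec map_zz_step :: "('o, 'm, 'p, 'n) functor_data \<Rightarrow> ('o, 'm) step \<Rightarrow> ('p, 'n) step" where
  "map_zz_step F (Fwd X f Y) = Fwd (fob F X) (fmor F f) (fob F Y)"
| "map_zz_step F (Bwd X w Y) = Bwd (fob F X) (fmor F w) (fob F Y)"

text \<open>The functor between localizations induced by a functor \<open>F\<close> into \<open>D\<close> which maps the
  localized arrows of its source into the class \<open>V\<close> of arrows of \<open>D\<close>.\<close>

definition localized_functor ::
  "('p, 'n, 'z) cat_scheme \<Rightarrow> ('p \<Rightarrow> 'p \<Rightarrow> 'n set) \<Rightarrow> ('o, 'm, 'p, 'n) functor_data \<Rightarrow>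
     ('o, ('o, 'm) zz_arrow, 'p, ('p, 'n) zz_arrow) functor_data" where
  "localized_functor D V F =
     \<lparr>fob = fob F,
      fmor = (\<lambda>\<alpha>. \<Union>{zz_class D V (fob F X) (map (map_zz_step F) p) (fob F Y) | X p Y. (X, p, Y) \<in> \<alpha>})\<rparr>"


section \<open>Triangles and semiorthogonal decompositions\<close>

text \<open>
  A category with a shift functor and a class of distinguished triangles
  \<open>X \<rightarrow> Y \<rightarrow> Z \<rightarrow> X[1]\<close>, listed as \<open>(X, Y, Z, u, v, w)\<close>.
\<close>

record ('o, 'm) tricat = "('o, 'm) cat" +
  shift :: "('o, 'm, 'o, 'm) functor_data"
  dist :: "('o \<times> 'o \<times> 'o \<times> 'm \<times> 'm \<times> 'm) set"

text \<open>
  A strictly full triangulated subcategory.  As the shift is an equivalence and \<open>S\<close> is closed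
  under isomorphisms, closure under the inverse shift means that \<open>X[1] \<in> S\<close> implies \<open>X \<in> S\<close>.
\<close>

definition triangulated_subcategory :: "('o, 'm, 'z) tricat_scheme \<Rightarrow> 'o set \<Rightarrow> bool" where
  "triangulated_subcategory T S \<longleftrightarrow>
     S \<subseteq> Obj T \<and>
     (\<exists>Z\<in>S. is_zero_object T Z) \<and>
     (\<forall>X\<in>S. \<forall>Y\<in>Obj T. isomorphic T X Y \<longrightarrow> Y \<in> S) \<and>
     (\<forall>X\<in>Obj T. X \<in> S \<longleftrightarrow> fob (shift T) X \<in> S) \<and>
     (\<forall>X Y Z u v w. (X, Y, Z, u, v, w) \<in> dist T \<and> X \<in> S \<and> Y \<in> S \<longrightarrow> Z \<in> S)"

text \<open>\<open>Hom(B, A) = 0\<close> is expressed by saying that every arrow \<open>B \<rightarrow> A\<close> is the zero arrow, that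
  is, factors through a zero object.\<close>

definition semiorthogonal_decomposition ::
  "('o, 'm, 'z) tricat_scheme \<Rightarrow> 'o set \<Rightarrow> 'o set \<Rightarrow> bool" where
  "semiorthogonal_decomposition T SA SB \<longleftrightarrow>
     triangulated_subcategory T SA \<and> triangulated_subcategory T SB \<and>
     (\<forall>B\<in>SB. \<forall>A\<in>SA. \<forall>f\<in>Hom T B A. is_zero_morphism T B A f) \<and>
     (\<forall>E\<in>Obj T. \<exists>A\<in>SA. \<exists>B\<in>SB. \<exists>u v w. (B, E, A, u, v, w) \<in> dist T)"


section \<open>The unbounded derived category\<close>

definition derived_cat ::
  "('o, 'm, 'r, 'z) lincat_scheme \<Rightarrow>
     (('o, 'm) cochain, (('o, 'm) cochain, int \<Rightarrow> 'm) zz_arrow) cat" where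
  "derived_cat C = localization (Ch C) (quasi_isos C)"

definition derived_shift ::
  "('o, 'm, 'r, 'z) lincat_scheme \<Rightarrow>
     (('o, 'm) cochain, (('o, 'm) cochain, int \<Rightarrow> 'm) zz_arrow,
      ('o, 'm) cochain, (('o, 'm) cochain, int \<Rightarrow> 'm) zz_arrow) functor_data" where
  "derived_shift C = localized_functor (Ch C) (quasi_isos C) (shift_functor C)"

definition in_derived ::
  "('o, 'm, 'r, 'z) lincat_scheme \<Rightarrow> ('o, 'm) cochain \<Rightarrow> (int \<Rightarrow> 'm) \<Rightarrow> ('o, 'm) cochain \<Rightarrow>
     (('o, 'm) cochain, int \<Rightarrow> 'm) zz_arrow" where
  "in_derived C X f Y = zz_class (Ch C) (quasi_isos C) X [Fwd X f Y] Y"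

text \<open>Distinguished triangles are those isomorphic, in the derived category, to a mapping cone
  triangle \<open>X' \<rightarrow> Y' \<rightarrow> cone f \<rightarrow> X'[1]\<close>.\<close>

definition derived_triangles ::
  "('o, 'm, 'r, 'z) lincat_scheme \<Rightarrow>
     (('o, 'm) cochain \<times> ('o, 'm) cochain \<times> ('o, 'm) cochain \<times>
      (('o, 'm) cochain, int \<Rightarrow> 'm) zz_arrow \<times>
      (('o, 'm) cochain, int \<Rightarrow> 'm) zz_arrow \<times>
      (('o, 'm) cochain, int \<Rightarrow> 'm) zz_arrow) set" where
  "derived_triangles C =
     {(X, Y, Z, u, v, w).
        X \<in> Obj (derived_cat C) \<and> Y \<in> Obj (derived_cat C) \<and> Z \<in> Obj (derived_cat C) \<and>
        u \<in> Hom (derived_cat C) X Y \<and> v \<in> Hom (derived_cat C) Y Z \<and>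
        w \<in> Hom (derived_cat C) Z (fob (derived_shift C) X) \<and>
        (\<exists>X' Y' f a b c.
           is_complex C X' \<and> is_complex C Y' \<and> is_chain_map C X' Y' f \<and>
           is_iso (derived_cat C) X X' a \<and> is_iso (derived_cat C) Y Y' b \<and>
           is_iso (derived_cat C) Z (cone C X' Y' f) c \<and>
           b \<cdot>\<^bsub>derived_cat C\<^esub> u = in_derived C X' f Y' \<cdot>\<^bsub>derived_cat C\<^esub> a \<and>
           c \<cdot>\<^bsub>derived_cat C\<^esub> v =
             in_derived C Y' (cone_in C X' Y') (cone C X' Y' f) \<cdot>\<^bsub>derived_cat C\<^esub> b \<and>
           fmor (derived_shift C) a \<cdot>\<^bsub>derived_cat C\<^esub> w =
             in_derived C (cone C X' Y' f) (cone_out C X' Y') (fob (shift_functor C) X')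
               \<cdot>\<^bsub>derived_cat C\<^esub> c)}"

definition derived_category ::
  "('o, 'm, 'r, 'z) lincat_scheme \<Rightarrow>
     (('o, 'm) cochain, (('o, 'm) cochain, int \<Rightarrow> 'm) zz_arrow) tricat" where
  "derived_category C =
     cat.extend (derived_cat C) \<lparr>shift = derived_shift C, dist = derived_triangles C\<rparr>"

text \<open>The functor \<open>D(C') \<rightarrow> D(C)\<close> induced by an exact functor \<open>F : C' \<rightarrow> C\<close>.\<close>

definition derived_functor ::
  "('p, 'n, 'r, 'z) lincat_scheme \<Rightarrow> ('o, 'm, 'p, 'n) functor_data \<Rightarrow>
     (('o, 'm) cochain, (('o, 'm) cochain, int \<Rightarrow> 'm) zz_arrow,
      ('p, 'n) cochain, (('p, 'n) cochain, int \<Rightarrow> 'n) zz_arrow) functor_data" where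
  "derived_functor C F = localized_functor (Ch C) (quasi_isos C) (chain_functor F)"


section \<open>Bifunctors and glued categories\<close>

text \<open>
  A bifunctor \<open>A\<^sup>o\<^sup>p \<otimes> B \<rightarrow> mod-R\<close>; for \<open>f : X \<rightarrow> X'\<close> in \<open>A\<close> and \<open>g : Y \<rightarrow> Y'\<close> in \<open>B\<close>,
  \<open>bmap M f g\<close> maps \<open>M(X', Y)\<close> to \<open>M(X, Y')\<close>.
\<close>

record ('oa, 'ma, 'ob, 'mb, 'r, 'v) bifunctor_data =
  bmod :: "'oa \<Rightarrow> 'ob \<Rightarrow> ('r, 'v) module"
  bmap :: "'ma \<Rightarrow> 'mb \<Rightarrow> 'v \<Rightarrow> 'v"

locale linear_bifunctor = A?: linear_category R A + B?: linear_category R B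
  for R :: "('r, 'x) ring_scheme" (structure)
    and A :: "('oa, 'ma, 'r) lincat" and B :: "('ob, 'mb, 'r) lincat" +
  fixes M :: "('oa, 'ma, 'ob, 'mb, 'r, 'v) bifunctor_data"
  assumes bmod_module: "\<lbrakk>X \<in> Obj A; Y \<in> Obj B\<rbrakk> \<Longrightarrow> module R (bmod M X Y)"
    and bmap_linear:
      "\<lbrakk>X \<in> Obj A; X' \<in> Obj A; Y \<in> Obj B; Y' \<in> Obj B; f \<in> Hom A X X'; g \<in> Hom B Y Y'\<rbrakk>
        \<Longrightarrow> linear_map R (bmod M X' Y) (bmod M X Y') (bmap M f g)"
    and bmap_ident:
      "\<lbrakk>X \<in> Obj A; Y \<in> Obj B; x \<in> carrier (bmod M X Y)\<rbrakk> \<Longrightarrow> bmap M (Ident A X) (Ident B Y) x = x"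
    and bmap_comp:
      "\<lbrakk>X \<in> Obj A; X' \<in> Obj A; X'' \<in> Obj A; Y \<in> Obj B; Y' \<in> Obj B; Y'' \<in> Obj B;
        f \<in> Hom A X X'; f' \<in> Hom A X' X''; g \<in> Hom B Y Y'; g' \<in> Hom B Y' Y'';
        x \<in> carrier (bmod M X'' Y)\<rbrakk>
        \<Longrightarrow> bmap M (f' \<cdot>\<^bsub>A\<^esub> f) (g' \<cdot>\<^bsub>B\<^esub> g) x = bmap M f g' (bmap M f' g x)"
    and bmap_linear_fst:
      "\<lbrakk>X \<in> Obj A; X' \<in> Obj A; Y \<in> Obj B; Y' \<in> Obj B; g \<in> Hom B Y Y'; x \<in> carrier (bmod M X' Y)\<rbrakk>
        \<Longrightarrow> linear_map R (Hom_mod A X X') (bmod M X Y') (\<lambda>f. bmap M f g x)"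
    and bmap_linear_snd:
      "\<lbrakk>X \<in> Obj A; X' \<in> Obj A; Y \<in> Obj B; Y' \<in> Obj B; f \<in> Hom A X X'; x \<in> carrier (bmod M X' Y)\<rbrakk>
        \<Longrightarrow> linear_map R (Hom_mod B Y Y') (bmod M X Y') (\<lambda>g. bmap M f g x)"

text \<open>Exactness of \<open>0 \<rightarrow> L \<rightarrow> M \<rightarrow> N\<close> for modules.\<close>

definition left_exact_seq ::
  "('r, 'u) module \<Rightarrow> ('u \<Rightarrow> 'v) \<Rightarrow> ('r, 'v) module \<Rightarrow> ('v \<Rightarrow> 'w) \<Rightarrow> ('r, 'w) module \<Rightarrow> bool" where
  "left_exact_seq L i M p N \<longleftrightarrow>
     inj_on i (carrier L) \<and> i ` carrier L = {x \<in> carrier M. p x = \<zero>\<^bsub>N\<^esub>}"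

text \<open>
  Left exactness in each variable: exact sequences \<open>0 \<rightarrow> K \<rightarrow> Y \<rightarrow> Y'\<close> in \<open>B\<close> and, since \<open>M\<close> is
  contravariant in its first argument, exact sequences \<open>X \<rightarrow> X' \<rightarrow> Q \<rightarrow> 0\<close> in \<open>A\<close> are mapped
  to left exact sequences of modules.
\<close>

locale left_exact_bifunctor = linear_bifunctor R A B M
  for R :: "('r, 'x) ring_scheme" (structure)
    and A :: "('oa, 'ma, 'r) lincat" and B :: "('ob, 'mb, 'r) lincat"
    and M :: "('oa, 'ma, 'ob, 'mb, 'r, 'v) bifunctor_data" +
  assumes left_exact_snd:
      "\<lbrakk>X \<in> Obj A; is_kernel B Y Y' g K k\<rbrakk>
        \<Longrightarrow> left_exact_seq (bmod M X K) (bmap M (Ident A X) k)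
              (bmod M X Y) (bmap M (Ident A X) g) (bmod M X Y')"
    and left_exact_fst:
      "\<lbrakk>Y \<in> Obj B; is_cokernel A X X' f Q q\<rbrakk>
        \<Longrightarrow> left_exact_seq (bmod M Q Y) (bmap M q (Ident B Y))
              (bmod M X' Y) (bmap M f (Ident B Y)) (bmod M X Y)"

definition glued ::
  "('oa, 'ma, 'r) lincat \<Rightarrow> ('ob, 'mb, 'r) lincat \<Rightarrow> ('oa, 'ma, 'ob, 'mb, 'r, 'v) bifunctor_data \<Rightarrow>
     ('oa \<times> 'ob \<times> 'v, 'ma \<times> 'mb, 'r) lincat" where
  "glued A B M =
     \<lparr>Obj = {(X, Y, \<mu>). X \<in> Obj A \<and> Y \<in> Obj B \<and> \<mu> \<in> carrier (bmod M X Y)},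
      Hom = (\<lambda>(X, Y, \<mu>) (X', Y', \<mu>').
        {(f, g). f \<in> Hom A X X' \<and> g \<in> Hom B Y Y' \<and>
                 bmap M (Ident A X) g \<mu> = bmap M f (Ident B Y') \<mu>'}),
      Ident = (\<lambda>(X, Y, \<mu>). (Ident A X, Ident B Y)),
      Comp = (\<lambda>(f', g') (f, g). (f' \<cdot>\<^bsub>A\<^esub> f, g' \<cdot>\<^bsub>B\<^esub> g)),
      hzero = (\<lambda>(X, Y, \<mu>) (X', Y', \<mu>'). (hzero A X X', hzero B Y Y')),
      hadd = (\<lambda>(X, Y, \<mu>) (X', Y', \<mu>') (f, g) (f', g'). (hadd A X X' f f', hadd B Y Y' g g')),
      hsmult = (\<lambda>(X, Y, \<mu>) (X', Y', \<mu>') r (f, g). (hsmult A X X' r f, hsmult B Y Y' r g))\<rparr>"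

definition glued_incl_fst ::
  "('oa, 'ma, 'r) lincat \<Rightarrow> ('ob, 'mb, 'r) lincat \<Rightarrow> ('oa, 'ma, 'ob, 'mb, 'r, 'v) bifunctor_data \<Rightarrow>
     ('oa, 'ma, 'oa \<times> 'ob \<times> 'v, 'ma \<times> 'mb) functor_data" where
  "glued_incl_fst A B M =
     \<lparr>fob = (\<lambda>X. (X, zero_object B, \<zero>\<^bsub>bmod M X (zero_object B)\<^esub>)),
      fmor = (\<lambda>f. (f, hzero B (zero_object B) (zero_object B)))\<rparr>"

definition glued_incl_snd ::
  "('oa, 'ma, 'r) lincat \<Rightarrow> ('ob, 'mb, 'r) lincat \<Rightarrow> ('oa, 'ma, 'ob, 'mb, 'r, 'v) bifunctor_data \<Rightarrow>
     ('ob, 'mb, 'oa \<times> 'ob \<times> 'v, 'ma \<times> 'mb) functor_data" where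
  "glued_incl_snd A B M =
     \<lparr>fob = (\<lambda>Y. (zero_object A, Y, \<zero>\<^bsub>bmod M (zero_object A) Y\<^esub>)),
      fmor = (\<lambda>g. (hzero A (zero_object A) (zero_object A), g))\<rparr>"

end

theory Submission
  imports Defs
begin

text \<open>
  The inclusion \<open>X \<mapsto> (X, 0, 0)\<close> has the exact left adjoint \<open>(X, Y, \<mu>) \<mapsto> X\<close>, the inclusion
  \<open>Y \<mapsto> (0, Y, 0)\<close> has the exact right adjoint \<open>(X, Y, \<mu>) \<mapsto> Y\<close>, and each adjoint is a strict
  retraction of its inclusion.  As all four functors are exact, the adjunctions pass to the derived
  categories without any calculus of fractions: naturality of a unit extends to zigzags.  Full
  faithfulness follows, and the essential image of each inclusion is the subcategory of complexes
  whose other component is acyclic; it is triangulated because cones of acyclic complexes are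
  acyclic.  An arrow from the second image to the first factors through an acyclic complex, and the
  cone of the counit \<open>(0, Y, 0) \<rightarrow> (X, Y, \<mu>)\<close> lies in the first image because its \<open>B\<close>-component
  is the cone of an identity.
\<close>

section \<open>Arrows and linear structure\<close>

text \<open>The gluing condition for an arrow \<open>(X, Y, mu) -> (X', Y', mu')\<close> is an
  equation in \<open>M(X, Y')\<close>. Towards \<open>(X, 0, 0)\<close> it lives in
  \<open>M(X, 0)\<close>, and from \<open>(0, Y, 0)\<close> in \<open>M(0, Y)\<close>; both modules
  vanish. This is why one inclusion has a left adjoint and the other a right adjoint. Left exactness
  of \<open>M\<close> makes kernels and cokernels componentwise, and so makes the projections exact.

  Two obstacles shape the rest. Equality of zigzags is only a generated congruence, so information
  is extracted from it by interpreting zigzags elsewhere: in another localization, or through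
  cohomology, which inverts quasi-isomorphisms. The latter shows that isomorphism in the derived
  category preserves acyclicity. Moreover, functors do not respect chosen cohomology or chosen
  cones, so both are replaced by relations that exact functors preserve.

  The glued category is used as a preabelian category; the steps that rest on normal epimorphisms
  take place in \<open>A\<close> and \<open>B\<close>, after projection.\<close>

definition arrow :: "('o, 'm, 'z) cat_scheme \<Rightarrow> 'o \<Rightarrow> 'o \<Rightarrow> 'm \<Rightarrow> bool" where
  "arrow C X Y f \<longleftrightarrow> X \<in> Obj C \<and> Y \<in> Obj C \<and> f \<in> Hom C X Y"

lemma arrowI: "\<lbrakk>X \<in> Obj C; Y \<in> Obj C; f \<in> Hom C X Y\<rbrakk> \<Longrightarrow> arrow C X Y f"
  by (simp add: arrow_def)

lemma arrowD:
  assumes "arrow C X Y f"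
  shows "X \<in> Obj C" "Y \<in> Obj C" "f \<in> Hom C X Y"
  using assms by (auto simp: arrow_def)

context category
begin

lemma arrow_ident: "X \<in> Obj C \<Longrightarrow> arrow C X X (Ident C X)"
  by (simp add: arrow_def ident_closed)

lemma arrow_comp: "\<lbrakk>arrow C X Y f; arrow C Y Z g\<rbrakk> \<Longrightarrow> arrow C X Z (g \<cdot> f)"
  unfolding arrow_def using comp_closed by blast

lemma comp_id_right: "arrow C X Y f \<Longrightarrow> f \<cdot> Ident C X = f"
  unfolding arrow_def using comp_ident_right by blast

lemma comp_id_left: "arrow C X Y f \<Longrightarrow> Ident C Y \<cdot> f = f"
  unfolding arrow_def using comp_ident_left by blast

lemma assoc: "\<lbrakk>arrow C W X f; arrow C X Y g; arrow C Y Z h\<rbrakk> \<Longrightarrow> (h \<cdot> g) \<cdot> f = h \<cdot> (g \<cdot> f)"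
  unfolding arrow_def using comp_assoc by blast

lemma is_isoI:
  "\<lbrakk>arrow C X Y f; arrow C Y X g; g \<cdot> f = Ident C X; f \<cdot> g = Ident C Y\<rbrakk> \<Longrightarrow> is_iso C X Y f"
  unfolding is_iso_def is_inverse_def arrow_def by blast

lemma is_isoE:
  assumes "is_iso C X Y f" "X \<in> Obj C" "Y \<in> Obj C"
  obtains g where "arrow C X Y f" "arrow C Y X g" "g \<cdot> f = Ident C X" "f \<cdot> g = Ident C Y"
  using assms unfolding is_iso_def is_inverse_def arrow_def by blast

lemma is_iso_ident: "X \<in> Obj C \<Longrightarrow> is_iso C X X (Ident C X)"
  using is_isoI arrow_ident comp_id_left by metis

lemma is_iso_comp:
  assumes o: "X \<in> Obj C" "Y \<in> Obj C" "Z \<in> Obj C" and f: "is_iso C X Y f" and g: "is_iso C Y Z g"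
  shows "is_iso C X Z (g \<cdot> f)"
proof -
  obtain f' where f': "arrow C X Y f" "arrow C Y X f'" "f' \<cdot> f = Ident C X" "f \<cdot> f' = Ident C Y"
    using is_isoE[OF f o(1,2)] by blast
  obtain g' where g': "arrow C Y Z g" "arrow C Z Y g'" "g' \<cdot> g = Ident C Y" "g \<cdot> g' = Ident C Z"
    using is_isoE[OF g o(2,3)] by blast
  have "(f' \<cdot> g') \<cdot> (g \<cdot> f) = f' \<cdot> (g' \<cdot> (g \<cdot> f))"
    using assoc[OF arrow_comp[OF f'(1) g'(1)] g'(2) f'(2)] .
  also have "g' \<cdot> (g \<cdot> f) = f"
    using assoc[OF f'(1) g'(1,2)] g'(3) comp_id_left[OF f'(1)] by simp
  finally have 1: "(f' \<cdot> g') \<cdot> (g \<cdot> f) = Ident C X" using f'(3) by simp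
  have "(g \<cdot> f) \<cdot> (f' \<cdot> g') = g \<cdot> (f \<cdot> (f' \<cdot> g'))"
    using assoc[OF arrow_comp[OF g'(2) f'(2)] f'(1) g'(1)] .
  also have "f \<cdot> (f' \<cdot> g') = g'"
    using assoc[OF g'(2) f'(2,1)] f'(4) comp_id_left[OF g'(2)] by simp
  finally have 2: "(g \<cdot> f) \<cdot> (f' \<cdot> g') = Ident C Z" using g'(4) by simp
  show ?thesis
    using is_isoI[OF arrow_comp[OF f'(1) g'(1)] arrow_comp[OF g'(2) f'(2)] 1 2] .
qed

lemma isomorphic_sym: "isomorphic C X Y \<Longrightarrow> isomorphic C Y X"
  unfolding isomorphic_def is_iso_def is_inverse_def by blast

lemma to_zero_object_unique:
  "\<lbrakk>is_zero_object C Z; arrow C X Z f; arrow C X Z g\<rbrakk> \<Longrightarrow> f = g"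
  unfolding is_zero_object_def arrow_def by (blast dest: bspec)

lemma from_zero_object_unique:
  "\<lbrakk>is_zero_object C Z; arrow C Z X f; arrow C Z X g\<rbrakk> \<Longrightarrow> f = g"
  unfolding is_zero_object_def arrow_def by (blast dest: bspec)

lemma ex_arrow_from_zero_object:
  "\<lbrakk>is_zero_object C Z; X \<in> Obj C\<rbrakk> \<Longrightarrow> \<exists>f. arrow C Z X f"
  unfolding is_zero_object_def arrow_def by (blast dest: bspec)

lemma ex_arrow_to_zero_object:
  "\<lbrakk>is_zero_object C Z; X \<in> Obj C\<rbrakk> \<Longrightarrow> \<exists>f. arrow C X Z f"
  unfolding is_zero_object_def arrow_def by (blast dest: bspec)

lemma iso_if_zero_objects:
  assumes "is_zero_object C X" "is_zero_object C Y" "arrow C X Y f"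
  shows "is_iso C X Y f"
proof -
  have o: "X \<in> Obj C" "Y \<in> Obj C" using assms(3) by (auto dest: arrowD)
  obtain g where g: "arrow C Y X g" using ex_arrow_from_zero_object[OF assms(2) o(1)] by blast
  have "g \<cdot> f = Ident C X"
    by (rule to_zero_object_unique[OF assms(1) arrow_comp[OF assms(3) g] arrow_ident[OF o(1)]])
  moreover have "f \<cdot> g = Ident C Y"
    by (rule to_zero_object_unique[OF assms(2) arrow_comp[OF g assms(3)] arrow_ident[OF o(2)]])
  ultimately show ?thesis using is_isoI[OF assms(3) g] by blast
qed

end

lemma Hom_mod_simps [simp]:
  "carrier (Hom_mod C X Y) = Hom C X Y"
  "zero (Hom_mod C X Y) = hzero C X Y"
  "add (Hom_mod C X Y) = hadd C X Y"
  "smult (Hom_mod C X Y) = hsmult C X Y"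
  by (simp_all add: Hom_mod_def)

abbreviation hneg :: "('o, 'm, 'r, 'z) lincat_scheme \<Rightarrow> 'o \<Rightarrow> 'o \<Rightarrow> 'm \<Rightarrow> 'm" where
  "hneg C X Y f \<equiv> a_inv (Hom_mod C X Y) f"

context linear_category
begin

lemma hom_group: "\<lbrakk>X \<in> Obj C; Y \<in> Obj C\<rbrakk> \<Longrightarrow> abelian_group (Hom_mod C X Y)"
  using Hom_module module.axioms(2) by blast

lemma arrow_zero: "\<lbrakk>X \<in> Obj C; Y \<in> Obj C\<rbrakk> \<Longrightarrow> arrow C X Y (hzero C X Y)"
  using abelian_group.axioms(1)[OF hom_group, THEN abelian_monoid.zero_closed]
  by (simp add: arrow_def)

lemma arrow_add: "\<lbrakk>arrow C X Y f; arrow C X Y g\<rbrakk> \<Longrightarrow> arrow C X Y (hadd C X Y f g)"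
  using abelian_group.axioms(1)[OF hom_group, THEN abelian_monoid.a_closed]
  by (simp add: arrow_def)

lemma arrow_neg: "arrow C X Y f \<Longrightarrow> arrow C X Y (hneg C X Y f)"
  using abelian_group.a_inv_closed[OF hom_group] by (simp add: arrow_def)

lemma add_assoc:
  "\<lbrakk>arrow C X Y f; arrow C X Y g; arrow C X Y h\<rbrakk>
    \<Longrightarrow> hadd C X Y (hadd C X Y f g) h = hadd C X Y f (hadd C X Y g h)"
  using abelian_group.axioms(1)[OF hom_group, THEN abelian_monoid.a_assoc]
  by (simp add: arrow_def)

lemma add_comm: "\<lbrakk>arrow C X Y f; arrow C X Y g\<rbrakk> \<Longrightarrow> hadd C X Y f g = hadd C X Y g f"
  using abelian_group.axioms(1)[OF hom_group, THEN abelian_monoid.a_comm]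
  by (simp add: arrow_def)

lemma add_zero_left: "arrow C X Y f \<Longrightarrow> hadd C X Y (hzero C X Y) f = f"
  using abelian_group.axioms(1)[OF hom_group, THEN abelian_monoid.l_zero]
  by (simp add: arrow_def)

lemma add_zero_right: "arrow C X Y f \<Longrightarrow> hadd C X Y f (hzero C X Y) = f"
  using abelian_group.axioms(1)[OF hom_group, THEN abelian_monoid.r_zero]
  by (simp add: arrow_def)

lemma add_neg_left: "arrow C X Y f \<Longrightarrow> hadd C X Y (hneg C X Y f) f = hzero C X Y"
  using abelian_group.l_neg[OF hom_group] by (simp add: arrow_def)

lemma add_neg_right: "arrow C X Y f \<Longrightarrow> hadd C X Y f (hneg C X Y f) = hzero C X Y"
  using abelian_group.r_neg[OF hom_group] by (simp add: arrow_def)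

lemma neg_neg: "arrow C X Y f \<Longrightarrow> hneg C X Y (hneg C X Y f) = f"
  using abelian_group.minus_minus[OF hom_group] by (simp add: arrow_def)

lemma neg_unique:
  "\<lbrakk>arrow C X Y f; arrow C X Y g; hadd C X Y f g = hzero C X Y\<rbrakk> \<Longrightarrow> g = hneg C X Y f"
  by (metis add_assoc add_neg_left add_zero_left add_zero_right arrow_neg)

lemma neg_zero: "\<lbrakk>X \<in> Obj C; Y \<in> Obj C\<rbrakk> \<Longrightarrow> hneg C X Y (hzero C X Y) = hzero C X Y"
  by (metis add_zero_left arrow_zero neg_unique)

lemma comp_add_left:
  assumes "arrow C X Y f" "arrow C Y Z g" "arrow C Y Z g'"
  shows "hadd C Y Z g g' \<cdot>\<^bsub>C\<^esub> f = hadd C X Z (g \<cdot>\<^bsub>C\<^esub> f) (g' \<cdot>\<^bsub>C\<^esub> f)"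
  using comp_linear_left[of X Y Z f] assms by (simp add: arrow_def linear_map_def)

lemma comp_add_right:
  assumes "arrow C X Y f" "arrow C X Y f'" "arrow C Y Z g"
  shows "g \<cdot>\<^bsub>C\<^esub> hadd C X Y f f' = hadd C X Z (g \<cdot>\<^bsub>C\<^esub> f) (g \<cdot>\<^bsub>C\<^esub> f')"
  using comp_linear_right[of X Y Z g] assms by (simp add: arrow_def linear_map_def)

lemma add_self_zero: "\<lbrakk>arrow C X Y f; hadd C X Y f f = f\<rbrakk> \<Longrightarrow> f = hzero C X Y"
  by (metis add_assoc add_neg_left add_zero_left arrow_neg)

lemma comp_zero_left:
  assumes "arrow C X Y f" "Z \<in> Obj C"
  shows "hzero C Y Z \<cdot>\<^bsub>C\<^esub> f = hzero C X Z"
proof (rule add_self_zero)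
  have Y: "Y \<in> Obj C" using assms(1) by (auto simp: arrow_def)
  show "arrow C X Z (hzero C Y Z \<cdot>\<^bsub>C\<^esub> f)"
    using arrow_comp[OF assms(1) arrow_zero[OF Y assms(2)]] .
  show "hadd C X Z (hzero C Y Z \<cdot>\<^bsub>C\<^esub> f) (hzero C Y Z \<cdot>\<^bsub>C\<^esub> f) = hzero C Y Z \<cdot>\<^bsub>C\<^esub> f"
    using comp_add_left[OF assms(1) arrow_zero[OF Y assms(2)] arrow_zero[OF Y assms(2)]]
    by (simp add: add_zero_left[OF arrow_zero[OF Y assms(2)]])
qed

lemma comp_zero_right:
  assumes "X \<in> Obj C" "arrow C Y Z g"
  shows "g \<cdot>\<^bsub>C\<^esub> hzero C X Y = hzero C X Z"
proof (rule add_self_zero)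
  have Y: "Y \<in> Obj C" using assms(2) by (auto simp: arrow_def)
  show "arrow C X Z (g \<cdot>\<^bsub>C\<^esub> hzero C X Y)"
    using arrow_comp[OF arrow_zero[OF assms(1) Y] assms(2)] .
  show "hadd C X Z (g \<cdot>\<^bsub>C\<^esub> hzero C X Y) (g \<cdot>\<^bsub>C\<^esub> hzero C X Y) = g \<cdot>\<^bsub>C\<^esub> hzero C X Y"
    using comp_add_right[OF arrow_zero[OF assms(1) Y] arrow_zero[OF assms(1) Y] assms(2)]
    by (simp add: add_zero_left[OF arrow_zero[OF assms(1) Y]])
qed

lemma comp_neg_left:
  assumes "arrow C X Y f" "arrow C Y Z g"
  shows "hneg C Y Z g \<cdot>\<^bsub>C\<^esub> f = hneg C X Z (g \<cdot>\<^bsub>C\<^esub> f)"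
proof (rule neg_unique[OF arrow_comp[OF assms] arrow_comp[OF assms(1) arrow_neg[OF assms(2)]]])
  show "hadd C X Z (g \<cdot>\<^bsub>C\<^esub> f) (hneg C Y Z g \<cdot>\<^bsub>C\<^esub> f) = hzero C X Z"
    using comp_add_left[OF assms arrow_neg[OF assms(2)]] add_neg_right[OF assms(2)]
      comp_zero_left[OF assms(1) arrowD(2)[OF assms(2)]] by simp
qed

lemma comp_neg_right:
  assumes "arrow C X Y f" "arrow C Y Z g"
  shows "g \<cdot>\<^bsub>C\<^esub> hneg C X Y f = hneg C X Z (g \<cdot>\<^bsub>C\<^esub> f)"
proof (rule neg_unique[OF arrow_comp[OF assms] arrow_comp[OF arrow_neg[OF assms(1)] assms(2)]])
  show "hadd C X Z (g \<cdot>\<^bsub>C\<^esub> f) (g \<cdot>\<^bsub>C\<^esub> hneg C X Y f) = hzero C X Z"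
    using comp_add_right[OF assms(1) arrow_neg[OF assms(1)] assms(2)] add_neg_right[OF assms(1)]
      comp_zero_right[OF arrowD(1)[OF assms(1)] assms(2)] by simp
qed

lemma diff_zero_iff:
  assumes "arrow C X Y f" "arrow C X Y g"
  shows "hadd C X Y f (hneg C X Y g) = hzero C X Y \<longleftrightarrow> f = g"
  by (metis assms add_neg_right arrow_neg neg_neg neg_unique add_comm)

text \<open>If the identity of \<open>Z\<close> is zero, each arrow into or out of \<open>Z\<close>
  is its own composite with a zero arrow. In this equational form the notion passes through additive
  functors and splits into the components of a glued object.\<close>

lemma is_zero_object_iff: "is_zero_object C Z \<longleftrightarrow> Z \<in> Obj C \<and> Ident C Z = hzero C Z Z"
proof
  assume "is_zero_object C Z"
  then show "Z \<in> Obj C \<and> Ident C Z = hzero C Z Z"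
    unfolding is_zero_object_def using ident_closed arrow_zero arrowD(3) by metis
next
  assume Z: "Z \<in> Obj C \<and> Ident C Z = hzero C Z Z"
  have "f = hzero C X Z" if "arrow C X Z f" for X f
    using comp_id_left[OF that] comp_zero_left[OF that] Z by simp
  moreover have "f = hzero C Z X" if "arrow C Z X f" for X f
    using comp_id_right[OF that] comp_zero_right[OF _ that] Z by simp
  ultimately show "is_zero_object C Z"
    unfolding is_zero_object_def using Z arrow_zero by (metis arrow_def)
qed

lemma arrow_to_zero: "\<lbrakk>is_zero_object C Z; arrow C X Z f\<rbrakk> \<Longrightarrow> f = hzero C X Z"
  using comp_id_left[of X Z f] comp_zero_left[of X Z f Z] by (simp add: is_zero_object_iff)

lemma arrow_from_zero: "\<lbrakk>is_zero_object C Z; arrow C Z X f\<rbrakk> \<Longrightarrow> f = hzero C Z X"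
  using comp_id_right[of Z X f] comp_zero_right[of Z Z X f] by (simp add: is_zero_object_iff)

text \<open>Right cancellation of \<open>f\<close> is tested on the difference
  \<open>s - t\<close>.\<close>

lemma is_epi_iff:
  assumes f: "arrow C X Y f"
  shows "is_epi C X Y f \<longleftrightarrow>
    (\<forall>T s. arrow C Y T s \<longrightarrow> s \<cdot>\<^bsub>C\<^esub> f = hzero C X T \<longrightarrow> s = hzero C Y T)"
proof
  assume "is_epi C X Y f"
  then show "\<forall>T s. arrow C Y T s \<longrightarrow> s \<cdot>\<^bsub>C\<^esub> f = hzero C X T \<longrightarrow> s = hzero C Y T"
    unfolding is_epi_def using comp_zero_left[OF f] arrow_zero f unfolding arrow_def by metis
next
  assume *: "\<forall>T s. arrow C Y T s \<longrightarrow> s \<cdot>\<^bsub>C\<^esub> f = hzero C X T \<longrightarrow> s = hzero C Y T"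
  have "s = t" if a: "arrow C Y T s" "arrow C Y T t" and e: "s \<cdot>\<^bsub>C\<^esub> f = t \<cdot>\<^bsub>C\<^esub> f" for T s t
  proof -
    have "hadd C Y T s (hneg C Y T t) \<cdot>\<^bsub>C\<^esub> f = hzero C X T"
      using comp_add_left[OF f a(1) arrow_neg[OF a(2)]] comp_neg_left[OF f a(2)] e
        add_neg_right arrow_comp[OF f a(2)] by simp
    then have "hadd C Y T s (hneg C Y T t) = hzero C Y T"
      using * a arrow_add arrow_neg by blast
    then show ?thesis using diff_zero_iff[OF a] by simp
  qed
  then show "is_epi C X Y f"
    unfolding is_epi_def using f unfolding arrow_def by blast
qed

lemma epi_cancel:
  "\<lbrakk>is_epi C X Y f; arrow C Y T s; arrow C Y T t; s \<cdot>\<^bsub>C\<^esub> f = t \<cdot>\<^bsub>C\<^esub> f\<rbrakk> \<Longrightarrow> s = t"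
  unfolding is_epi_def arrow_def by blast

lemma epi_comp:
  assumes "X \<in> Obj C" "Y \<in> Obj C" "is_epi C X Y f" "is_epi C Y Z g" "Z \<in> Obj C"
  shows "is_epi C X Z (g \<cdot>\<^bsub>C\<^esub> f)"
proof -
  have a: "arrow C X Y f" "arrow C Y Z g" using assms by (auto simp: is_epi_def arrow_def)
  have "s = t" if s: "arrow C Z T s" "arrow C Z T t" "s \<cdot>\<^bsub>C\<^esub> (g \<cdot>\<^bsub>C\<^esub> f) = t \<cdot>\<^bsub>C\<^esub> (g \<cdot>\<^bsub>C\<^esub> f)" for T s t
  proof -
    have "(s \<cdot>\<^bsub>C\<^esub> g) \<cdot>\<^bsub>C\<^esub> f = (t \<cdot>\<^bsub>C\<^esub> g) \<cdot>\<^bsub>C\<^esub> f" using s assoc[OF a] by simp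
    then have "s \<cdot>\<^bsub>C\<^esub> g = t \<cdot>\<^bsub>C\<^esub> g"
      using epi_cancel[OF assms(3)] arrow_comp[OF a(2)] s by blast
    then show ?thesis using epi_cancel[OF assms(4)] s by blast
  qed
  then show ?thesis
    unfolding is_epi_def using arrow_comp[OF a] arrowD assms unfolding arrow_def by metis
qed

lemma epi_right_factor:
  assumes "is_epi C X Z (g \<cdot>\<^bsub>C\<^esub> f)" "arrow C X Y f" "arrow C Y Z g"
  shows "is_epi C Y Z g"
proof -
  have "s = t" if s: "arrow C Z T s" "arrow C Z T t" "s \<cdot>\<^bsub>C\<^esub> g = t \<cdot>\<^bsub>C\<^esub> g" for T s t
    using epi_cancel[OF assms(1) s(1,2)] s(3) assoc[OF assms(2,3)] s(1,2) by metis
  then show ?thesis unfolding is_epi_def using assms(3) unfolding arrow_def by blast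
qed

lemma epi_ident: "X \<in> Obj C \<Longrightarrow> is_epi C X X (Ident C X)"
  unfolding is_epi_def using ident_closed comp_ident_right by metis


section \<open>Kernels and cokernels\<close>

lemma is_kernelD:
  assumes "is_kernel C X Y f K k"
  shows "arrow C X Y f" "arrow C K X k" "f \<cdot>\<^bsub>C\<^esub> k = hzero C K Y"
  using assms by (auto simp: is_kernel_def arrow_def)

lemma kernel_lift:
  assumes "is_kernel C X Y f K k" "arrow C T X t" "f \<cdot>\<^bsub>C\<^esub> t = hzero C T Y"
  shows "\<exists>u. arrow C T K u \<and> k \<cdot>\<^bsub>C\<^esub> u = t"
  using assms unfolding is_kernel_def arrow_def by blast

lemma kernel_cancel:
  assumes k: "is_kernel C X Y f K k" and u: "arrow C T K u" and v: "arrow C T K v"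
    and e: "k \<cdot>\<^bsub>C\<^esub> u = k \<cdot>\<^bsub>C\<^esub> v"
  shows "u = v"
proof -
  note d = is_kernelD[OF k]
  have T: "T \<in> Obj C" using u by (auto simp: arrow_def)
  have "f \<cdot>\<^bsub>C\<^esub> (k \<cdot>\<^bsub>C\<^esub> u) = hzero C T Y"
    using assoc[OF u d(2,1)] d(3) comp_zero_left[OF u] arrowD[OF d(1)] by metis
  moreover have "k \<cdot>\<^bsub>C\<^esub> u \<in> Hom C T X" using arrow_comp[OF u d(2)] by (auto simp: arrow_def)
  ultimately have "\<exists>!w. w \<in> Hom C T K \<and> k \<cdot>\<^bsub>C\<^esub> w = k \<cdot>\<^bsub>C\<^esub> u"
    using k T unfolding is_kernel_def by blast
  then show ?thesis using u v e arrowD(3) by metis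
qed

lemma is_kernelI:
  assumes "arrow C X Y f" "arrow C K X k" "f \<cdot>\<^bsub>C\<^esub> k = hzero C K Y"
    and "\<And>T t. \<lbrakk>arrow C T X t; f \<cdot>\<^bsub>C\<^esub> t = hzero C T Y\<rbrakk> \<Longrightarrow> \<exists>u. arrow C T K u \<and> k \<cdot>\<^bsub>C\<^esub> u = t"
    and "\<And>T u v. \<lbrakk>arrow C T K u; arrow C T K v; k \<cdot>\<^bsub>C\<^esub> u = k \<cdot>\<^bsub>C\<^esub> v\<rbrakk> \<Longrightarrow> u = v"
  shows "is_kernel C X Y f K k"
proof -
  have "\<exists>!u. u \<in> Hom C T K \<and> k \<cdot>\<^bsub>C\<^esub> u = t"
    if "T \<in> Obj C" "t \<in> Hom C T X" "f \<cdot>\<^bsub>C\<^esub> t = hzero C T Y" for T t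
    using assms(4)[of T t] assms(5)[of T] that assms(1,2) unfolding arrow_def by metis
  then show ?thesis using assms(1-3) unfolding is_kernel_def arrow_def by blast
qed

lemma is_cokernelD:
  assumes "is_cokernel C X Y f Q q"
  shows "arrow C X Y f" "arrow C Y Q q" "q \<cdot>\<^bsub>C\<^esub> f = hzero C X Q"
  using assms by (auto simp: is_cokernel_def arrow_def)

lemma cokernel_extend:
  assumes "is_cokernel C X Y f Q q" "arrow C Y T t" "t \<cdot>\<^bsub>C\<^esub> f = hzero C X T"
  shows "\<exists>u. arrow C Q T u \<and> u \<cdot>\<^bsub>C\<^esub> q = t"
  using assms unfolding is_cokernel_def arrow_def by blast

lemma cokernel_cancel:
  assumes k: "is_cokernel C X Y f Q q" and u: "arrow C Q T u" and v: "arrow C Q T v"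
    and e: "u \<cdot>\<^bsub>C\<^esub> q = v \<cdot>\<^bsub>C\<^esub> q"
  shows "u = v"
proof -
  note d = is_cokernelD[OF k]
  have T: "T \<in> Obj C" using u by (auto simp: arrow_def)
  have "(u \<cdot>\<^bsub>C\<^esub> q) \<cdot>\<^bsub>C\<^esub> f = hzero C X T"
    using assoc[OF d(1,2) u] d(3) comp_zero_right[OF _ u] arrowD[OF d(1)] by metis
  moreover have "u \<cdot>\<^bsub>C\<^esub> q \<in> Hom C Y T" using arrow_comp[OF d(2) u] by (auto simp: arrow_def)
  ultimately have "\<exists>!w. w \<in> Hom C Q T \<and> w \<cdot>\<^bsub>C\<^esub> q = u \<cdot>\<^bsub>C\<^esub> q"
    using k T unfolding is_cokernel_def by blast
  then show ?thesis using u v e arrowD(3) by metis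
qed

lemma is_cokernelI:
  assumes "arrow C X Y f" "arrow C Y Q q" "q \<cdot>\<^bsub>C\<^esub> f = hzero C X Q"
    and "\<And>T t. \<lbrakk>arrow C Y T t; t \<cdot>\<^bsub>C\<^esub> f = hzero C X T\<rbrakk> \<Longrightarrow> \<exists>u. arrow C Q T u \<and> u \<cdot>\<^bsub>C\<^esub> q = t"
    and "\<And>T u v. \<lbrakk>arrow C Q T u; arrow C Q T v; u \<cdot>\<^bsub>C\<^esub> q = v \<cdot>\<^bsub>C\<^esub> q\<rbrakk> \<Longrightarrow> u = v"
  shows "is_cokernel C X Y f Q q"
proof -
  have "\<exists>!u. u \<in> Hom C Q T \<and> u \<cdot>\<^bsub>C\<^esub> q = t"
    if "T \<in> Obj C" "t \<in> Hom C Y T" "t \<cdot>\<^bsub>C\<^esub> f = hzero C X T" for T t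
    using assms(4)[of T t] assms(5)[of T] that assms(1,2) unfolding arrow_def by metis
  then show ?thesis using assms(1-3) unfolding is_cokernel_def arrow_def by blast
qed

text \<open>With \<open>Q\<close> zero, an arrow that kills \<open>f\<close> factors through
  \<open>Q\<close> and vanishes. With \<open>f\<close> epi, \<open>q\<close> itself vanishes, so
  identity and zero of \<open>Q\<close> agree after \<open>q\<close>. Applied to the boundary arrow,
  this turns vanishing cohomology into surjectivity onto the cocycles.\<close>

lemma cokernel_zero_iff_epi:
  assumes q: "is_cokernel C X Y f Q q"
  shows "is_zero_object C Q \<longleftrightarrow> is_epi C X Y f"
proof
  note d = is_cokernelD[OF q]
  assume Z: "is_zero_object C Q"
  show "is_epi C X Y f"
    unfolding is_epi_iff[OF d(1)]
  proof (intro allI impI)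
    fix T s assume s: "arrow C Y T s" "s \<cdot>\<^bsub>C\<^esub> f = hzero C X T"
    then obtain u where u: "arrow C Q T u" "u \<cdot>\<^bsub>C\<^esub> q = s" using cokernel_extend[OF q] by blast
    then show "s = hzero C Y T"
      using arrow_from_zero[OF Z u(1)] comp_zero_left[OF d(2)] arrowD by metis
  qed
next
  note d = is_cokernelD[OF q]
  assume e: "is_epi C X Y f"
  have Q: "Q \<in> Obj C" using arrowD[OF d(2)] by blast
  have "q = hzero C Y Q"
    using e is_epi_iff[OF d(1)] d(2,3) by blast
  then have "Ident C Q \<cdot>\<^bsub>C\<^esub> q = hzero C Q Q \<cdot>\<^bsub>C\<^esub> q"
    using comp_id_left[OF d(2)] comp_zero_left[OF d(2) Q] by simp
  then have "Ident C Q = hzero C Q Q"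
    using cokernel_cancel[OF q] arrow_ident[OF Q] arrow_zero[OF Q Q] by blast
  then show "is_zero_object C Q" using Q is_zero_object_iff by blast
qed

text \<open>In the glued category one kernel is assembled by hand from components; this carries the
  kernel property of those components over to the components of every other kernel.\<close>

lemma kernel_precompose_iso:
  assumes k: "is_kernel C X Y f K k" and p: "arrow C L K p" "is_iso C L K p"
  shows "is_kernel C X Y f L (k \<cdot>\<^bsub>C\<^esub> p)"
proof -
  obtain p' where p': "is_inverse C L K p p'" using p is_iso_def by metis
  have a: "arrow C K L p'" using p' p arrowD by (auto simp: is_inverse_def arrow_def)
  note d = is_kernelD[OF k]
  have L: "L \<in> Obj C" using a by (auto simp: arrow_def)
  show ?thesis
  proof (rule is_kernelI)
    show "arrow C X Y f" by fact
    show "arrow C L X (k \<cdot>\<^bsub>C\<^esub> p)" using arrow_comp[OF p(1) d(2)] .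
    show "f \<cdot>\<^bsub>C\<^esub> (k \<cdot>\<^bsub>C\<^esub> p) = hzero C L Y"
      using assoc[OF p(1) d(2,1)] d(3) comp_zero_left[OF p(1)] arrowD[OF d(1)] by metis
  next
    fix T t assume "arrow C T X t" "f \<cdot>\<^bsub>C\<^esub> t = hzero C T Y"
    then obtain u where u: "arrow C T K u" "k \<cdot>\<^bsub>C\<^esub> u = t" using kernel_lift[OF k] by blast
    have "p \<cdot>\<^bsub>C\<^esub> (p' \<cdot>\<^bsub>C\<^esub> u) = u"
      using assoc[OF u(1) a p(1)] p' comp_id_left[OF u(1)] by (simp add: is_inverse_def)
    then have "(k \<cdot>\<^bsub>C\<^esub> p) \<cdot>\<^bsub>C\<^esub> (p' \<cdot>\<^bsub>C\<^esub> u) = t"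
      using assoc[OF arrow_comp[OF u(1) a] p(1) d(2)] u by simp
    then show "\<exists>u. arrow C T L u \<and> (k \<cdot>\<^bsub>C\<^esub> p) \<cdot>\<^bsub>C\<^esub> u = t" using arrow_comp[OF u(1) a] by blast
  next
    fix T u v assume uv: "arrow C T L u" "arrow C T L v" "(k \<cdot>\<^bsub>C\<^esub> p) \<cdot>\<^bsub>C\<^esub> u = (k \<cdot>\<^bsub>C\<^esub> p) \<cdot>\<^bsub>C\<^esub> v"
    then have "k \<cdot>\<^bsub>C\<^esub> (p \<cdot>\<^bsub>C\<^esub> u) = k \<cdot>\<^bsub>C\<^esub> (p \<cdot>\<^bsub>C\<^esub> v)"
      using assoc[OF _ p(1) d(2)] by metis
    then have "p \<cdot>\<^bsub>C\<^esub> u = p \<cdot>\<^bsub>C\<^esub> v"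
      using kernel_cancel[OF k] arrow_comp[OF _ p(1)] uv by blast
    then have "p' \<cdot>\<^bsub>C\<^esub> (p \<cdot>\<^bsub>C\<^esub> u) = p' \<cdot>\<^bsub>C\<^esub> (p \<cdot>\<^bsub>C\<^esub> v)" by simp
    then show "u = v"
      using assoc[OF uv(1) p(1) a] assoc[OF uv(2) p(1) a] p' comp_id_left[OF uv(1)]
        comp_id_left[OF uv(2)] by (simp add: is_inverse_def)
  qed
qed

lemma cokernel_postcompose_iso:
  assumes k: "is_cokernel C X Y f Q q" and p: "arrow C Q L p" "is_iso C Q L p"
  shows "is_cokernel C X Y f L (p \<cdot>\<^bsub>C\<^esub> q)"
proof -
  obtain p' where p': "is_inverse C Q L p p'" using p is_iso_def by metis
  have a: "arrow C L Q p'" using p' p arrowD by (auto simp: is_inverse_def arrow_def)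
  note d = is_cokernelD[OF k]
  show ?thesis
  proof (rule is_cokernelI)
    show "arrow C X Y f" by fact
    show "arrow C Y L (p \<cdot>\<^bsub>C\<^esub> q)" using arrow_comp[OF d(2) p(1)] .
    show "(p \<cdot>\<^bsub>C\<^esub> q) \<cdot>\<^bsub>C\<^esub> f = hzero C X L"
      using assoc[OF d(1,2) p(1)] d(3) comp_zero_right[OF _ p(1)] arrowD[OF d(1)] by metis
  next
    fix T t assume "arrow C Y T t" "t \<cdot>\<^bsub>C\<^esub> f = hzero C X T"
    then obtain u where u: "arrow C Q T u" "u \<cdot>\<^bsub>C\<^esub> q = t" using cokernel_extend[OF k] by blast
    have "(u \<cdot>\<^bsub>C\<^esub> p') \<cdot>\<^bsub>C\<^esub> p = u"
      using assoc[OF p(1) a u(1)] p' comp_id_right[OF u(1)] by (simp add: is_inverse_def)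
    then have "(u \<cdot>\<^bsub>C\<^esub> p') \<cdot>\<^bsub>C\<^esub> (p \<cdot>\<^bsub>C\<^esub> q) = t"
      using assoc[OF d(2) p(1) arrow_comp[OF a u(1)]] u by simp
    then show "\<exists>u. arrow C L T u \<and> u \<cdot>\<^bsub>C\<^esub> (p \<cdot>\<^bsub>C\<^esub> q) = t" using arrow_comp[OF a u(1)] by blast
  next
    fix T u v assume uv: "arrow C L T u" "arrow C L T v" "u \<cdot>\<^bsub>C\<^esub> (p \<cdot>\<^bsub>C\<^esub> q) = v \<cdot>\<^bsub>C\<^esub> (p \<cdot>\<^bsub>C\<^esub> q)"
    then have "(u \<cdot>\<^bsub>C\<^esub> p) \<cdot>\<^bsub>C\<^esub> q = (v \<cdot>\<^bsub>C\<^esub> p) \<cdot>\<^bsub>C\<^esub> q"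
      using assoc[OF d(2) p(1)] by metis
    then have "u \<cdot>\<^bsub>C\<^esub> p = v \<cdot>\<^bsub>C\<^esub> p"
      using cokernel_cancel[OF k] arrow_comp[OF p(1)] uv by blast
    then have "(u \<cdot>\<^bsub>C\<^esub> p) \<cdot>\<^bsub>C\<^esub> p' = (v \<cdot>\<^bsub>C\<^esub> p) \<cdot>\<^bsub>C\<^esub> p'" by simp
    then show "u = v"
      using assoc[OF a p(1) uv(1)] assoc[OF a p(1) uv(2)] p' comp_id_right[OF uv(1)]
        comp_id_right[OF uv(2)] by (simp add: is_inverse_def)
  qed
qed

lemma kernel_unique:
  assumes k: "is_kernel C X Y f K k" and l: "is_kernel C X Y f L l"
  shows "\<exists>p. arrow C K L p \<and> is_iso C K L p \<and> l \<cdot>\<^bsub>C\<^esub> p = k"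
proof -
  note dk = is_kernelD[OF k] and dl = is_kernelD[OF l]
  obtain p where p: "arrow C K L p" "l \<cdot>\<^bsub>C\<^esub> p = k" using kernel_lift[OF l dk(2,3)] by blast
  obtain r where r: "arrow C L K r" "k \<cdot>\<^bsub>C\<^esub> r = l" using kernel_lift[OF k dl(2,3)] by blast
  have o: "K \<in> Obj C" "L \<in> Obj C" using p arrowD by auto
  have "k \<cdot>\<^bsub>C\<^esub> (r \<cdot>\<^bsub>C\<^esub> p) = k \<cdot>\<^bsub>C\<^esub> Ident C K"
    using assoc[OF p(1) r(1) dk(2)] p r comp_id_right[OF dk(2)] by simp
  then have 1: "r \<cdot>\<^bsub>C\<^esub> p = Ident C K"
    using kernel_cancel[OF k arrow_comp[OF p(1) r(1)] arrow_ident] o by blast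
  have "l \<cdot>\<^bsub>C\<^esub> (p \<cdot>\<^bsub>C\<^esub> r) = l \<cdot>\<^bsub>C\<^esub> Ident C L"
    using assoc[OF r(1) p(1) dl(2)] p r comp_id_right[OF dl(2)] by simp
  then have "p \<cdot>\<^bsub>C\<^esub> r = Ident C L"
    using kernel_cancel[OF l arrow_comp[OF r(1) p(1)] arrow_ident] o by blast
  with 1 show ?thesis using is_isoI[OF p(1) r(1)] p(2) p(1) by blast
qed

lemma cokernel_unique:
  assumes k: "is_cokernel C X Y f K k" and l: "is_cokernel C X Y f L l"
  shows "\<exists>p. arrow C K L p \<and> is_iso C K L p \<and> p \<cdot>\<^bsub>C\<^esub> k = l"
proof -
  note dk = is_cokernelD[OF k] and dl = is_cokernelD[OF l]
  obtain p where p: "arrow C K L p" "p \<cdot>\<^bsub>C\<^esub> k = l" using cokernel_extend[OF k dl(2,3)] by blast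
  obtain r where r: "arrow C L K r" "r \<cdot>\<^bsub>C\<^esub> l = k" using cokernel_extend[OF l dk(2,3)] by blast
  have o: "K \<in> Obj C" "L \<in> Obj C" using p arrowD by auto
  have "(r \<cdot>\<^bsub>C\<^esub> p) \<cdot>\<^bsub>C\<^esub> k = Ident C K \<cdot>\<^bsub>C\<^esub> k"
    using assoc[OF dk(2) p(1) r(1)] p r comp_id_left[OF dk(2)] by simp
  then have 1: "r \<cdot>\<^bsub>C\<^esub> p = Ident C K"
    using cokernel_cancel[OF k arrow_comp[OF p(1) r(1)] arrow_ident] o by blast
  have "(p \<cdot>\<^bsub>C\<^esub> r) \<cdot>\<^bsub>C\<^esub> l = Ident C L \<cdot>\<^bsub>C\<^esub> l"
    using assoc[OF dl(2) r(1) p(1)] p r comp_id_left[OF dl(2)] by simp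
  then have "p \<cdot>\<^bsub>C\<^esub> r = Ident C L"
    using cokernel_cancel[OF l arrow_comp[OF r(1) p(1)] arrow_ident] o by blast
  with 1 show ?thesis using is_isoI[OF p(1) r(1)] p(2) p(1) by blast
qed

text \<open>Needed for the shift, whose differential carries a sign: \<open>f\<close> and
  \<open>-f\<close> kill the same arrows.\<close>

lemma kernel_neg:
  assumes k: "is_kernel C X Y f K k"
  shows "is_kernel C X Y (hneg C X Y f) K k"
proof -
  note d = is_kernelD[OF k]
  have "f \<cdot>\<^bsub>C\<^esub> t = hzero C T Y" if "arrow C T X t" "hneg C X Y f \<cdot>\<^bsub>C\<^esub> t = hzero C T Y" for T t
    using that comp_neg_left[OF that(1) d(1)] neg_neg[OF arrow_comp[OF that(1) d(1)]]
      neg_zero arrowD d(1) by metis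
  moreover have "hneg C X Y f \<cdot>\<^bsub>C\<^esub> k = hzero C K Y"
    using d comp_neg_left[OF d(2,1)] neg_zero arrowD by metis
  ultimately show ?thesis
    using is_kernelI[OF arrow_neg[OF d(1)] d(2)] kernel_lift[OF k] kernel_cancel[OF k] by blast
qed

lemma cokernel_neg:
  assumes k: "is_cokernel C X Y f Q q"
  shows "is_cokernel C X Y (hneg C X Y f) Q q"
proof -
  note d = is_cokernelD[OF k]
  have "t \<cdot>\<^bsub>C\<^esub> f = hzero C X T" if "arrow C Y T t" "t \<cdot>\<^bsub>C\<^esub> hneg C X Y f = hzero C X T" for T t
    using that comp_neg_right[OF d(1) that(1)] neg_neg[OF arrow_comp[OF d(1) that(1)]]
      neg_zero arrowD d(1) by metis
  moreover have "q \<cdot>\<^bsub>C\<^esub> hneg C X Y f = hzero C X Q"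
    using d comp_neg_right[OF d(1,2)] neg_zero arrowD by metis
  ultimately show ?thesis
    using is_cokernelI[OF arrow_neg[OF d(1)] d(2)] cokernel_extend[OF k] cokernel_cancel[OF k] by blast
qed

end

section \<open>Zigzags and localizations\<close>

locale localizing = category C for C :: "('o, 'm, 'z) cat_scheme" (structure) +
  fixes W :: "'o \<Rightarrow> 'o \<Rightarrow> 'm set"
  assumes W_arrow: "\<lbrakk>X \<in> Obj C; Y \<in> Obj C; w \<in> W X Y\<rbrakk> \<Longrightarrow> arrow C X Y w"
begin

lemma zigzag_append: "\<lbrakk>zigzag C W X p Y; zigzag C W Y q Z\<rbrakk> \<Longrightarrow> zigzag C W X (p @ q) Z"
  by (induction rule: zigzag.induct) (auto intro: zigzag.intros)

lemma zigzag_Fwd: "arrow C X Y f \<Longrightarrow> zigzag C W X [Fwd X f Y] Y"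
  by (auto simp: arrow_def intro: zigzag.intros)

lemma zigzag_Bwd: "\<lbrakk>X \<in> Obj C; Y \<in> Obj C; w \<in> W X Y\<rbrakk> \<Longrightarrow> zigzag C W Y [Bwd X w Y] X"
  by (auto intro: zigzag.intros)

lemma zz_eq_zigzag: "zz_eq C W X Y p q \<Longrightarrow> zigzag C W X p Y \<and> zigzag C W X q Y"
proof (induction rule: zz_eq.induct)
  case (zz_comp X Y Z f g)
  then show ?case
    using zigzag_append[OF zigzag_Fwd zigzag_Fwd, of X Y f Z g] zigzag_Fwd[OF arrow_comp, of X Y f Z g]
    by (simp add: arrow_def)
next
  case (zz_fwd_bwd X Y w)
  then show ?case
    using zigzag_append[OF zigzag_Fwd zigzag_Bwd, of X Y w X w] W_arrow[of X Y w]
    by (auto intro: zigzag.intros)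
next
  case (zz_bwd_fwd X Y w)
  then show ?case
    using zigzag_append[OF zigzag_Bwd zigzag_Fwd, of X Y w Y w] W_arrow[of X Y w]
    by (auto intro: zigzag.intros)
qed (auto intro: zigzag_append zigzag_Fwd zigzag.intros arrow_ident)

lemma zz_cong_left: "\<lbrakk>zz_eq C W X Y p p'; zigzag C W Y q Z\<rbrakk> \<Longrightarrow> zz_eq C W X Z (p @ q) (p' @ q)"
  by (blast intro: zz_append zz_refl)

lemma zz_cong_right: "\<lbrakk>zigzag C W X p Y; zz_eq C W Y Z q q'\<rbrakk> \<Longrightarrow> zz_eq C W X Z (p @ q) (p @ q')"
  by (blast intro: zz_append zz_refl)

lemma zz_cong_mid:
  "\<lbrakk>zigzag C W X r Y; zz_eq C W Y Z p p'; zigzag C W Z s U\<rbrakk>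
    \<Longrightarrow> zz_eq C W X U (r @ p @ s) (r @ p' @ s)"
  by (blast intro: zz_append zz_refl)

lemma zz_Fwd_Fwd:
  "\<lbrakk>arrow C X Y f; arrow C Y Z g\<rbrakk> \<Longrightarrow> zz_eq C W X Z [Fwd X f Y, Fwd Y g Z] [Fwd X (g \<cdot> f) Z]"
  by (auto simp: arrow_def intro: zz_comp)

lemma W_fwd_bwd:
  "\<lbrakk>X \<in> Obj C; Y \<in> Obj C; w \<in> W X Y\<rbrakk> \<Longrightarrow> zz_eq C W X X [Fwd X w Y, Bwd X w Y] []"
  by (rule zz_fwd_bwd)

lemma W_bwd_fwd:
  "\<lbrakk>X \<in> Obj C; Y \<in> Obj C; w \<in> W X Y\<rbrakk> \<Longrightarrow> zz_eq C W Y Y [Bwd X w Y, Fwd X w Y] []"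
  by (rule zz_bwd_fwd)

text \<open>Well-formedness puts \<open>p\<close> into its own class by reflexivity; two ill-formed
  words would share the empty class.\<close>

lemma zz_class_eq_iff:
  assumes "zigzag C W X p Y"
  shows "zz_class C W X p Y = zz_class C W X q Y \<longleftrightarrow> zz_eq C W X Y p q"
proof
  assume "zz_class C W X p Y = zz_class C W X q Y"
  moreover have "(X, p, Y) \<in> zz_class C W X p Y" using assms by (simp add: zz_class_def zz_refl)
  ultimately have "(X, p, Y) \<in> zz_class C W X q Y" by simp
  then show "zz_eq C W X Y p q" by (auto simp: zz_class_def intro: zz_sym)
next
  assume e: "zz_eq C W X Y p q"
  have "zz_eq C W X Y p r \<longleftrightarrow> zz_eq C W X Y q r" for r
    using e zz_trans zz_sym by metis
  then show "zz_class C W X p Y = zz_class C W X q Y" by (simp add: zz_class_def)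
qed

abbreviation L where "L \<equiv> localization C W"

lemma Obj_localization: "Obj L = Obj C"
  by (simp add: localization_def)

lemma Ident_localization: "Ident L X = zz_class C W X [] X"
  by (simp add: localization_def)

lemma Hom_localization: "Hom L X Y = {zz_class C W X p Y | p. zigzag C W X p Y}"
  by (simp add: localization_def)

text \<open>The union defining the composite ranges over all pairs of representatives. The
  congruence rule \<open>zz_append\<close> makes all of them yield one class, so it is the union of
  a singleton.\<close>

lemma Comp_localization:
  assumes p: "zigzag C W X p Y" and q: "zigzag C W Y q Z"
  shows "zz_class C W Y q Z \<cdot>\<^bsub>L\<^esub> zz_class C W X p Y = zz_class C W X (p @ q) Z"
proof -
  have "zz_class C W X' (p' @ q') Z' = zz_class C W X (p @ q) Z"
    if "(X', p', Y') \<in> zz_class C W X p Y" "(Y', q', Z') \<in> zz_class C W Y q Z" for X' p' Y' q' Z'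
  proof -
    have e: "X' = X" "Y' = Y" "Z' = Z" "zz_eq C W X Y p p'" "zz_eq C W Y Z q q'"
      using that by (auto simp: zz_class_def)
    then show ?thesis
      using iffD2[OF zz_class_eq_iff[OF zigzag_append[OF p q]] zz_append[OF e(4,5)]] by simp
  qed
  moreover have "(X, p, Y) \<in> zz_class C W X p Y" "(Y, q, Z) \<in> zz_class C W Y q Z"
    using p q by (auto simp: zz_class_def zz_refl)
  ultimately have "{zz_class C W X' (p' @ q') Z' | X' p' Y' q' Z'.
      (X', p', Y') \<in> zz_class C W X p Y \<and> (Y', q', Z') \<in> zz_class C W Y q Z} = {zz_class C W X (p @ q) Z}"
    by blast
  then show ?thesis by (simp add: localization_def)
qed

lemma Hom_localizationE:
  assumes "\<alpha> \<in> Hom L X Y"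
  obtains p where "zigzag C W X p Y" "\<alpha> = zz_class C W X p Y"
  using assms by (auto simp: Hom_localization)

lemma zz_class_Hom: "zigzag C W X p Y \<Longrightarrow> zz_class C W X p Y \<in> Hom L X Y"
  by (auto simp: Hom_localization)

lemma category_localization: "category L"
proof
  fix X assume "X \<in> Obj L"
  then show "Ident L X \<in> Hom L X X"
    by (auto simp: Obj_localization Ident_localization intro: zz_class_Hom zz_nil)
next
  fix X Y Z f g assume "f \<in> Hom L X Y" "g \<in> Hom L Y Z"
  then show "g \<cdot>\<^bsub>L\<^esub> f \<in> Hom L X Z"
    by (elim Hom_localizationE) (auto simp: Comp_localization intro: zz_class_Hom zigzag_append)
next
  fix X Y f assume "X \<in> Obj L" "f \<in> Hom L X Y"
  then show "f \<cdot>\<^bsub>L\<^esub> Ident L X = f"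
    by (elim Hom_localizationE)
       (auto simp: Comp_localization[of X "[]"] Ident_localization Obj_localization zz_nil)
next
  fix X Y f assume "Y \<in> Obj L" "f \<in> Hom L X Y"
  then show "Ident L Y \<cdot>\<^bsub>L\<^esub> f = f"
    by (elim Hom_localizationE)
       (auto simp: Comp_localization[of _ _ Y "[]"] Ident_localization Obj_localization zz_nil)
next
  fix V X Y Z f g h assume "f \<in> Hom L V X" "g \<in> Hom L X Y" "h \<in> Hom L Y Z"
  then show "h \<cdot>\<^bsub>L\<^esub> g \<cdot>\<^bsub>L\<^esub> f = h \<cdot>\<^bsub>L\<^esub> (g \<cdot>\<^bsub>L\<^esub> f)"
    by (elim Hom_localizationE) (auto simp: Comp_localization zigzag_append)
qed

text \<open>Representatives replace classes here, so that any interpretation of zigzags that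
  respects \<open>zz_eq\<close> can be applied to an isomorphism.\<close>

lemma isomorphic_localization_iff:
  "isomorphic L X Y \<longleftrightarrow> (\<exists>p q. zigzag C W X p Y \<and> zigzag C W Y q X \<and>
     zz_eq C W X X (p @ q) [] \<and> zz_eq C W Y Y (q @ p) [])"
proof
  assume "isomorphic L X Y"
  then obtain \<alpha> \<beta> where ab: "is_inverse L X Y \<alpha> \<beta>" by (auto simp: isomorphic_def is_iso_def)
  then have "\<alpha> \<in> Hom L X Y" "\<beta> \<in> Hom L Y X" by (auto simp: is_inverse_def)
  then obtain p q where p: "zigzag C W X p Y" "\<alpha> = zz_class C W X p Y"
    and q: "zigzag C W Y q X" "\<beta> = zz_class C W Y q X"
    by (auto elim!: Hom_localizationE)
  have "zz_class C W X (p @ q) X = zz_class C W X [] X"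
    "zz_class C W Y (q @ p) Y = zz_class C W Y [] Y"
    using ab p q by (auto simp: is_inverse_def Ident_localization Comp_localization)
  then have "zz_eq C W X X (p @ q) []" "zz_eq C W Y Y (q @ p) []"
    using zz_class_eq_iff zigzag_append p(1) q(1) by metis+
  with p q show "\<exists>p q. zigzag C W X p Y \<and> zigzag C W Y q X \<and>
     zz_eq C W X X (p @ q) [] \<and> zz_eq C W Y Y (q @ p) []" by blast
next
  assume "\<exists>p q. zigzag C W X p Y \<and> zigzag C W Y q X \<and>
     zz_eq C W X X (p @ q) [] \<and> zz_eq C W Y Y (q @ p) []"
  then obtain p q where pq: "zigzag C W X p Y" "zigzag C W Y q X"
    "zz_eq C W X X (p @ q) []" "zz_eq C W Y Y (q @ p) []" by blast
  have "is_inverse L X Y (zz_class C W X p Y) (zz_class C W Y q X)"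
    using pq zz_class_eq_iff[OF zigzag_append[OF pq(1,2)]] zz_class_eq_iff[OF zigzag_append[OF pq(2,1)]]
    by (auto simp: is_inverse_def Ident_localization Comp_localization intro: zz_class_Hom)
  then show "isomorphic L X Y" by (auto simp: isomorphic_def is_iso_def)
qed

lemma isomorphic_if_W:
  assumes "X \<in> Obj C" "Y \<in> Obj C" "w \<in> W X Y"
  shows "isomorphic L X Y"
proof -
  have "zz_eq C W X X ([Fwd X w Y] @ [Bwd X w Y]) []" "zz_eq C W Y Y ([Bwd X w Y] @ [Fwd X w Y]) []"
    using W_fwd_bwd[OF assms] W_bwd_fwd[OF assms] by auto
  then show ?thesis
    unfolding isomorphic_localization_iff
    using zigzag_Fwd[OF W_arrow[OF assms]] zigzag_Bwd[OF assms] by blast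
qed

text \<open>A terminal object stays terminal: the induction peels the zigzag off at its source and
  absorbs each step into the unique arrow to \<open>Z\<close>. The endpoint enters through the
  premise \<open>Y = Z\<close>, which keeps it a variable for the induction.\<close>

lemma zigzag_to_zero:
  assumes O: "is_zero_object C Z" and p: "zigzag C W X p Y"
  shows "Y = Z \<Longrightarrow> arrow C X Z t \<Longrightarrow> zz_eq C W X Z p [Fwd X t Z]"
  using p
proof (induction arbitrary: t rule: zigzag.induct)
  case (zz_nil X)
  then have "t = Ident C X"
    using to_zero_object_unique[OF O] arrow_ident by blast
  then show ?case using zz_sym[OF zz_ident[of X C W]] zz_nil by simp
next
  case (zz_fwd X Y f p U)
  obtain s where s: "arrow C Y Z s"
    using ex_arrow_to_zero_object[OF O \<open>Y \<in> Obj C\<close>] by blast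
  have f: "arrow C X Y f" using zz_fwd by (simp add: arrow_def)
  have t: "t = s \<cdot> f" using to_zero_object_unique[OF O] arrow_comp[OF f s] zz_fwd by blast
  have "zz_eq C W X Z ([Fwd X f Y] @ p) ([Fwd X f Y] @ [Fwd Y s Z])"
    using zz_cong_right[OF zigzag_Fwd[OF f]] zz_fwd s by blast
  then show ?case using zz_trans[OF _ zz_Fwd_Fwd[OF f s]] t by simp
next
  case (zz_bwd X Y w p U)
  obtain s where s: "arrow C X Z s"
    using ex_arrow_to_zero_object[OF O \<open>X \<in> Obj C\<close>] by blast
  note w = W_arrow[OF zz_bwd(1-3)]
  \<comment> \<open>The arrow to \<open>Z\<close> from the source of \<open>w\<close> is forced to
    be \<open>t\<close> after \<open>w\<close>, so the backward step along \<open>w\<close> cancels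
    and leaves \<open>t\<close>.\<close>
  have e: "s = t \<cdot> w" using to_zero_object_unique[OF O] arrow_comp[OF w] s zz_bwd by blast
  note b = zigzag_Bwd[OF zz_bwd(1-3)]
  have "zz_eq C W Y Z ([Bwd X w Y] @ p) ([Bwd X w Y] @ [Fwd X s Z])"
    using zz_cong_right[OF b] zz_bwd s by blast
  moreover have "zz_eq C W Y Z ([Bwd X w Y] @ [Fwd X s Z]) ([Bwd X w Y] @ [Fwd X w Y, Fwd Y t Z])"
    unfolding e using zz_cong_right[OF b zz_sym[OF zz_Fwd_Fwd[OF w]]] zz_bwd by blast
  moreover have "zz_eq C W Y Z ([Bwd X w Y, Fwd X w Y] @ [Fwd Y t Z]) ([] @ [Fwd Y t Z])"
    using zz_cong_left[OF W_bwd_fwd[OF zz_bwd(1-3)] zigzag_Fwd] zz_bwd by blast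
  ultimately show ?case by (auto intro: zz_trans)
qed

text \<open>The induction consumes the zigzag from the end at which \<open>Z\<close> sits, so an
  arrow \<open>s\<close> out of \<open>Z\<close> is carried along as an accumulator that swallows
  the steps one by one.\<close>

lemma zigzag_from_zero_aux:
  assumes O: "is_zero_object C Z" and p: "zigzag C W Y p X"
  shows "arrow C Z Y s \<Longrightarrow> arrow C Z X t \<Longrightarrow> zz_eq C W Z X ([Fwd Z s Y] @ p) [Fwd Z t X]"
  using p
proof (induction arbitrary: s rule: zigzag.induct)
  case (zz_nil X)
  then have "s = t" using from_zero_object_unique[OF O] by blast
  then show ?case using zz_refl[OF zigzag_Fwd[OF zz_nil.prems(1)]] by simp
next
  case (zz_fwd Y Y' f p U)
  have f: "arrow C Y Y' f" using zz_fwd by (simp add: arrow_def)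
  have "zz_eq C W Z U ([Fwd Z s Y, Fwd Y f Y'] @ p) ([Fwd Z (f \<cdot> s) Y'] @ p)"
    using zz_cong_left[OF zz_Fwd_Fwd[OF zz_fwd.prems(1) f]] zz_fwd by blast
  then show ?case using zz_trans[OF _ zz_fwd.IH[OF arrow_comp[OF zz_fwd.prems(1) f] zz_fwd.prems(2)]]
    by simp
next
  case (zz_bwd Y' Y w p U)
  note w = W_arrow[OF zz_bwd(1-3)]
  obtain s' where s': "arrow C Z Y' s'"
    using ex_arrow_from_zero_object[OF O \<open>Y' \<in> Obj C\<close>] by blast
  \<comment> \<open>Initiality of \<open>Z\<close> factors \<open>s\<close> through
    \<open>w\<close>, against which the backward step cancels.\<close>
  have e: "s = w \<cdot> s'" using from_zero_object_unique[OF O zz_bwd.prems(1) arrow_comp[OF s' w]] .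
  note b = zigzag_append[OF zigzag_Bwd[OF zz_bwd(1-3)] zz_bwd(4)]
  have "zz_eq C W Z U ([Fwd Z s Y] @ ([Bwd Y' w Y] @ p)) ([Fwd Z s' Y', Fwd Y' w Y] @ ([Bwd Y' w Y] @ p))"
    unfolding e using zz_cong_left[OF zz_sym[OF zz_Fwd_Fwd[OF s' w]] b] .
  moreover have "zz_eq C W Z U ([Fwd Z s' Y'] @ [Fwd Y' w Y, Bwd Y' w Y] @ p) ([Fwd Z s' Y'] @ [] @ p)"
    using zz_cong_mid[OF zigzag_Fwd[OF s'] W_fwd_bwd[OF zz_bwd(1-3)] zz_bwd(4)] .
  moreover have "zz_eq C W Z U ([Fwd Z s' Y'] @ p) [Fwd Z t U]"
    using zz_bwd.IH[OF s' zz_bwd.prems(2)] .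
  ultimately show ?case by (auto intro: zz_trans)
qed

lemma zigzag_from_zero:
  assumes O: "is_zero_object C Z" and p: "zigzag C W Z p X" and t: "arrow C Z X t"
  shows "zz_eq C W Z X p [Fwd Z t X]"
proof -
  have Z: "Z \<in> Obj C" using t by (simp add: arrow_def)
  have "zz_eq C W Z X ([] @ p) ([Fwd Z (Ident C Z) Z] @ p)"
    using zz_cong_left[OF zz_sym[OF zz_ident[of Z C W]] p] Z by blast
  then show ?thesis using zz_trans zigzag_from_zero_aux[OF O p arrow_ident[OF Z] t] by fastforce
qed

lemma zero_object_localization:
  assumes O: "is_zero_object C Z"
  shows "is_zero_object L Z"
proof -
  have "Z \<in> Obj C" using O by (simp add: is_zero_object_def)
  moreover have "\<exists>!f. f \<in> Hom L X Z" if X: "X \<in> Obj C" for X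
  proof -
    obtain t where t: "arrow C X Z t" using ex_arrow_to_zero_object[OF O X] by blast
    show ?thesis
    proof (rule ex1I)
      show "zz_class C W X [Fwd X t Z] Z \<in> Hom L X Z" using zz_class_Hom[OF zigzag_Fwd[OF t]] .
    next
      fix f assume "f \<in> Hom L X Z"
      then obtain p where p: "zigzag C W X p Z" "f = zz_class C W X p Z" by (rule Hom_localizationE)
      then show "f = zz_class C W X [Fwd X t Z] Z"
        using zz_class_eq_iff[OF p(1)] zigzag_to_zero[OF O p(1) refl t] by simp
    qed
  qed
  moreover have "\<exists>!f. f \<in> Hom L Z X" if X: "X \<in> Obj C" for X
  proof -
    obtain t where t: "arrow C Z X t" using ex_arrow_from_zero_object[OF O X] by blast
    show ?thesis
    proof (rule ex1I)
      show "zz_class C W Z [Fwd Z t X] X \<in> Hom L Z X" using zz_class_Hom[OF zigzag_Fwd[OF t]] .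
    next
      fix f assume "f \<in> Hom L Z X"
      then obtain p where p: "zigzag C W Z p X" "f = zz_class C W Z p X" by (rule Hom_localizationE)
      then show "f = zz_class C W Z [Fwd Z t X] X"
        using zz_class_eq_iff[OF p(1)] zigzag_from_zero[OF O p(1) t] by simp
    qed
  qed
  ultimately show ?thesis by (simp add: is_zero_object_def Obj_localization)
qed

end

section \<open>Functors between localizations, and natural transformations along zigzags\<close>

lemma is_functorD:
  assumes "is_functor C D F"
  shows "\<And>X. X \<in> Obj C \<Longrightarrow> fob F X \<in> Obj D"
    and "\<And>X. X \<in> Obj C \<Longrightarrow> fmor F (Ident C X) = Ident D (fob F X)"
    and "\<And>X Y f. arrow C X Y f \<Longrightarrow> arrow D (fob F X) (fob F Y) (fmor F f)"
    and "\<And>X Y Z f g. \<lbrakk>arrow C X Y f; arrow C Y Z g\<rbrakk>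
      \<Longrightarrow> fmor F (g \<cdot>\<^bsub>C\<^esub> f) = fmor F g \<cdot>\<^bsub>D\<^esub> fmor F f"
  using assms unfolding is_functor_def arrow_def by blast+

locale localizing_functor = S: localizing C W + T: localizing D V
  for C :: "('o, 'm, 'z) cat_scheme" and W :: "'o \<Rightarrow> 'o \<Rightarrow> 'm set"
    and D :: "('p, 'n, 'y) cat_scheme" and V :: "'p \<Rightarrow> 'p \<Rightarrow> 'n set" +
  fixes F :: "('o, 'm, 'p, 'n) functor_data"
  assumes F: "is_functor C D F"
    and F_W: "\<lbrakk>X \<in> Obj C; Y \<in> Obj C; w \<in> W X Y\<rbrakk> \<Longrightarrow> fmor F w \<in> V (fob F X) (fob F Y)"
begin

lemmas F_obj = is_functorD(1)[OF F] and F_ident = is_functorD(2)[OF F]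
  and F_arrow = is_functorD(3)[OF F] and F_comp = is_functorD(4)[OF F]

abbreviation Fz where "Fz p \<equiv> map (map_zz_step F) p"

lemma zigzag_map: "zigzag C W X p Y \<Longrightarrow> zigzag D V (fob F X) (Fz p) (fob F Y)"
proof (induction rule: zigzag.induct)
  case (zz_fwd X Y f p Z)
  then show ?case using F_arrow[of X Y f] by (auto simp: arrow_def intro: zigzag.zz_fwd)
qed (auto intro: F_obj F_W zigzag.intros)

lemma zz_eq_map: "zz_eq C W X Y p q \<Longrightarrow> zz_eq D V (fob F X) (fob F Y) (Fz p) (Fz q)"
proof (induction rule: zz_eq.induct)
  case (zz_refl X p Y)
  show ?case by (rule zz_eq.zz_refl[OF zigzag_map[OF zz_refl]])
next
  case (zz_sym X Y p q)
  show ?case by (rule zz_eq.zz_sym[OF zz_sym.IH])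
next
  case (zz_trans X Y p q r)
  show ?case by (rule zz_eq.zz_trans[OF zz_trans.IH])
next
  case (zz_append X Y p p' Z q q')
  show ?case using zz_eq.zz_append[OF zz_append.IH] by simp
next
  case (zz_ident X)
  then show ?case using zz_eq.zz_ident[of "fob F X" D V] F_obj F_ident by simp
next
  case (zz_comp X Y Z f g)
  then have "arrow C X Y f" "arrow C Y Z g" by (auto simp: arrow_def)
  then show ?case using T.zz_Fwd_Fwd F_arrow F_comp by simp
next
  case (zz_fwd_bwd X Y w)
  then show ?case using T.W_fwd_bwd[OF F_obj F_obj F_W] by simp
next
  case (zz_bwd_fwd X Y w)
  then show ?case using T.W_bwd_fwd[OF F_obj F_obj F_W] by simp
qed

abbreviation LF where "LF \<equiv> localized_functor D V F"

lemma fob_localized: "fob LF = fob F"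
  by (simp add: localized_functor_def)

lemma fmor_localized:
  assumes p: "zigzag C W X p Y"
  shows "fmor LF (zz_class C W X p Y) = zz_class D V (fob F X) (Fz p) (fob F Y)"
proof -
  have "zz_class D V (fob F X') (Fz p') (fob F Y') = zz_class D V (fob F X) (Fz p) (fob F Y)"
    if "(X', p', Y') \<in> zz_class C W X p Y" for X' p' Y'
  proof -
    have e: "X' = X" "Y' = Y" "zz_eq C W X Y p p'" using that by (auto simp: zz_class_def)
    then show ?thesis
      using iffD2[OF T.zz_class_eq_iff[OF zigzag_map[OF p]] zz_eq_map[OF e(3)]] by simp
  qed
  moreover have "(X, p, Y) \<in> zz_class C W X p Y" using p by (auto simp: zz_class_def zz_refl)
  ultimately have "{zz_class D V (fob F X') (Fz p') (fob F Y') | X' p' Y'.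
      (X', p', Y') \<in> zz_class C W X p Y} = {zz_class D V (fob F X) (Fz p) (fob F Y)}"
    by blast
  then show ?thesis by (simp add: localized_functor_def)
qed

lemma is_functor_localized: "is_functor S.L T.L LF"
  unfolding is_functor_def
proof (intro conjI ballI)
  fix X assume "X \<in> Obj S.L"
  then have X: "X \<in> Obj C" by (simp add: S.Obj_localization)
  then show "fob LF X \<in> Obj T.L" by (simp add: fob_localized T.Obj_localization F_obj)
  show "fmor LF (Ident S.L X) = Ident T.L (fob LF X)"
    using fmor_localized[OF zz_nil[OF X]]
    by (simp add: S.Ident_localization T.Ident_localization fob_localized)
next
  fix X Y f assume "f \<in> Hom S.L X Y"
  then show "fmor LF f \<in> Hom T.L (fob LF X) (fob LF Y)"
    by (elim S.Hom_localizationE)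
       (auto simp: fmor_localized fob_localized intro: T.zz_class_Hom zigzag_map)
next
  fix X Y Z f g assume "f \<in> Hom S.L X Y" "g \<in> Hom S.L Y Z"
  then show "fmor LF (g \<cdot>\<^bsub>S.L\<^esub> f) = fmor LF g \<cdot>\<^bsub>T.L\<^esub> fmor LF f"
    by (elim S.Hom_localizationE)
       (auto simp: S.Comp_localization T.Comp_localization fmor_localized S.zigzag_append zigzag_map)
qed

lemma isomorphic_map:
  assumes "isomorphic S.L X Y"
  shows "isomorphic T.L (fob F X) (fob F Y)"
proof -
  obtain p q where pq: "zigzag C W X p Y" "zigzag C W Y q X"
     "zz_eq C W X X (p @ q) []" "zz_eq C W Y Y (q @ p) []"
    using assms unfolding S.isomorphic_localization_iff by blast
  have "zz_eq D V (fob F X) (fob F X) (Fz p @ Fz q) []" "zz_eq D V (fob F Y) (fob F Y) (Fz q @ Fz p) []"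
    using zz_eq_map[OF pq(3)] zz_eq_map[OF pq(4)] by auto
  with zigzag_map[OF pq(1)] zigzag_map[OF pq(2)] show ?thesis
    unfolding T.isomorphic_localization_iff by blast
qed

end

text \<open>Squares for the original arrows suffice: the square of a formal inverse follows from the
  square of \<open>w\<close> by conjugation with the inverses of \<open>F w\<close> and
  \<open>G w\<close>.\<close>

lemma zigzag_natural:
  assumes "localizing_functor C W D V F" "localizing_functor C W D V G"
    and eta: "\<And>X. X \<in> Obj C \<Longrightarrow> arrow D (fob F X) (fob G X) (\<eta> X)"
    and nat: "\<And>X Y f. arrow C X Y f \<Longrightarrow> \<eta> Y \<cdot>\<^bsub>D\<^esub> fmor F f = fmor G f \<cdot>\<^bsub>D\<^esub> \<eta> X"
    and p: "zigzag C W X p Y"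
  shows "zz_eq D V (fob F X) (fob G Y)
    (map (map_zz_step F) p @ [Fwd (fob F Y) (\<eta> Y) (fob G Y)])
    ([Fwd (fob F X) (\<eta> X) (fob G X)] @ map (map_zz_step G) p)"
  using p
proof (induction rule: zigzag.induct)
  interpret F: localizing_functor C W D V F by fact
  interpret G: localizing_functor C W D V G by fact
  {
    case (zz_nil X)
    then show ?case using zz_refl F.T.zigzag_Fwd eta by fastforce
  next
    case (zz_fwd X Y f p Z)
    have f: "arrow C X Y f" using zz_fwd by (simp add: arrow_def)
    note Ff = F.F_arrow[OF f] and Gf = G.F_arrow[OF f]
    note eX = eta[OF \<open>X \<in> Obj C\<close>] and eY = eta[OF \<open>Y \<in> Obj C\<close>]
    let ?Ff = "Fwd (fob F X) (fmor F f) (fob F Y)" and ?Gf = "Fwd (fob G X) (fmor G f) (fob G Y)"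
    let ?eX = "Fwd (fob F X) (\<eta> X) (fob G X)" and ?eY = "Fwd (fob F Y) (\<eta> Y) (fob G Y)"
    have "zz_eq D V (fob F X) (fob G Z) ([?Ff] @ (F.Fz p @ [Fwd (fob F Z) (\<eta> Z) (fob G Z)]))
        ([?Ff] @ ([?eY] @ G.Fz p))"
      using F.T.zz_cong_right[OF F.T.zigzag_Fwd[OF Ff] zz_fwd.IH] .
    moreover have "zz_eq D V (fob F X) (fob G Y) [?Ff, ?eY] [?eX, ?Gf]"
      using F.T.zz_Fwd_Fwd[OF Ff eY] zz_sym[OF F.T.zz_Fwd_Fwd[OF eX Gf]] nat[OF f]
      by (auto intro: zz_trans)
    then have "zz_eq D V (fob F X) (fob G Z) ([?Ff, ?eY] @ G.Fz p) ([?eX, ?Gf] @ G.Fz p)"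
      using F.T.zz_cong_left G.zigzag_map[OF zz_fwd(4)] by blast
    ultimately show ?case by (auto intro: zz_trans)
  next
    case (zz_bwd X Y w p Z)
    note w = F.S.W_arrow[OF zz_bwd(1-3)]
    note Fw = F.F_arrow[OF w] and Gw = G.F_arrow[OF w]
    note VF = F.F_obj[OF zz_bwd(1)] F.F_obj[OF zz_bwd(2)] F.F_W[OF zz_bwd(1-3)]
    note VG = G.F_obj[OF zz_bwd(1)] G.F_obj[OF zz_bwd(2)] G.F_W[OF zz_bwd(1-3)]
    note eX = eta[OF \<open>X \<in> Obj C\<close>] and eY = eta[OF \<open>Y \<in> Obj C\<close>]
    let ?bF = "Bwd (fob F X) (fmor F w) (fob F Y)" and ?bG = "Bwd (fob G X) (fmor G w) (fob G Y)"
    let ?fF = "Fwd (fob F X) (fmor F w) (fob F Y)" and ?fG = "Fwd (fob G X) (fmor G w) (fob G Y)"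
    let ?eX = "Fwd (fob F X) (\<eta> X) (fob G X)" and ?eY = "Fwd (fob F Y) (\<eta> Y) (fob G Y)"
    have "zz_eq D V (fob F Y) (fob G Z) ([?bF] @ (F.Fz p @ [Fwd (fob F Z) (\<eta> Z) (fob G Z)]))
        ([?bF] @ ([?eX] @ G.Fz p))"
      using F.T.zz_cong_right[OF F.T.zigzag_Bwd[OF VF] zz_bwd.IH] .
    \<comment> \<open>Append \<open>G w\<close> and its formal inverse, use the square of
      \<open>w\<close> in the middle, and cancel the inverse of \<open>F w\<close> against
      \<open>F w\<close> in front.\<close>
    moreover have "zz_eq D V (fob F Y) (fob G X) [?bF, ?eX] [?eY, ?bG]"
    proof -
      have "zz_eq D V (fob F X) (fob G Y) [?eX, ?fG] [?fF, ?eY]"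
        using F.T.zz_Fwd_Fwd[OF eX Gw] zz_sym[OF F.T.zz_Fwd_Fwd[OF Fw eY]] nat[OF w]
        by (auto intro: zz_trans)
      then have "zz_eq D V (fob F Y) (fob G X) ([?bF] @ [?eX, ?fG] @ [?bG]) ([?bF] @ [?fF, ?eY] @ [?bG])"
        using F.T.zz_cong_mid[OF F.T.zigzag_Bwd[OF VF]] F.T.zigzag_Bwd[OF VG] by blast
      moreover have "zz_eq D V (fob F Y) (fob G X) ([?bF, ?fF] @ ([?eY] @ [?bG])) ([] @ ([?eY] @ [?bG]))"
        using F.T.zz_cong_left[OF F.T.W_bwd_fwd[OF VF]
          F.T.zigzag_append[OF F.T.zigzag_Fwd[OF eY] F.T.zigzag_Bwd[OF VG]]] .
      moreover have "zz_eq D V (fob F Y) (fob G X) (([?bF] @ [?eX]) @ []) (([?bF] @ [?eX]) @ [?fG, ?bG])"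
        using F.T.zz_cong_right[OF F.T.zigzag_append[OF F.T.zigzag_Bwd[OF VF] F.T.zigzag_Fwd[OF eX]]
          zz_sym[OF F.T.W_fwd_bwd[OF VG]]] .
      ultimately show ?thesis by (auto intro: zz_trans)
    qed
    then have "zz_eq D V (fob F Y) (fob G Z) ([?bF, ?eX] @ G.Fz p) ([?eY, ?bG] @ G.Fz p)"
      using F.T.zz_cong_left G.zigzag_map[OF zz_bwd(4)] by blast
    ultimately show ?case by (auto intro: zz_trans)
  }
qed

section \<open>Evaluation of zigzags where the localized arrows become invertible\<close>

primrec zz_value ::
  "('p, 'n, 'y) cat_scheme \<Rightarrow> ('o \<Rightarrow> 'p) \<Rightarrow> ('o \<Rightarrow> 'o \<Rightarrow> 'm \<Rightarrow> 'n) \<Rightarrow> ('o, 'm) step list \<Rightarrow> 'o \<Rightarrow> 'n" where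
  "zz_value E h m [] Z = Ident E (h Z)"
| "zz_value E h m (s # p) Z = (case s of
     Fwd X f Y \<Rightarrow> zz_value E h m p Z \<cdot>\<^bsub>E\<^esub> m X Y f
   | Bwd X w Y \<Rightarrow> zz_value E h m p Z \<cdot>\<^bsub>E\<^esub> (SOME g. is_inverse E (h X) (h Y) (m X Y w) g))"

text \<open>The universal property of the localization, at the level of zigzags. Unlike
  \<open>fmor\<close>, \<open>m\<close> receives the endpoints, because the map induced on
  cohomology depends on the two complexes and not on the family of arrows alone.\<close>

locale inverting_assignment = S: localizing C W + E: category E
  for C :: "('o, 'm, 'z) cat_scheme" and W :: "'o \<Rightarrow> 'o \<Rightarrow> 'm set"
    and E :: "('p, 'n, 'y) cat_scheme" +
  fixes h :: "'o \<Rightarrow> 'p" and m :: "'o \<Rightarrow> 'o \<Rightarrow> 'm \<Rightarrow> 'n"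
  assumes h_obj: "X \<in> Obj C \<Longrightarrow> h X \<in> Obj E"
    and m_arrow: "arrow C X Y f \<Longrightarrow> arrow E (h X) (h Y) (m X Y f)"
    and m_ident: "X \<in> Obj C \<Longrightarrow> m X X (Ident C X) = Ident E (h X)"
    and m_comp: "\<lbrakk>arrow C X Y f; arrow C Y Z g\<rbrakk>
      \<Longrightarrow> m X Z (g \<cdot>\<^bsub>C\<^esub> f) = m Y Z g \<cdot>\<^bsub>E\<^esub> m X Y f"
    and m_iso: "\<lbrakk>X \<in> Obj C; Y \<in> Obj C; w \<in> W X Y\<rbrakk> \<Longrightarrow> is_iso E (h X) (h Y) (m X Y w)"
begin

abbreviation "val \<equiv> zz_value E h m"
abbreviation "inverse_of X Y w \<equiv> SOME g. is_inverse E (h X) (h Y) (m X Y w) g"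

lemma inverse_of:
  assumes "X \<in> Obj C" "Y \<in> Obj C" "w \<in> W X Y"
  shows "arrow E (h Y) (h X) (inverse_of X Y w)" "inverse_of X Y w \<cdot>\<^bsub>E\<^esub> m X Y w = Ident E (h X)"
    "m X Y w \<cdot>\<^bsub>E\<^esub> inverse_of X Y w = Ident E (h Y)"
proof -
  have "is_inverse E (h X) (h Y) (m X Y w) (inverse_of X Y w)"
    using m_iso[OF assms] unfolding is_iso_def by (rule someI_ex)
  then show "arrow E (h Y) (h X) (inverse_of X Y w)"
    "inverse_of X Y w \<cdot>\<^bsub>E\<^esub> m X Y w = Ident E (h X)"
    "m X Y w \<cdot>\<^bsub>E\<^esub> inverse_of X Y w = Ident E (h Y)"
    using h_obj assms by (auto simp: is_inverse_def arrow_def)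
qed

lemma val_arrow: "zigzag C W X p Y \<Longrightarrow> arrow E (h X) (h Y) (val p Y)"
proof (induction rule: zigzag.induct)
  case (zz_nil X)
  then show ?case using E.arrow_ident h_obj by simp
next
  case (zz_fwd X Y f p Z)
  then have "arrow C X Y f" by (simp add: arrow_def)
  then show ?case using E.arrow_comp[OF m_arrow zz_fwd.IH] by simp
next
  case (zz_bwd X Y w p Z)
  then show ?case using E.arrow_comp[OF inverse_of(1) zz_bwd.IH] by simp
qed

lemma val_append:
  "zigzag C W X p Y \<Longrightarrow> zigzag C W Y q Z \<Longrightarrow> val (p @ q) Z = val q Z \<cdot>\<^bsub>E\<^esub> val p Y"
proof (induction rule: zigzag.induct)
  case (zz_nil X)
  then show ?case using E.comp_id_right[OF val_arrow] by simp
next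
  case (zz_fwd X Y f p U)
  then have f: "arrow C X Y f" by (simp add: arrow_def)
  then show ?case
    using E.assoc[OF m_arrow[OF f] val_arrow[OF zz_fwd(4)] val_arrow[OF zz_fwd.prems]] zz_fwd by simp
next
  case (zz_bwd X Y w p U)
  then show ?case
    using E.assoc[OF inverse_of(1)[OF zz_bwd(1-3)] val_arrow[OF zz_bwd(4)] val_arrow[OF zz_bwd.prems]]
    by simp
qed

lemma val_cong: "zz_eq C W X Y p q \<Longrightarrow> val p Y = val q Y"
proof (induction rule: zz_eq.induct)
  case (zz_append X Y p p' Z q q')
  then show ?case using val_append S.zz_eq_zigzag by metis
next
  case (zz_ident X)
  then show ?case using E.comp_id_left[OF E.arrow_ident[OF h_obj]] m_ident by simp
next
  case (zz_comp X Y Z f g)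
  then have a: "arrow C X Y f" "arrow C Y Z g" by (auto simp: arrow_def)
  then show ?case
    using E.comp_id_left[OF m_arrow[OF a(2)]] E.comp_id_left[OF m_arrow[OF S.arrow_comp[OF a]]]
      m_comp[OF a] by simp
next
  case (zz_fwd_bwd X Y w)
  then show ?case
    using inverse_of[OF zz_fwd_bwd] E.comp_id_left[OF inverse_of(1)[OF zz_fwd_bwd]] by simp
next
  case (zz_bwd_fwd X Y w)
  then show ?case
    using inverse_of[OF zz_bwd_fwd] E.comp_id_left[OF m_arrow[OF S.W_arrow[OF zz_bwd_fwd]]] by simp
qed auto

lemma isomorphic_value:
  assumes "isomorphic S.L X Y"
  shows "isomorphic E (h X) (h Y)"
proof -
  obtain p q where pq: "zigzag C W X p Y" "zigzag C W Y q X"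
     "zz_eq C W X X (p @ q) []" "zz_eq C W Y Y (q @ p) []"
    using assms unfolding S.isomorphic_localization_iff by blast
  have "val q X \<cdot>\<^bsub>E\<^esub> val p Y = Ident E (h X)" "val p Y \<cdot>\<^bsub>E\<^esub> val q X = Ident E (h Y)"
    using val_append[OF pq(1,2)] val_append[OF pq(2,1)] val_cong[OF pq(3)] val_cong[OF pq(4)] by auto
  then show ?thesis
    unfolding isomorphic_def using E.is_isoI[OF val_arrow[OF pq(1)] val_arrow[OF pq(2)]] by blast
qed

end

section \<open>Complexes and their cohomology\<close>

context linear_category
begin

lemma complexD:
  assumes "is_complex C X"
  shows "cob X n \<in> Obj C" "arrow C (cob X n) (cob X (n + 1)) (cdiff X n)"
    "arrow C (cob X (n - 1)) (cob X n) (cdiff X (n - 1))"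
    "cdiff X (n + 1) \<cdot>\<^bsub>C\<^esub> cdiff X n = hzero C (cob X n) (cob X (n + 2))"
    "cdiff X n \<cdot>\<^bsub>C\<^esub> cdiff X (n - 1) = hzero C (cob X (n - 1)) (cob X (n + 1))"
proof -
  have *: "cob X n \<in> Obj C \<and> cdiff X n \<in> Hom C (cob X n) (cob X (n + 1)) \<and>
      cdiff X (n + 1) \<cdot>\<^bsub>C\<^esub> cdiff X n = hzero C (cob X n) (cob X (n + 2))" for n
    using assms unfolding is_complex_def by blast
  show "cob X n \<in> Obj C" "arrow C (cob X n) (cob X (n + 1)) (cdiff X n)"
    "cdiff X (n + 1) \<cdot>\<^bsub>C\<^esub> cdiff X n = hzero C (cob X n) (cob X (n + 2))"
    using * by (auto simp: arrow_def)
  have e: "n - 1 + 1 = n" "n - 1 + 2 = n + 1" by auto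
  show "arrow C (cob X (n - 1)) (cob X n) (cdiff X (n - 1))"
    "cdiff X n \<cdot>\<^bsub>C\<^esub> cdiff X (n - 1) = hzero C (cob X (n - 1)) (cob X (n + 1))"
    using *[of "n - 1"] *[of n] unfolding e by (auto simp: arrow_def)
qed

lemma is_complexI:
  assumes "\<And>n. arrow C (cob X n) (cob X (n + 1)) (cdiff X n)"
    and "\<And>n. cdiff X (n + 1) \<cdot>\<^bsub>C\<^esub> cdiff X n = hzero C (cob X n) (cob X (n + 2))"
  shows "is_complex C X"
  using assms unfolding is_complex_def arrow_def by blast

lemma chain_mapD:
  assumes "is_complex C X" "is_complex C Y" "is_chain_map C X Y f"
  shows "arrow C (cob X n) (cob Y n) (f n)"
    "f (n + 1) \<cdot>\<^bsub>C\<^esub> cdiff X n = cdiff Y n \<cdot>\<^bsub>C\<^esub> f n"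
    "f n \<cdot>\<^bsub>C\<^esub> cdiff X (n - 1) = cdiff Y (n - 1) \<cdot>\<^bsub>C\<^esub> f (n - 1)"
proof -
  have *: "f n \<in> Hom C (cob X n) (cob Y n) \<and> f (n + 1) \<cdot>\<^bsub>C\<^esub> cdiff X n = cdiff Y n \<cdot>\<^bsub>C\<^esub> f n" for n
    using assms(3) unfolding is_chain_map_def by blast
  show "arrow C (cob X n) (cob Y n) (f n)"
    "f (n + 1) \<cdot>\<^bsub>C\<^esub> cdiff X n = cdiff Y n \<cdot>\<^bsub>C\<^esub> f n"
    using * complexD(1) assms by (auto simp: arrow_def)
  show "f n \<cdot>\<^bsub>C\<^esub> cdiff X (n - 1) = cdiff Y (n - 1) \<cdot>\<^bsub>C\<^esub> f (n - 1)"
    using *[of "n - 1"] by simp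
qed

lemma is_chain_mapI:
  assumes "\<And>n. arrow C (cob X n) (cob Y n) (f n)"
    and "\<And>n. f (n + 1) \<cdot>\<^bsub>C\<^esub> cdiff X n = cdiff Y n \<cdot>\<^bsub>C\<^esub> f n"
  shows "is_chain_map C X Y f"
  using assms unfolding is_chain_map_def arrow_def by blast

lemma chain_map_ident: "is_complex C X \<Longrightarrow> is_chain_map C X X (\<lambda>n. Ident C (cob X n))"
  by (rule is_chain_mapI) (auto simp: complexD arrow_ident comp_id_left[OF complexD(2)]
    comp_id_right[OF complexD(2)])

lemma chain_map_comp:
  assumes "is_complex C X" "is_complex C Y" "is_complex C Z"
    and f: "is_chain_map C X Y f" and g: "is_chain_map C Y Z g"
  shows "is_chain_map C X Z (\<lambda>n. g n \<cdot>\<^bsub>C\<^esub> f n)"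
proof (rule is_chain_mapI)
  fix n
  note F = chain_mapD[OF assms(1,2) f] and G = chain_mapD[OF assms(2,3) g]
  show "arrow C (cob X n) (cob Z n) (g n \<cdot>\<^bsub>C\<^esub> f n)" using arrow_comp[OF F(1) G(1)] .
  have "(g (n + 1) \<cdot>\<^bsub>C\<^esub> f (n + 1)) \<cdot>\<^bsub>C\<^esub> cdiff X n = g (n + 1) \<cdot>\<^bsub>C\<^esub> (cdiff Y n \<cdot>\<^bsub>C\<^esub> f n)"
    using assoc[OF complexD(2)[OF assms(1)] F(1) G(1)] F(2) by simp
  also have "\<dots> = cdiff Z n \<cdot>\<^bsub>C\<^esub> (g n \<cdot>\<^bsub>C\<^esub> f n)"
    using assoc[OF F(1) complexD(2)[OF assms(2)] G(1)] assoc[OF F(1) G(1) complexD(2)[OF assms(3)]]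
      G(2) by simp
  finally show "g (n + 1) \<cdot>\<^bsub>C\<^esub> f (n + 1) \<cdot>\<^bsub>C\<^esub> cdiff X n = cdiff Z n \<cdot>\<^bsub>C\<^esub> (g n \<cdot>\<^bsub>C\<^esub> f n)" .
qed

lemma Ch_simps:
  "Obj (Ch C) = {X. is_complex C X}" "Hom (Ch C) X Y = {f. is_chain_map C X Y f}"
  "Ident (Ch C) X = (\<lambda>n. Ident C (cob X n))" "g \<cdot>\<^bsub>Ch C\<^esub> f = (\<lambda>n. g n \<cdot>\<^bsub>C\<^esub> f n)"
  by (simp_all add: Ch_def)

lemma arrow_Ch: "arrow (Ch C) X Y f \<longleftrightarrow> is_complex C X \<and> is_complex C Y \<and> is_chain_map C X Y f"
  by (simp add: arrow_def Ch_simps)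

lemma category_Ch: "category (Ch C)"
proof
  fix X assume "X \<in> Obj (Ch C)"
  then show "Ident (Ch C) X \<in> Hom (Ch C) X X" using chain_map_ident by (simp add: Ch_simps)
next
  fix X Y Z f g assume "X \<in> Obj (Ch C)" "Y \<in> Obj (Ch C)" "Z \<in> Obj (Ch C)"
    "f \<in> Hom (Ch C) X Y" "g \<in> Hom (Ch C) Y Z"
  then show "g \<cdot>\<^bsub>Ch C\<^esub> f \<in> Hom (Ch C) X Z" using chain_map_comp by (simp add: Ch_simps)
next
  fix X Y f assume a: "X \<in> Obj (Ch C)" "Y \<in> Obj (Ch C)" "f \<in> Hom (Ch C) X Y"
  then have f: "arrow C (cob X n) (cob Y n) (f n)" for n using chain_mapD(1) by (simp add: Ch_simps)
  show "f \<cdot>\<^bsub>Ch C\<^esub> Ident (Ch C) X = f" "Ident (Ch C) Y \<cdot>\<^bsub>Ch C\<^esub> f = f"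
    by (simp_all add: Ch_simps comp_id_left[OF f] comp_id_right[OF f])
next
  fix W X Y Z f g h
  assume "W \<in> Obj (Ch C)" "X \<in> Obj (Ch C)" "Y \<in> Obj (Ch C)" "Z \<in> Obj (Ch C)"
    "f \<in> Hom (Ch C) W X" "g \<in> Hom (Ch C) X Y" "h \<in> Hom (Ch C) Y Z"
  then have a: "arrow C (cob W n) (cob X n) (f n)" "arrow C (cob X n) (cob Y n) (g n)"
    "arrow C (cob Y n) (cob Z n) (h n)" for n using chain_mapD(1) by (simp_all add: Ch_simps)
  show "h \<cdot>\<^bsub>Ch C\<^esub> g \<cdot>\<^bsub>Ch C\<^esub> f = h \<cdot>\<^bsub>Ch C\<^esub> (g \<cdot>\<^bsub>Ch C\<^esub> f)"
    by (simp add: Ch_simps assoc[OF a])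
qed

end

text \<open>Since \<open>cohomology\<close> is defined by arbitrary choices, cohomology is handled through all
  possible choices at once.\<close>

record ('o, 'm) cohomology_data =
  cyc :: 'o
  cyc_in :: 'm
  coh :: 'o
  coh_pr :: 'm

definition is_cohomology ::
  "('o, 'm, 'r, 'z) lincat_scheme \<Rightarrow> ('o, 'm) cochain \<Rightarrow> int \<Rightarrow> ('o, 'm) cohomology_data \<Rightarrow> bool" where
  "is_cohomology C X n H \<longleftrightarrow>
     is_kernel C (cob X n) (cob X (n + 1)) (cdiff X n) (cyc H) (cyc_in H) \<and>
     (\<exists>b. arrow C (cob X (n - 1)) (cyc H) b \<and> cyc_in H \<cdot>\<^bsub>C\<^esub> b = cdiff X (n - 1) \<and>
          is_cokernel C (cob X (n - 1)) (cyc H) b (coh H) (coh_pr H))"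

definition is_cohomology_map ::
  "('o, 'm, 'r, 'z) lincat_scheme \<Rightarrow> ('o, 'm) cohomology_data \<Rightarrow> ('o, 'm) cohomology_data \<Rightarrow>
     'm \<Rightarrow> 'm \<Rightarrow> bool" where
  "is_cohomology_map C H H' f h \<longleftrightarrow> arrow C (coh H) (coh H') h \<and>
     (\<exists>u. arrow C (cyc H) (cyc H') u \<and> cyc_in H' \<cdot>\<^bsub>C\<^esub> u = f \<cdot>\<^bsub>C\<^esub> cyc_in H \<and>
          h \<cdot>\<^bsub>C\<^esub> coh_pr H = coh_pr H' \<cdot>\<^bsub>C\<^esub> u)"

definition chosen_cohomology ::
  "('o, 'm, 'r, 'z) lincat_scheme \<Rightarrow> ('o, 'm) cochain \<Rightarrow> int \<Rightarrow> ('o, 'm) cohomology_data" where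
  "chosen_cohomology C X n =
     \<lparr>cyc = fst (cocycles C X n), cyc_in = snd (cocycles C X n),
      coh = fst (cohomology C X n), coh_pr = snd (cohomology C X n)\<rparr>"

section \<open>Cohomology data and the maps induced between them\<close>

context linear_category
begin

lemma is_cohomologyD:
  assumes "is_cohomology C X n H"
  shows "is_kernel C (cob X n) (cob X (n + 1)) (cdiff X n) (cyc H) (cyc_in H)"
    "arrow C (cyc H) (cob X n) (cyc_in H)" "arrow C (cyc H) (coh H) (coh_pr H)"
    "cyc H \<in> Obj C" "coh H \<in> Obj C"
proof -
  show k: "is_kernel C (cob X n) (cob X (n + 1)) (cdiff X n) (cyc H) (cyc_in H)"
    using assms by (simp add: is_cohomology_def)
  show "arrow C (cyc H) (cob X n) (cyc_in H)" using is_kernelD(2)[OF k] .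
  show "arrow C (cyc H) (coh H) (coh_pr H)"
    using assms is_cokernelD(2) unfolding is_cohomology_def by blast
  then show "cyc H \<in> Obj C" "coh H \<in> Obj C" by (auto simp: arrow_def)
qed

text \<open>A chain map sends cocycles to cocycles, which gives \<open>u\<close> by the kernel
  property, and boundaries to boundaries, which gives \<open>h\<close> by the cokernel
  property.\<close>

lemma cohomology_map_exists:
  assumes X: "is_complex C X" and Y: "is_complex C Y" and f: "is_chain_map C X Y f"
    and H: "is_cohomology C X n H" and H': "is_cohomology C Y n H'"
  shows "\<exists>h. is_cohomology_map C H H' (f n) h"
proof -
  note F = chain_mapD[OF X Y f]
  note dX = complexD[OF X] and dY = complexD[OF Y]
  obtain b where b: "arrow C (cob X (n - 1)) (cyc H) b" "cyc_in H \<cdot>\<^bsub>C\<^esub> b = cdiff X (n - 1)"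
    "is_cokernel C (cob X (n - 1)) (cyc H) b (coh H) (coh_pr H)"
    using H unfolding is_cohomology_def by blast
  obtain c where c: "arrow C (cob Y (n - 1)) (cyc H') c" "cyc_in H' \<cdot>\<^bsub>C\<^esub> c = cdiff Y (n - 1)"
    "is_cokernel C (cob Y (n - 1)) (cyc H') c (coh H') (coh_pr H')"
    using H' unfolding is_cohomology_def by blast
  note k = is_cohomologyD[OF H] and k' = is_cohomologyD[OF H']
  have "cdiff Y n \<cdot>\<^bsub>C\<^esub> (f n \<cdot>\<^bsub>C\<^esub> cyc_in H) = f (n + 1) \<cdot>\<^bsub>C\<^esub> (cdiff X n \<cdot>\<^bsub>C\<^esub> cyc_in H)"
    using assoc[OF k(2) F(1) dY(2)] assoc[OF k(2) dX(2) F(1)] F(2) by simp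
  also have "\<dots> = hzero C (cyc H) (cob Y (n + 1))"
    using is_kernelD(3)[OF k(1)] comp_zero_right[OF k(4) F(1)] by simp
  finally obtain u where u: "arrow C (cyc H) (cyc H') u" "cyc_in H' \<cdot>\<^bsub>C\<^esub> u = f n \<cdot>\<^bsub>C\<^esub> cyc_in H"
    using kernel_lift[OF k'(1) arrow_comp[OF k(2) F(1)]] by blast
  \<comment> \<open>The commutation with boundary arrows is checked in degree \<open>n\<close> of
    \<open>Y\<close>, after composing with the kernel arrow \<open>cyc_in H'\<close>, which can be
    cancelled.\<close>
  have "cyc_in H' \<cdot>\<^bsub>C\<^esub> (u \<cdot>\<^bsub>C\<^esub> b) = cyc_in H' \<cdot>\<^bsub>C\<^esub> (c \<cdot>\<^bsub>C\<^esub> f (n - 1))"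
    using assoc[OF b(1) u(1) k'(2)] assoc[OF b(1) k(2) F(1)] assoc[OF F(1) c(1) k'(2)] u(2) b(2) c(2) F(3)
    by simp
  then have e: "u \<cdot>\<^bsub>C\<^esub> b = c \<cdot>\<^bsub>C\<^esub> f (n - 1)"
    using kernel_cancel[OF k'(1) arrow_comp[OF b(1) u(1)] arrow_comp[OF F(1) c(1)]] by blast
  have "(coh_pr H' \<cdot>\<^bsub>C\<^esub> u) \<cdot>\<^bsub>C\<^esub> b = (coh_pr H' \<cdot>\<^bsub>C\<^esub> c) \<cdot>\<^bsub>C\<^esub> f (n - 1)"
    using assoc[OF b(1) u(1) k'(3)] assoc[OF F(1) c(1) k'(3)] e by simp
  also have "\<dots> = hzero C (cob X (n - 1)) (coh H')"
    using is_cokernelD(3)[OF c(3)] comp_zero_left[OF F(1) k'(5)] by simp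
  finally obtain h where "arrow C (coh H) (coh H') h" "h \<cdot>\<^bsub>C\<^esub> coh_pr H = coh_pr H' \<cdot>\<^bsub>C\<^esub> u"
    using cokernel_extend[OF b(3) arrow_comp[OF u(1) k'(3)]] by blast
  with u show ?thesis unfolding is_cohomology_map_def by blast
qed

lemma cohomology_map_unique:
  assumes H: "is_cohomology C X n H" and H': "is_cohomology C Y n H'"
    and h: "is_cohomology_map C H H' f h" "is_cohomology_map C H H' f h'"
  shows "h = h'"
proof -
  note k' = is_cohomologyD[OF H']
  obtain u where u: "arrow C (cyc H) (cyc H') u" "cyc_in H' \<cdot>\<^bsub>C\<^esub> u = f \<cdot>\<^bsub>C\<^esub> cyc_in H"
    "h \<cdot>\<^bsub>C\<^esub> coh_pr H = coh_pr H' \<cdot>\<^bsub>C\<^esub> u" using h(1) unfolding is_cohomology_map_def by blast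
  obtain v where v: "arrow C (cyc H) (cyc H') v" "cyc_in H' \<cdot>\<^bsub>C\<^esub> v = f \<cdot>\<^bsub>C\<^esub> cyc_in H"
    "h' \<cdot>\<^bsub>C\<^esub> coh_pr H = coh_pr H' \<cdot>\<^bsub>C\<^esub> v" using h(2) unfolding is_cohomology_map_def by blast
  have "u = v" using kernel_cancel[OF k'(1) u(1) v(1)] u(2) v(2) by simp
  moreover obtain b where b: "is_cokernel C (cob X (n - 1)) (cyc H) b (coh H) (coh_pr H)"
    using H unfolding is_cohomology_def by blast
  ultimately show ?thesis
    using cokernel_cancel[OF b] u(3) v(3) h unfolding is_cohomology_map_def by metis
qed

lemma cohomology_map_comp:
  assumes H: "is_cohomology C X n H" and H': "is_cohomology C Y n H'" and H'': "is_cohomology C Z n H''"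
    and f: "arrow C (cob X n) (cob Y n) f" and g: "arrow C (cob Y n) (cob Z n) g"
    and h: "is_cohomology_map C H H' f h" and h': "is_cohomology_map C H' H'' g h'"
  shows "is_cohomology_map C H H'' (g \<cdot>\<^bsub>C\<^esub> f) (h' \<cdot>\<^bsub>C\<^esub> h)"
proof -
  note k = is_cohomologyD[OF H] and k' = is_cohomologyD[OF H'] and k'' = is_cohomologyD[OF H'']
  obtain u where u: "arrow C (cyc H) (cyc H') u" "cyc_in H' \<cdot>\<^bsub>C\<^esub> u = f \<cdot>\<^bsub>C\<^esub> cyc_in H"
    "h \<cdot>\<^bsub>C\<^esub> coh_pr H = coh_pr H' \<cdot>\<^bsub>C\<^esub> u" using h(1) unfolding is_cohomology_map_def by blast
  obtain v where v: "arrow C (cyc H') (cyc H'') v" "cyc_in H'' \<cdot>\<^bsub>C\<^esub> v = g \<cdot>\<^bsub>C\<^esub> cyc_in H'"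
    "h' \<cdot>\<^bsub>C\<^esub> coh_pr H' = coh_pr H'' \<cdot>\<^bsub>C\<^esub> v" using h' unfolding is_cohomology_map_def by blast
  have a: "arrow C (coh H) (coh H') h" "arrow C (coh H') (coh H'') h'"
    using h h' by (auto simp: is_cohomology_map_def)
  have "cyc_in H'' \<cdot>\<^bsub>C\<^esub> (v \<cdot>\<^bsub>C\<^esub> u) = (g \<cdot>\<^bsub>C\<^esub> f) \<cdot>\<^bsub>C\<^esub> cyc_in H"
    using assoc[OF u(1) v(1) k''(2)] assoc[OF u(1) k'(2) g] assoc[OF k(2) f g] u(2) v(2) by simp
  moreover have "(h' \<cdot>\<^bsub>C\<^esub> h) \<cdot>\<^bsub>C\<^esub> coh_pr H = coh_pr H'' \<cdot>\<^bsub>C\<^esub> (v \<cdot>\<^bsub>C\<^esub> u)"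
    using assoc[OF u(1) v(1) k''(3)] assoc[OF u(1) k'(3) a(2)] assoc[OF k(3) a] u(3) v(3) by simp
  ultimately show ?thesis
    unfolding is_cohomology_map_def using arrow_comp[OF a] arrow_comp[OF u(1) v(1)] by blast
qed

lemma cohomology_map_ident:
  assumes "is_cohomology C X n H"
  shows "is_cohomology_map C H H (Ident C (cob X n)) (Ident C (coh H))"
proof -
  note k = is_cohomologyD[OF assms]
  show ?thesis
    unfolding is_cohomology_map_def
    using k arrow_ident comp_id_left[OF k(2)] comp_id_right[OF k(2)] comp_id_left[OF k(3)]
      comp_id_right[OF k(3)] by metis
qed

text \<open>The comparison maps in the two directions compose to maps induced by the identity, and
  uniqueness identifies these with identities.\<close>

lemma cohomology_data_iso:
  assumes X: "is_complex C X" and H: "is_cohomology C X n H" and H': "is_cohomology C X n H'"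
    and h: "is_cohomology_map C H H' (Ident C (cob X n)) h"
  shows "is_iso C (coh H) (coh H') h"
proof -
  note i = arrow_ident[OF complexD(1)[OF X], of n]
  obtain h' where h': "is_cohomology_map C H' H (Ident C (cob X n)) h'"
    using cohomology_map_exists[OF X X chain_map_ident[OF X] H' H] by blast
  have "is_cohomology_map C H H (Ident C (cob X n)) (h' \<cdot>\<^bsub>C\<^esub> h)"
    using cohomology_map_comp[OF H H' H i i h h'] comp_id_left[OF i] by simp
  then have 1: "h' \<cdot>\<^bsub>C\<^esub> h = Ident C (coh H)"
    using cohomology_map_unique[OF H H] cohomology_map_ident[OF H] by blast
  have "is_cohomology_map C H' H' (Ident C (cob X n)) (h \<cdot>\<^bsub>C\<^esub> h')"
    using cohomology_map_comp[OF H' H H' i i h' h] comp_id_left[OF i] by simp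
  then have 2: "h \<cdot>\<^bsub>C\<^esub> h' = Ident C (coh H')"
    using cohomology_map_unique[OF H' H'] cohomology_map_ident[OF H'] by blast
  have "arrow C (coh H) (coh H') h" "arrow C (coh H') (coh H) h'"
    using h h' by (simp_all add: is_cohomology_map_def)
  then show ?thesis using is_isoI 1 2 by blast
qed

text \<open>By uniqueness \<open>h2\<close> is \<open>h\<close> flanked by two comparison
  isomorphisms. Hence being a quasi-isomorphism may be tested on any data, in particular on images
  of chosen data under a functor.\<close>

lemma cohomology_iso_independent:
  assumes X: "is_complex C X" and Y: "is_complex C Y" and f: "is_chain_map C X Y f"
    and H: "is_cohomology C X n H" "is_cohomology C X n H2"
    and H': "is_cohomology C Y n H'" "is_cohomology C Y n H2'"
    and h: "is_cohomology_map C H H' (f n) h" and h2: "is_cohomology_map C H2 H2' (f n) h2"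
    and iso: "is_iso C (coh H) (coh H') h"
  shows "is_iso C (coh H2) (coh H2') h2"
proof -
  note iX = arrow_ident[OF complexD(1)[OF X], of n] and iY = arrow_ident[OF complexD(1)[OF Y], of n]
  note F = chain_mapD(1)[OF X Y f, of n]
  obtain a where a: "is_cohomology_map C H2 H (Ident C (cob X n)) a"
    using cohomology_map_exists[OF X X chain_map_ident[OF X] H(2,1)] by blast
  obtain b where b: "is_cohomology_map C H' H2' (Ident C (cob Y n)) b"
    using cohomology_map_exists[OF Y Y chain_map_ident[OF Y] H'] by blast
  have "is_cohomology_map C H2 H' (f n) (h \<cdot>\<^bsub>C\<^esub> a)"
    using cohomology_map_comp[OF H(2,1) H'(1) iX F a h] comp_id_right[OF F] by simp
  then have "is_cohomology_map C H2 H2' (f n) (b \<cdot>\<^bsub>C\<^esub> (h \<cdot>\<^bsub>C\<^esub> a))"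
    using cohomology_map_comp[OF H(2) H' F iY _ b] comp_id_left[OF F] by simp
  then have "h2 = b \<cdot>\<^bsub>C\<^esub> (h \<cdot>\<^bsub>C\<^esub> a)" using cohomology_map_unique[OF H(2) H'(2) h2] by blast
  moreover have "is_iso C (coh H2) (coh H2') (b \<cdot>\<^bsub>C\<^esub> (h \<cdot>\<^bsub>C\<^esub> a))"
    using is_iso_comp iso cohomology_data_iso[OF X H(2,1) a] cohomology_data_iso[OF Y H' b]
      is_cohomologyD(5) H H' by metis
  ultimately show ?thesis by simp
qed

end

text \<open>Enough structure to define cohomology, cones and the derived category; the glued
  category is established at this level.\<close>

locale preabelian_category = linear_category R C
  for R :: "('r, 'x) ring_scheme" (structure)
    and C :: "('o, 'm, 'r, 'z) lincat_scheme" (structure) +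
  assumes ex_zero_object: "\<exists>Z. is_zero_object C Z"
    and ex_biproduct: "\<lbrakk>X \<in> Obj C; Y \<in> Obj C\<rbrakk> \<Longrightarrow> \<exists>P. is_biproduct C X Y P"
    and ex_kernel: "arrow C X Y f \<Longrightarrow> \<exists>K k. is_kernel C X Y f K k"
    and ex_cokernel: "arrow C X Y f \<Longrightarrow> \<exists>Q q. is_cokernel C X Y f Q q"
begin

lemma is_zero_object_zero_object: "is_zero_object C (zero_object C)"
  unfolding zero_object_def using ex_zero_object by (rule someI_ex)

text \<open>The definition chooses a kernel, then describes the boundary arrow by
  \<open>THE\<close>, then chooses a cokernel. The description is sound because lifts through a
  kernel exist and are unique.\<close>

lemma chosen_cohomology:
  assumes X: "is_complex C X"
  shows "is_cohomology C X n (chosen_cohomology C X n)"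
proof -
  note d = complexD[OF X]
  obtain K k where c: "cocycles C X n = (K, k)" by fastforce
  have "\<exists>p. case p of (K, k) \<Rightarrow> is_kernel C (cob X n) (cob X (n + 1)) (cdiff X n) K k"
    using ex_kernel[OF d(2)] by auto
  then have "case cocycles C X n of (K, k) \<Rightarrow> is_kernel C (cob X n) (cob X (n + 1)) (cdiff X n) K k"
    unfolding cocycles_def by (rule someI_ex)
  then have k: "is_kernel C (cob X n) (cob X (n + 1)) (cdiff X n) K k" by (simp add: c)
  obtain b where b: "arrow C (cob X (n - 1)) K b" "k \<cdot>\<^bsub>C\<^esub> b = cdiff X (n - 1)"
    using kernel_lift[OF k d(3,5)] by blast
  have "boundary_arrow C X n = b"
    unfolding boundary_arrow_def c fst_conv snd_conv
  proof (rule the_equality)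
    show "b \<in> Hom C (cob X (n - 1)) K \<and> k \<cdot>\<^bsub>C\<^esub> b = cdiff X (n - 1)" using b by (simp add: arrow_def)
    fix b' assume "b' \<in> Hom C (cob X (n - 1)) K \<and> k \<cdot>\<^bsub>C\<^esub> b' = cdiff X (n - 1)"
    then show "b' = b" using kernel_cancel[OF k] b by (metis arrow_def)
  qed
  moreover have "\<exists>p. case p of (H, q) \<Rightarrow> is_cokernel C (cob X (n - 1)) K b H q"
    using ex_cokernel[OF b(1)] by auto
  then have "case (SOME (H, q). is_cokernel C (cob X (n - 1)) K b H q) of
      (H, q) \<Rightarrow> is_cokernel C (cob X (n - 1)) K b H q" by (rule someI_ex)
  ultimately have "is_cokernel C (cob X (n - 1)) K b (fst (cohomology C X n)) (snd (cohomology C X n))"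
    by (simp add: cohomology_def c case_prod_beta)
  then show ?thesis
    unfolding is_cohomology_def chosen_cohomology_def using k b by (auto simp: c)
qed

lemma is_cohomology_map_cohomology_map:
  assumes X: "is_complex C X" and Y: "is_complex C Y" and f: "is_chain_map C X Y f"
  shows "is_cohomology_map C (chosen_cohomology C X n) (chosen_cohomology C Y n) (f n)
    (cohomology_map C X Y f n)"
proof -
  let ?H = "chosen_cohomology C X n" and ?K = "chosen_cohomology C Y n"
  note c = chosen_cohomology[OF X, of n] chosen_cohomology[OF Y, of n]
  note o = is_cohomologyD(4,5)[OF c(1)] is_cohomologyD(4,5)[OF c(2)]
  obtain h where h: "is_cohomology_map C ?H ?K (f n) h"
    using cohomology_map_exists[OF X Y f c] by blast
  have "cohomology_map C X Y f n = (THE h. is_cohomology_map C ?H ?K (f n) h)"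
    using o unfolding cohomology_map_def is_cohomology_map_def
    by (simp add: chosen_cohomology_def arrow_def Bex_def conj_assoc)
  also have "\<dots> = h" by (rule the_equality) (use h cohomology_map_unique[OF c] in blast)+
  finally show ?thesis using h by simp
qed

lemma quasi_isosD:
  assumes X: "is_complex C X" and Y: "is_complex C Y" and f: "f \<in> quasi_isos C X Y"
    and H: "is_cohomology C X n H" "is_cohomology C Y n H'" "is_cohomology_map C H H' (f n) h"
  shows "is_iso C (coh H) (coh H') h"
proof -
  have f': "is_chain_map C X Y f" using f by (simp add: quasi_isos_def)
  have "is_iso C (coh (chosen_cohomology C X n)) (coh (chosen_cohomology C Y n)) (cohomology_map C X Y f n)"
    using f by (simp add: quasi_isos_def chosen_cohomology_def)
  then show ?thesis
    using cohomology_iso_independent[OF X Y f' chosen_cohomology[OF X] H(1) chosen_cohomology[OF Y] H(2)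
      is_cohomology_map_cohomology_map[OF X Y f'] H(3)] by blast
qed

text \<open>Each degree may use whatever cohomology data are convenient; exact functors supply the
  images of chosen data, and the shift supplies the data of the next degree.\<close>

lemma quasi_isosI:
  assumes X: "is_complex C X" and Y: "is_complex C Y" and f: "is_chain_map C X Y f"
    and h: "\<And>n. \<exists>H H' h. is_cohomology C X n H \<and> is_cohomology C Y n H' \<and>
      is_cohomology_map C H H' (f n) h \<and> is_iso C (coh H) (coh H') h"
  shows "f \<in> quasi_isos C X Y"
proof -
  have "is_iso C (coh (chosen_cohomology C X n)) (coh (chosen_cohomology C Y n)) (cohomology_map C X Y f n)"
    for n
    using h[of n] cohomology_iso_independent[OF X Y f _ chosen_cohomology[OF X] _ chosen_cohomology[OF Y] _
      is_cohomology_map_cohomology_map[OF X Y f]] by blast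
  then show ?thesis by (simp add: quasi_isos_def chosen_cohomology_def f)
qed

lemma quasi_isos_ident:
  assumes X: "is_complex C X"
  shows "(\<lambda>n. Ident C (cob X n)) \<in> quasi_isos C X X"
proof (rule quasi_isosI[OF X X chain_map_ident[OF X]])
  fix n
  note c = chosen_cohomology[OF X, of n]
  show "\<exists>H H' h. is_cohomology C X n H \<and> is_cohomology C X n H' \<and>
      is_cohomology_map C H H' (Ident C (cob X n)) h \<and> is_iso C (coh H) (coh H') h"
    using c cohomology_map_ident[OF c] is_iso_ident[OF is_cohomologyD(5)[OF c]] by blast
qed

lemma localizing_quasi_isos: "localizing (Ch C) (quasi_isos C)"
  using category_Ch
  by (auto simp: localizing_def localizing_axioms_def arrow_Ch Ch_simps quasi_isos_def)

text \<open>Functoriality of the chosen maps follows from uniqueness of induced maps, and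
  invertibility on quasi-isomorphisms is their definition. Cohomology thereby becomes an invariant
  of isomorphism in the derived category.\<close>

lemma inverting_cohomology:
  "inverting_assignment (Ch C) (quasi_isos C) C (\<lambda>X. coh (chosen_cohomology C X n))
     (\<lambda>X Y f. cohomology_map C X Y f n)"
proof -
  interpret localizing "Ch C" "quasi_isos C" by (rule localizing_quasi_isos)
  have cm: "is_cohomology_map C (chosen_cohomology C X n) (chosen_cohomology C Y n) (f n)
      (cohomology_map C X Y f n)" if "arrow (Ch C) X Y f" for X Y f
    using is_cohomology_map_cohomology_map that by (simp add: arrow_Ch)
  have cc: "is_cohomology C X n (chosen_cohomology C X n)" if "X \<in> Obj (Ch C)" for X
    using that chosen_cohomology by (simp add: Ch_simps)
  show ?thesis
  proof (unfold_locales, goal_cases)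
    case (1 X)
    then show ?case using is_cohomologyD(5)[OF cc] by simp
  next
    case (2 X Y f)
    then show ?case using cm by (simp add: is_cohomology_map_def)
  next
    case (3 X)
    then show ?case
      using cohomology_map_unique[OF cc[OF 3] cc[OF 3] cm[OF arrow_ident[OF 3]]]
        cohomology_map_ident[OF cc[OF 3]] by (simp add: Ch_simps)
  next
    case (4 X Y f Z g)
    note o = arrowD(1)[OF 4(1)] arrowD(1)[OF 4(2)] arrowD(2)[OF 4(2)]
    have a: "arrow C (cob X n) (cob Y n) (f n)" "arrow C (cob Y n) (cob Z n) (g n)"
      using 4 chain_mapD(1) by (auto simp: arrow_Ch)
    show ?case
      using cohomology_map_unique[OF cc[OF o(1)] cc[OF o(3)] cm[OF arrow_comp[OF 4]]]
        cohomology_map_comp[OF cc[OF o(1)] cc[OF o(2)] cc[OF o(3)] a cm[OF 4(1)] cm[OF 4(2)]]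
      by (simp add: Ch_simps)
  next
    case (5 X Y w)
    then show ?case by (simp add: quasi_isos_def chosen_cohomology_def)
  qed
qed

end

section \<open>Acyclic complexes and cones\<close>

text \<open>Exactness is tested on generalized elements: cocycles are boundaries after precomposition
  with an epimorphism.\<close>

definition acyclic_at :: "('o, 'm, 'r, 'z) lincat_scheme \<Rightarrow> ('o, 'm) cochain \<Rightarrow> int \<Rightarrow> bool" where
  "acyclic_at C X n \<longleftrightarrow> (\<forall>T t. arrow C T (cob X n) t \<longrightarrow>
     cdiff X n \<cdot>\<^bsub>C\<^esub> t = hzero C T (cob X (n + 1)) \<longrightarrow>
     (\<exists>T' e s. arrow C T' T e \<and> is_epi C T' T e \<and> arrow C T' (cob X (n - 1)) s \<and>
        cdiff X (n - 1) \<cdot>\<^bsub>C\<^esub> s = t \<cdot>\<^bsub>C\<^esub> e))"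

abbreviation acyclic_complex :: "('o, 'm, 'r, 'z) lincat_scheme \<Rightarrow> ('o, 'm) cochain \<Rightarrow> bool" where
  "acyclic_complex C X \<equiv> (\<forall>n. acyclic_at C X n)"

text \<open>A relation in place of the chosen cone, since a functor takes a chosen biproduct to a
  biproduct that need not be the chosen one. Prescribing the differential through its projections
  makes it computable on generalized elements \<open>(x, y)\<close>.\<close>

definition is_cone ::
  "('o, 'm, 'r, 'z) lincat_scheme \<Rightarrow> ('o, 'm) cochain \<Rightarrow> ('o, 'm) cochain \<Rightarrow> (int \<Rightarrow> 'm) \<Rightarrow>
     ('o, 'm) cochain \<Rightarrow> (int \<Rightarrow> ('o, 'm) biproduct) \<Rightarrow> bool" where
  "is_cone C X Y f K P \<longleftrightarrow> (\<forall>n.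
     is_biproduct C (cob X (n + 1)) (cob Y n) (P n) \<and> vertex (P n) = cob K n \<and>
     arrow C (cob K n) (cob K (n + 1)) (cdiff K n) \<and>
     prj1 (P (n + 1)) \<cdot>\<^bsub>C\<^esub> cdiff K n =
       hneg C (cob X (n + 1)) (cob X (n + 2)) (cdiff X (n + 1)) \<cdot>\<^bsub>C\<^esub> prj1 (P n) \<and>
     prj2 (P (n + 1)) \<cdot>\<^bsub>C\<^esub> cdiff K n =
       hadd C (cob K n) (cob Y (n + 1)) (f (n + 1) \<cdot>\<^bsub>C\<^esub> prj1 (P n)) (cdiff Y n \<cdot>\<^bsub>C\<^esub> prj2 (P n)))"

section \<open>Generalized elements of cones\<close>

context linear_category
begin

lemma acyclic_atD:
  assumes "acyclic_at C X n" "arrow C T (cob X n) t" "cdiff X n \<cdot>\<^bsub>C\<^esub> t = hzero C T (cob X (n + 1))"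
  obtains T' e s where "arrow C T' T e" "is_epi C T' T e" "arrow C T' (cob X (n - 1)) s"
    "cdiff X (n - 1) \<cdot>\<^bsub>C\<^esub> s = t \<cdot>\<^bsub>C\<^esub> e"
  using assms unfolding acyclic_at_def by blast

text \<open>Exactness is applied to the universal cocycle \<open>cyc_in H\<close>. The resulting
  cover \<open>e\<close> factors through the boundary arrow \<open>b\<close>, which is therefore
  epi.\<close>

lemma acyclic_at_cohomology_zero:
  assumes X: "is_complex C X" and ac: "acyclic_at C X n" and H: "is_cohomology C X n H"
  shows "is_zero_object C (coh H)"
proof -
  note k = is_cohomologyD[OF H]
  obtain b where b: "arrow C (cob X (n - 1)) (cyc H) b" "cyc_in H \<cdot>\<^bsub>C\<^esub> b = cdiff X (n - 1)"
    "is_cokernel C (cob X (n - 1)) (cyc H) b (coh H) (coh_pr H)"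
    using H unfolding is_cohomology_def by blast
  obtain T e s where s: "arrow C T (cyc H) e" "is_epi C T (cyc H) e" "arrow C T (cob X (n - 1)) s"
    "cdiff X (n - 1) \<cdot>\<^bsub>C\<^esub> s = cyc_in H \<cdot>\<^bsub>C\<^esub> e"
    using acyclic_atD[OF ac k(2) is_kernelD(3)[OF k(1)]] by blast
  have "cyc_in H \<cdot>\<^bsub>C\<^esub> (b \<cdot>\<^bsub>C\<^esub> s) = cyc_in H \<cdot>\<^bsub>C\<^esub> e"
    using assoc[OF s(3) b(1) k(2)] s(4) b(2) by simp
  then have "b \<cdot>\<^bsub>C\<^esub> s = e" using kernel_cancel[OF k(1) arrow_comp[OF s(3) b(1)] s(1)] by blast
  then have "is_epi C (cob X (n - 1)) (cyc H) b"
    using epi_right_factor[OF _ s(3) b(1)] s(2) by simp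
  then show ?thesis using cokernel_zero_iff_epi[OF b(3)] by simp
qed

lemma biproductD:
  assumes "is_biproduct C X Y P" "X \<in> Obj C" "Y \<in> Obj C"
  shows "arrow C X (vertex P) (inj1 P)" "arrow C Y (vertex P) (inj2 P)"
    "arrow C (vertex P) X (prj1 P)" "arrow C (vertex P) Y (prj2 P)"
    "prj1 P \<cdot>\<^bsub>C\<^esub> inj1 P = Ident C X" "prj2 P \<cdot>\<^bsub>C\<^esub> inj2 P = Ident C Y"
    "prj1 P \<cdot>\<^bsub>C\<^esub> inj2 P = hzero C Y X" "prj2 P \<cdot>\<^bsub>C\<^esub> inj1 P = hzero C X Y"
    "hadd C (vertex P) (vertex P) (inj1 P \<cdot>\<^bsub>C\<^esub> prj1 P) (inj2 P \<cdot>\<^bsub>C\<^esub> prj2 P) = Ident C (vertex P)"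
  using assms by (auto simp: is_biproduct_def arrow_def)

lemma biproduct_expand:
  assumes P: "is_biproduct C X Y P" "X \<in> Obj C" "Y \<in> Obj C" and s: "arrow C T (vertex P) s"
  shows "s = hadd C T (vertex P) (inj1 P \<cdot>\<^bsub>C\<^esub> (prj1 P \<cdot>\<^bsub>C\<^esub> s)) (inj2 P \<cdot>\<^bsub>C\<^esub> (prj2 P \<cdot>\<^bsub>C\<^esub> s))"
proof -
  note p = biproductD[OF P]
  show ?thesis
    using comp_add_left[OF s arrow_comp[OF p(3,1)] arrow_comp[OF p(4,2)]] p(9)
      comp_id_left[OF s] assoc[OF s p(3,1)] assoc[OF s p(4,2)] by simp
qed

lemma biproduct_eqI:
  assumes P: "is_biproduct C X Y P" "X \<in> Obj C" "Y \<in> Obj C"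
    and s: "arrow C T (vertex P) s" "arrow C T (vertex P) t"
    and e: "prj1 P \<cdot>\<^bsub>C\<^esub> s = prj1 P \<cdot>\<^bsub>C\<^esub> t" "prj2 P \<cdot>\<^bsub>C\<^esub> s = prj2 P \<cdot>\<^bsub>C\<^esub> t"
  shows "s = t"
  using biproduct_expand[OF P s(1)] biproduct_expand[OF P s(2)] e by simp

lemma biproduct_pair:
  assumes P: "is_biproduct C X Y P" and a: "arrow C T X a" and b: "arrow C T Y b"
  obtains s where "arrow C T (vertex P) s" "prj1 P \<cdot>\<^bsub>C\<^esub> s = a" "prj2 P \<cdot>\<^bsub>C\<^esub> s = b"
proof -
  note p = biproductD[OF P arrowD(2)[OF a] arrowD(2)[OF b]]
  let ?s = "hadd C T (vertex P) (inj1 P \<cdot>\<^bsub>C\<^esub> a) (inj2 P \<cdot>\<^bsub>C\<^esub> b)"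
  have "prj1 P \<cdot>\<^bsub>C\<^esub> ?s = hadd C T X a (hzero C T X)"
    using comp_add_right[OF arrow_comp[OF a p(1)] arrow_comp[OF b p(2)] p(3)]
      assoc[OF a p(1,3)] assoc[OF b p(2,3)] p(5,7) comp_id_left[OF a] comp_zero_left[OF b arrowD(2)[OF a]]
    by simp
  then have 1: "prj1 P \<cdot>\<^bsub>C\<^esub> ?s = a" using add_zero_right[OF a] by simp
  have "prj2 P \<cdot>\<^bsub>C\<^esub> ?s = hadd C T Y (hzero C T Y) b"
    using comp_add_right[OF arrow_comp[OF a p(1)] arrow_comp[OF b p(2)] p(4)]
      assoc[OF a p(1,4)] assoc[OF b p(2,4)] p(6,8) comp_id_left[OF b] comp_zero_left[OF a arrowD(2)[OF b]]
    by simp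
  then have 2: "prj2 P \<cdot>\<^bsub>C\<^esub> ?s = b" using add_zero_left[OF b] by simp
  show thesis
    using that[OF arrow_add[OF arrow_comp[OF a p(1)] arrow_comp[OF b p(2)]] 1 2] .
qed

lemma is_coneD:
  assumes K: "is_cone C X Y f K P" and X: "is_complex C X" and Y: "is_complex C Y"
  shows "is_biproduct C (cob X (n + 1)) (cob Y n) (P n)" "vertex (P n) = cob K n"
    "arrow C (cob K n) (cob K (n + 1)) (cdiff K n)"
    "arrow C (cob K n) (cob X (n + 1)) (prj1 (P n))" "arrow C (cob K n) (cob Y n) (prj2 (P n))"
    "prj1 (P (n + 1)) \<cdot>\<^bsub>C\<^esub> cdiff K n =
       hneg C (cob X (n + 1)) (cob X (n + 2)) (cdiff X (n + 1)) \<cdot>\<^bsub>C\<^esub> prj1 (P n)"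
    "prj2 (P (n + 1)) \<cdot>\<^bsub>C\<^esub> cdiff K n =
       hadd C (cob K n) (cob Y (n + 1)) (f (n + 1) \<cdot>\<^bsub>C\<^esub> prj1 (P n)) (cdiff Y n \<cdot>\<^bsub>C\<^esub> prj2 (P n))"
proof -
  have v: "is_biproduct C (cob X (n + 1)) (cob Y n) (P n)" "vertex (P n) = cob K n"
    using K unfolding is_cone_def by blast+
  then show "is_biproduct C (cob X (n + 1)) (cob Y n) (P n)" "vertex (P n) = cob K n"
    "arrow C (cob K n) (cob X (n + 1)) (prj1 (P n))" "arrow C (cob K n) (cob Y n) (prj2 (P n))"
    using biproductD(3,4)[OF v(1) complexD(1)[OF X] complexD(1)[OF Y]] by auto
  show "arrow C (cob K n) (cob K (n + 1)) (cdiff K n)"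
    "prj1 (P (n + 1)) \<cdot>\<^bsub>C\<^esub> cdiff K n =
       hneg C (cob X (n + 1)) (cob X (n + 2)) (cdiff X (n + 1)) \<cdot>\<^bsub>C\<^esub> prj1 (P n)"
    "prj2 (P (n + 1)) \<cdot>\<^bsub>C\<^esub> cdiff K n =
       hadd C (cob K n) (cob Y (n + 1)) (f (n + 1) \<cdot>\<^bsub>C\<^esub> prj1 (P n)) (cdiff Y n \<cdot>\<^bsub>C\<^esub> prj2 (P n))"
    using K unfolding is_cone_def by blast+
qed

text \<open>The differential of a cone on a generalized element \<open>(x, y)\<close>.\<close>

lemma cone_diff_components:
  assumes X: "is_complex C X" and Y: "is_complex C Y" and f: "is_chain_map C X Y f"
    and K: "is_cone C X Y f K P" and t: "arrow C T (cob K n) t"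
    and x: "prj1 (P n) \<cdot>\<^bsub>C\<^esub> t = x" and y: "prj2 (P n) \<cdot>\<^bsub>C\<^esub> t = y"
  shows "arrow C T (cob X (n + 1)) x" "arrow C T (cob Y n) y"
    "prj1 (P (n + 1)) \<cdot>\<^bsub>C\<^esub> (cdiff K n \<cdot>\<^bsub>C\<^esub> t) = hneg C T (cob X (n + 2)) (cdiff X (n + 1) \<cdot>\<^bsub>C\<^esub> x)"
    "prj2 (P (n + 1)) \<cdot>\<^bsub>C\<^esub> (cdiff K n \<cdot>\<^bsub>C\<^esub> t) =
       hadd C T (cob Y (n + 1)) (f (n + 1) \<cdot>\<^bsub>C\<^esub> x) (cdiff Y n \<cdot>\<^bsub>C\<^esub> y)"
proof -
  note k = is_coneD[OF K X Y, of n] and k1 = is_coneD[OF K X Y, of "n + 1"]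
  note F = chain_mapD(1)[OF X Y f]
  have e: "n + 1 + 1 = n + 2" by simp
  have dX: "arrow C (cob X (n + 1)) (cob X (n + 2)) (cdiff X (n + 1))"
    using complexD(2)[OF X, of "n + 1"] unfolding e .
  have p1: "arrow C (cob K (n + 1)) (cob X (n + 2)) (prj1 (P (n + 1)))" using k1(4) unfolding e .
  show ax: "arrow C T (cob X (n + 1)) x" using arrow_comp[OF t k(4)] x by simp
  show "arrow C T (cob Y n) y" using arrow_comp[OF t k(5)] y by simp
  show "prj1 (P (n + 1)) \<cdot>\<^bsub>C\<^esub> (cdiff K n \<cdot>\<^bsub>C\<^esub> t) = hneg C T (cob X (n + 2)) (cdiff X (n + 1) \<cdot>\<^bsub>C\<^esub> x)"
    using assoc[OF t k(3) p1] k(6) assoc[OF t k(4) arrow_neg[OF dX]] x comp_neg_left[OF ax dX] by simp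
  show "prj2 (P (n + 1)) \<cdot>\<^bsub>C\<^esub> (cdiff K n \<cdot>\<^bsub>C\<^esub> t) =
       hadd C T (cob Y (n + 1)) (f (n + 1) \<cdot>\<^bsub>C\<^esub> x) (cdiff Y n \<cdot>\<^bsub>C\<^esub> y)"
    using assoc[OF t k(3) k1(5)] k(7) assoc[OF t k(4) F] assoc[OF t k(5) complexD(2)[OF Y]] x y
      comp_add_left[OF t arrow_comp[OF k(4) F] arrow_comp[OF k(5) complexD(2)[OF Y]]] by simp
qed

text \<open>A direct chase takes the place of the long exact cohomology sequence; each of the two
  lifts, first in \<open>X\<close> and then in \<open>Y\<close>, costs one epimorphic cover.\<close>

lemma acyclic_cone:
  assumes X: "is_complex C X" and Y: "is_complex C Y" and f: "is_chain_map C X Y f"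
    and K: "is_cone C X Y f K P" and aX: "acyclic_complex C X" and aY: "acyclic_complex C Y"
  shows "acyclic_at C K n"
  unfolding acyclic_at_def
proof (intro allI impI)
  fix T t assume t: "arrow C T (cob K n) t" and dt: "cdiff K n \<cdot>\<^bsub>C\<^esub> t = hzero C T (cob K (n + 1))"
  note k = is_coneD[OF K X Y, of n] and k1 = is_coneD[OF K X Y, of "n + 1"]
  have e: "n + 1 + 1 = n + 2" "n - 1 + 1 = n" "n - 1 + 2 = n + 1" "n + 1 - 1 = n" by simp_all
  note F = chain_mapD[OF X Y f]
  have T: "T \<in> Obj C" using t by (simp add: arrow_def)
  define x y where "x = prj1 (P n) \<cdot>\<^bsub>C\<^esub> t" and "y = prj2 (P n) \<cdot>\<^bsub>C\<^esub> t"
  note xy = cone_diff_components[OF X Y f K t x_def[symmetric] y_def[symmetric]]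
  have p1: "arrow C (cob K (n + 1)) (cob X (n + 2)) (prj1 (P (n + 1)))" using k1(4) unfolding e .
  have dX: "arrow C (cob X (n + 1)) (cob X (n + 2)) (cdiff X (n + 1))"
    using complexD(2)[OF X, of "n + 1"] unfolding e .
  note dY = complexD(2)[OF Y, of n]
  \<comment> \<open>The two components of the cocycle equation are read off: \<open>d x = 0\<close>
    and \<open>f x + d y = 0\<close>.\<close>
  have "hneg C T (cob X (n + 2)) (cdiff X (n + 1) \<cdot>\<^bsub>C\<^esub> x) = hzero C T (cob X (n + 2))"
    using xy(3) dt comp_zero_right[OF T p1] by simp
  then have dx: "cdiff X (n + 1) \<cdot>\<^bsub>C\<^esub> x = hzero C T (cob X (n + 1 + 1))"
    using neg_neg[OF arrow_comp[OF xy(1) dX]] neg_zero[OF T complexD(1)[OF X]] unfolding e by metis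
  have fx: "hadd C T (cob Y (n + 1)) (f (n + 1) \<cdot>\<^bsub>C\<^esub> x) (cdiff Y n \<cdot>\<^bsub>C\<^esub> y) = hzero C T (cob Y (n + 1))"
    using xy(4) dt comp_zero_right[OF T k1(5)] by simp
  obtain T1 e1 x' where x': "arrow C T1 T e1" "is_epi C T1 T e1" "arrow C T1 (cob X n) x'"
    "cdiff X n \<cdot>\<^bsub>C\<^esub> x' = x \<cdot>\<^bsub>C\<^esub> e1"
    using acyclic_atD[OF spec[OF aX] xy(1) dx] unfolding e by blast
  \<comment> \<open>After the cover \<open>e1\<close>, \<open>x\<close> is \<open>d x'\<close>, so
    \<open>y + f x'\<close> is a cocycle of \<open>Y\<close> by
    \<open>f x + d y = 0\<close>.\<close>
  define z where "z = hadd C T1 (cob Y n) (y \<cdot>\<^bsub>C\<^esub> e1) (f n \<cdot>\<^bsub>C\<^esub> x')"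
  have ye: "arrow C T1 (cob Y n) (y \<cdot>\<^bsub>C\<^esub> e1)" using arrow_comp[OF x'(1) xy(2)] .
  have fx': "arrow C T1 (cob Y n) (f n \<cdot>\<^bsub>C\<^esub> x')" using arrow_comp[OF x'(3) F(1)] .
  have z: "arrow C T1 (cob Y n) z" unfolding z_def using arrow_add[OF ye fx'] .
  note fx1 = arrow_comp[OF xy(1) F(1)[of "n + 1"]] and dy1 = arrow_comp[OF xy(2) dY]
  have "cdiff Y n \<cdot>\<^bsub>C\<^esub> z = hadd C T1 (cob Y (n + 1)) (cdiff Y n \<cdot>\<^bsub>C\<^esub> (y \<cdot>\<^bsub>C\<^esub> e1)) (cdiff Y n \<cdot>\<^bsub>C\<^esub> (f n \<cdot>\<^bsub>C\<^esub> x'))"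
    unfolding z_def using comp_add_right[OF ye fx' dY] .
  also have "cdiff Y n \<cdot>\<^bsub>C\<^esub> (f n \<cdot>\<^bsub>C\<^esub> x') = (f (n + 1) \<cdot>\<^bsub>C\<^esub> x) \<cdot>\<^bsub>C\<^esub> e1"
    using assoc[OF x'(3) F(1) dY] F(2)[of n] assoc[OF x'(3) complexD(2)[OF X] F(1)] x'(4)
      assoc[OF x'(1) xy(1) F(1)] by simp
  also have "cdiff Y n \<cdot>\<^bsub>C\<^esub> (y \<cdot>\<^bsub>C\<^esub> e1) = (cdiff Y n \<cdot>\<^bsub>C\<^esub> y) \<cdot>\<^bsub>C\<^esub> e1"
    using assoc[OF x'(1) xy(2) dY] by simp
  also have "hadd C T1 (cob Y (n + 1)) ((cdiff Y n \<cdot>\<^bsub>C\<^esub> y) \<cdot>\<^bsub>C\<^esub> e1) ((f (n + 1) \<cdot>\<^bsub>C\<^esub> x) \<cdot>\<^bsub>C\<^esub> e1)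
      = hadd C T (cob Y (n + 1)) (f (n + 1) \<cdot>\<^bsub>C\<^esub> x) (cdiff Y n \<cdot>\<^bsub>C\<^esub> y) \<cdot>\<^bsub>C\<^esub> e1"
    using comp_add_left[OF x'(1) dy1 fx1] add_comm[OF dy1 fx1] by simp
  also have "\<dots> = hzero C T1 (cob Y (n + 1))"
    using fx comp_zero_left[OF x'(1) complexD(1)[OF Y]] by simp
  finally obtain T2 e2 b where b: "arrow C T2 T1 e2" "is_epi C T2 T1 e2" "arrow C T2 (cob Y (n - 1)) b"
    "cdiff Y (n - 1) \<cdot>\<^bsub>C\<^esub> b = z \<cdot>\<^bsub>C\<^esub> e2"
    using acyclic_atD[OF spec[OF aY] z] by blast
  note x'e = arrow_comp[OF b(1) x'(3)]
  \<comment> \<open>The sign offsets that of the shifted differential: \<open>(-x', b)\<close> has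
    differential \<open>(d x', -f x' + d b)\<close>, which is \<open>(x, y)\<close> after both
    covers.\<close>
  let ?a = "hneg C T2 (cob X n) (x' \<cdot>\<^bsub>C\<^esub> e2)"
  note k0 = is_coneD[OF K X Y, of "n - 1", unfolded e]
  obtain s where s: "arrow C T2 (cob K (n - 1)) s" "prj1 (P (n - 1)) \<cdot>\<^bsub>C\<^esub> s = ?a" "prj2 (P (n - 1)) \<cdot>\<^bsub>C\<^esub> s = b"
    using biproduct_pair[OF k0(1) arrow_neg[OF x'e] b(3)] k0(2) by auto
  note ds = cone_diff_components[OF X Y f K s, unfolded e]
  note ee = arrow_comp[OF b(1) x'(1)]
  have 1: "prj1 (P n) \<cdot>\<^bsub>C\<^esub> (cdiff K (n - 1) \<cdot>\<^bsub>C\<^esub> s) = prj1 (P n) \<cdot>\<^bsub>C\<^esub> (t \<cdot>\<^bsub>C\<^esub> (e1 \<cdot>\<^bsub>C\<^esub> e2))"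
    using ds(3) comp_neg_right[OF x'e complexD(2)[OF X]] neg_neg[OF arrow_comp[OF x'e complexD(2)[OF X]]]
      assoc[OF b(1) x'(3) complexD(2)[OF X]] x'(4) assoc[OF b(1) x'(1) xy(1)] assoc[OF ee t k(4)]
    by (simp add: x_def)
  have fxe: "arrow C T2 (cob Y n) (f n \<cdot>\<^bsub>C\<^esub> (x' \<cdot>\<^bsub>C\<^esub> e2))" using arrow_comp[OF x'e F(1)] .
  have yee: "arrow C T2 (cob Y n) (y \<cdot>\<^bsub>C\<^esub> (e1 \<cdot>\<^bsub>C\<^esub> e2))" using arrow_comp[OF ee xy(2)] .
  have ze: "z \<cdot>\<^bsub>C\<^esub> e2 = hadd C T2 (cob Y n) (f n \<cdot>\<^bsub>C\<^esub> (x' \<cdot>\<^bsub>C\<^esub> e2)) (y \<cdot>\<^bsub>C\<^esub> (e1 \<cdot>\<^bsub>C\<^esub> e2))"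
    unfolding z_def using comp_add_left[OF b(1) ye fx'] assoc[OF b(1) x'(1) xy(2)]
      assoc[OF b(1) x'(3) F(1)] add_comm[OF fxe yee] by simp
  have "prj2 (P n) \<cdot>\<^bsub>C\<^esub> (cdiff K (n - 1) \<cdot>\<^bsub>C\<^esub> s) = hadd C T2 (cob Y n)
      (hneg C T2 (cob Y n) (f n \<cdot>\<^bsub>C\<^esub> (x' \<cdot>\<^bsub>C\<^esub> e2)))
      (hadd C T2 (cob Y n) (f n \<cdot>\<^bsub>C\<^esub> (x' \<cdot>\<^bsub>C\<^esub> e2)) (y \<cdot>\<^bsub>C\<^esub> (e1 \<cdot>\<^bsub>C\<^esub> e2)))"
    using ds(4) b(4) ze comp_neg_right[OF x'e F(1)] by simp
  also have "\<dots> = y \<cdot>\<^bsub>C\<^esub> (e1 \<cdot>\<^bsub>C\<^esub> e2)"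
    using add_assoc[OF arrow_neg[OF fxe] fxe yee] add_neg_left[OF fxe] add_zero_left[OF yee] by simp
  finally have 2: "prj2 (P n) \<cdot>\<^bsub>C\<^esub> (cdiff K (n - 1) \<cdot>\<^bsub>C\<^esub> s) = prj2 (P n) \<cdot>\<^bsub>C\<^esub> (t \<cdot>\<^bsub>C\<^esub> (e1 \<cdot>\<^bsub>C\<^esub> e2))"
    using assoc[OF ee t k(5)] by (simp add: y_def)
  have "cdiff K (n - 1) \<cdot>\<^bsub>C\<^esub> s = t \<cdot>\<^bsub>C\<^esub> (e1 \<cdot>\<^bsub>C\<^esub> e2)"
    using biproduct_eqI[OF k(1) complexD(1)[OF X] complexD(1)[OF Y] _ _ 1 2]
      arrow_comp[OF s(1) k0(3)] arrow_comp[OF ee t] k(2) by simp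
  moreover have "is_epi C T2 T (e1 \<cdot>\<^bsub>C\<^esub> e2)"
    using epi_comp[OF _ _ b(2) x'(2) T] b(1) by (auto simp: arrow_def)
  ultimately show "\<exists>T' e s. arrow C T' T e \<and> is_epi C T' T e \<and> arrow C T' (cob K (n - 1)) s \<and>
        cdiff K (n - 1) \<cdot>\<^bsub>C\<^esub> s = t \<cdot>\<^bsub>C\<^esub> e"
    using ee s(1) by blast
qed

text \<open>On a cocycle \<open>(x, y)\<close>, the contracting homotopy of the cone of an identity is \<open>(y, 0)\<close>.\<close>

lemma acyclic_cone_ident:
  assumes X: "is_complex C X" and K: "is_cone C X X (\<lambda>n. Ident C (cob X n)) K P"
  shows "acyclic_at C K n"
  unfolding acyclic_at_def
proof (intro allI impI)
  fix T t assume t: "arrow C T (cob K n) t" and dt: "cdiff K n \<cdot>\<^bsub>C\<^esub> t = hzero C T (cob K (n + 1))"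
  note f = chain_map_ident[OF X]
  note k = is_coneD[OF K X X, of n] and k1 = is_coneD[OF K X X, of "n + 1"]
  have e: "n - 1 + 1 = n" "n - 1 + 2 = n + 1" by simp_all
  note k0 = is_coneD[OF K X X, of "n - 1", unfolded e]
  have T: "T \<in> Obj C" using t by (simp add: arrow_def)
  define x y where "x = prj1 (P n) \<cdot>\<^bsub>C\<^esub> t" and "y = prj2 (P n) \<cdot>\<^bsub>C\<^esub> t"
  note xy = cone_diff_components[OF X X f K t x_def[symmetric] y_def[symmetric]]
  note dy = arrow_comp[OF xy(2) complexD(2)[OF X]]
  have "hadd C T (cob X (n + 1)) x (cdiff X n \<cdot>\<^bsub>C\<^esub> y) = hzero C T (cob X (n + 1))"
    using xy(4) dt comp_zero_right[OF T k1(5)] comp_id_left[OF xy(1)] by simp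
  \<comment> \<open>The second component of the cocycle equation, \<open>x + d y = 0\<close>,
    determines \<open>x\<close>; so \<open>(y, 0)\<close> has differential
    \<open>(-d y, y) = (x, y)\<close>, with the identity as cover.\<close>
  then have x: "x = hneg C T (cob X (n + 1)) (cdiff X n \<cdot>\<^bsub>C\<^esub> y)"
    using neg_unique[OF dy xy(1)] add_comm[OF xy(1) dy] by simp
  note o = arrow_zero[OF T complexD(1)[OF X, of "n - 1"]]
  obtain s where s: "arrow C T (cob K (n - 1)) s" "prj1 (P (n - 1)) \<cdot>\<^bsub>C\<^esub> s = y"
    "prj2 (P (n - 1)) \<cdot>\<^bsub>C\<^esub> s = hzero C T (cob X (n - 1))"
    using biproduct_pair[OF k0(1) xy(2) o] k0(2) by auto
  note ds = cone_diff_components[OF X X f K s, unfolded e]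
  have 1: "prj1 (P n) \<cdot>\<^bsub>C\<^esub> (cdiff K (n - 1) \<cdot>\<^bsub>C\<^esub> s) = prj1 (P n) \<cdot>\<^bsub>C\<^esub> t"
    using ds(3) x by (simp add: x_def)
  have 2: "prj2 (P n) \<cdot>\<^bsub>C\<^esub> (cdiff K (n - 1) \<cdot>\<^bsub>C\<^esub> s) = prj2 (P n) \<cdot>\<^bsub>C\<^esub> t"
    using ds(4) comp_id_left[OF xy(2)] comp_zero_right[OF T complexD(3)[OF X, of n]]
      add_zero_right[OF xy(2)] by (simp add: y_def)
  have "cdiff K (n - 1) \<cdot>\<^bsub>C\<^esub> s = t"
    using biproduct_eqI[OF k(1) complexD(1)[OF X] complexD(1)[OF X] _ _ 1 2]
      arrow_comp[OF s(1) k0(3)] t k(2) by simp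
  then show "\<exists>T' e s. arrow C T' T e \<and> is_epi C T' T e \<and> arrow C T' (cob K (n - 1)) s \<and>
        cdiff K (n - 1) \<cdot>\<^bsub>C\<^esub> s = t \<cdot>\<^bsub>C\<^esub> e"
    using s(1) arrow_ident[OF T] epi_ident[OF T] comp_id_right[OF t] by metis
qed

lemma cone_is_complex:
  assumes X: "is_complex C X" and Y: "is_complex C Y" and f: "is_chain_map C X Y f"
    and K: "is_cone C X Y f K P"
  shows "is_complex C K"
proof (rule is_complexI)
  fix n :: int
  note k = is_coneD[OF K X Y, of n] and k1 = is_coneD[OF K X Y, of "n + 1"]
    and k2 = is_coneD[OF K X Y, of "n + 2"]
  note F = chain_mapD[OF X Y f]
  have e: "n + 1 + 1 = n + 2" "n + 1 + 2 = n + 3" "n + 2 + 1 = n + 3" by simp_all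
  show dK: "arrow C (cob K n) (cob K (n + 1)) (cdiff K n)" by (rule k(3))
  note dK1 = k1(3)[unfolded e]
  have oK: "cob K n \<in> Obj C" using dK by (simp add: arrow_def)
  \<comment> \<open>The identity of the cone serves as generalized element, so the element formulas
    yield the projections of the differential itself; a second application yields those of its
    square.\<close>
  note c0 = cone_diff_components[OF X Y f K arrow_ident[OF oK], unfolded comp_id_right[OF k(4)]
      comp_id_right[OF k(5)] comp_id_right[OF k(3)], OF refl refl]
  note c1 = cone_diff_components[OF X Y f K dK c0(3,4), unfolded e]
  note dX0 = complexD(2)[OF X, of "n + 1", unfolded e] and dX1 = complexD(2)[OF X, of "n + 2", unfolded e]
  note ddX = complexD(4)[OF X, of "n + 1", unfolded e]
  note dY0 = complexD(2)[OF Y, of n] and dY1 = complexD(2)[OF Y, of "n + 1", unfolded e]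
  note dXp = arrow_comp[OF k(4) dX0] and fp = arrow_comp[OF k(4) F(1)] and dYp = arrow_comp[OF k(5) dY0]
  note oX = complexD(1)[OF X, of "n + 3"] and oY = complexD(1)[OF Y, of "n + 2"]
  have "cdiff X (n + 2) \<cdot>\<^bsub>C\<^esub> (cdiff X (n + 1) \<cdot>\<^bsub>C\<^esub> prj1 (P n)) = hzero C (cob K n) (cob X (n + 3))"
    using assoc[OF k(4) dX0 dX1] ddX comp_zero_left[OF k(4) oX] by simp
  then have 1: "prj1 (P (n + 2)) \<cdot>\<^bsub>C\<^esub> (cdiff K (n + 1) \<cdot>\<^bsub>C\<^esub> cdiff K n) = hzero C (cob K n) (cob X (n + 3))"
    using c1(3) comp_neg_right[OF dXp dX1] neg_zero[OF oK oX] by simp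
  have "cdiff Y (n + 1) \<cdot>\<^bsub>C\<^esub> (cdiff Y n \<cdot>\<^bsub>C\<^esub> prj2 (P n)) = hzero C (cob K n) (cob Y (n + 2))"
    using assoc[OF k(5) dY0 dY1] complexD(4)[OF Y, of n] comp_zero_left[OF k(5) oY] by simp
  moreover have "cdiff Y (n + 1) \<cdot>\<^bsub>C\<^esub> (f (n + 1) \<cdot>\<^bsub>C\<^esub> prj1 (P n)) = f (n + 2) \<cdot>\<^bsub>C\<^esub> (cdiff X (n + 1) \<cdot>\<^bsub>C\<^esub> prj1 (P n))"
    using assoc[OF k(4) F(1) dY1] F(2)[of "n + 1", unfolded e] assoc[OF k(4) dX0 F(1)] by simp
  ultimately have "cdiff Y (n + 1) \<cdot>\<^bsub>C\<^esub> hadd C (cob K n) (cob Y (n + 1)) (f (n + 1) \<cdot>\<^bsub>C\<^esub> prj1 (P n))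
      (cdiff Y n \<cdot>\<^bsub>C\<^esub> prj2 (P n)) = f (n + 2) \<cdot>\<^bsub>C\<^esub> (cdiff X (n + 1) \<cdot>\<^bsub>C\<^esub> prj1 (P n))"
    using comp_add_right[OF fp dYp dY1] add_zero_right[OF arrow_comp[OF dXp F(1)]] by simp
  then have 2: "prj2 (P (n + 2)) \<cdot>\<^bsub>C\<^esub> (cdiff K (n + 1) \<cdot>\<^bsub>C\<^esub> cdiff K n) = hzero C (cob K n) (cob Y (n + 2))"
    using c1(4) comp_neg_right[OF dXp F(1)] add_neg_left[OF arrow_comp[OF dXp F(1)]] by simp
  have o2: "cob K (n + 2) \<in> Obj C" using dK1 by (simp add: arrow_def)
  show "cdiff K (n + 1) \<cdot>\<^bsub>C\<^esub> cdiff K n = hzero C (cob K n) (cob K (n + 2))"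
  proof (rule biproduct_eqI[OF k2(1) complexD(1)[OF X] complexD(1)[OF Y], unfolded k2(2)])
    show "arrow C (cob K n) (cob K (n + 2)) (cdiff K (n + 1) \<cdot>\<^bsub>C\<^esub> cdiff K n)"
      using arrow_comp[OF dK dK1] .
    show "arrow C (cob K n) (cob K (n + 2)) (hzero C (cob K n) (cob K (n + 2)))"
      using arrow_zero[OF oK o2] .
  qed (use 1 2 comp_zero_right[OF oK k2(4)] comp_zero_right[OF oK k2(5)] in \<open>simp_all add: e\<close>)
qed

end

section \<open>Zero complexes and the shift\<close>

context linear_category
begin

lemma is_zero_object_isomorphic:
  assumes "isomorphic C X Y" "is_zero_object C X" "X \<in> Obj C" "Y \<in> Obj C"
  shows "is_zero_object C Y"
proof -
  obtain f where "is_iso C X Y f" using assms(1) by (auto simp: isomorphic_def)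
  then obtain g where g: "arrow C X Y f" "arrow C Y X g" "f \<cdot>\<^bsub>C\<^esub> g = Ident C Y"
    using is_isoE assms(3,4) by blast
  then show ?thesis
    using arrow_to_zero[OF assms(2) g(2)] comp_zero_right[OF assms(4) g(1)] assms(4)
    by (simp add: is_zero_object_iff)
qed

lemma zero_complex_is_complex:
  assumes "\<And>n. is_zero_object C (cob X n)" "\<And>n. arrow C (cob X n) (cob X (n + 1)) (cdiff X n)"
  shows "is_complex C X"
proof (rule is_complexI[OF assms(2)])
  fix n :: int
  have e: "n + 1 + 1 = n + 2" by simp
  show "cdiff X (n + 1) \<cdot>\<^bsub>C\<^esub> cdiff X n = hzero C (cob X n) (cob X (n + 2))"
    using arrow_from_zero[OF assms(1) arrow_comp[OF assms(2)[of n] assms(2)[of "n + 1"]]] unfolding e .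
qed

lemma acyclic_if_zero_objects:
  assumes X: "is_complex C X" and Z: "\<And>n. is_zero_object C (cob X n)"
  shows "acyclic_at C X n"
  unfolding acyclic_at_def
proof (intro allI impI)
  fix T t assume t: "arrow C T (cob X n) t"
  have T: "T \<in> Obj C" using t by (simp add: arrow_def)
  have "cdiff X (n - 1) \<cdot>\<^bsub>C\<^esub> hzero C T (cob X (n - 1)) = t \<cdot>\<^bsub>C\<^esub> Ident C T"
    using comp_zero_right[OF T complexD(3)[OF X]] arrow_to_zero[OF Z t] comp_id_right[OF t] by simp
  then show "\<exists>T' e s. arrow C T' T e \<and> is_epi C T' T e \<and> arrow C T' (cob X (n - 1)) s \<and>
        cdiff X (n - 1) \<cdot>\<^bsub>C\<^esub> s = t \<cdot>\<^bsub>C\<^esub> e"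
    using arrow_ident[OF T] epi_ident[OF T] arrow_zero[OF T complexD(1)[OF X]] by blast
qed

lemma zero_object_Ch:
  assumes X: "is_complex C X" and Z: "\<And>n. is_zero_object C (cob X n)"
  shows "is_zero_object (Ch C) X"
proof -
  have "\<exists>!f. f \<in> Hom (Ch C) Y X" if Y: "Y \<in> Obj (Ch C)" for Y
  proof -
    have Y: "is_complex C Y" using Y by (simp add: Ch_simps)
    note o = arrow_zero[OF complexD(1)[OF Y] complexD(1)[OF X]]
    have "is_chain_map C Y X (\<lambda>n. hzero C (cob Y n) (cob X n))"
      by (rule is_chain_mapI[OF o])
        (simp add: comp_zero_left[OF complexD(2)[OF Y] complexD(1)[OF X]]
          comp_zero_right[OF complexD(1)[OF Y] complexD(2)[OF X]])
    moreover have "f = (\<lambda>n. hzero C (cob Y n) (cob X n))" if "is_chain_map C Y X f" for f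
      using arrow_to_zero[OF Z chain_mapD(1)[OF Y X that]] by blast
    ultimately show ?thesis by (auto simp: Ch_simps)
  qed
  moreover have "\<exists>!f. f \<in> Hom (Ch C) X Y" if Y: "Y \<in> Obj (Ch C)" for Y
  proof -
    have Y: "is_complex C Y" using Y by (simp add: Ch_simps)
    note o = arrow_zero[OF complexD(1)[OF X] complexD(1)[OF Y]]
    have "is_chain_map C X Y (\<lambda>n. hzero C (cob X n) (cob Y n))"
      by (rule is_chain_mapI[OF o])
        (simp add: comp_zero_left[OF complexD(2)[OF X] complexD(1)[OF Y]]
          comp_zero_right[OF complexD(1)[OF X] complexD(2)[OF Y]])
    moreover have "f = (\<lambda>n. hzero C (cob X n) (cob Y n))" if "is_chain_map C X Y f" for f
      using arrow_from_zero[OF Z chain_mapD(1)[OF X Y that]] by blast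
    ultimately show ?thesis by (auto simp: Ch_simps)
  qed
  ultimately show ?thesis using X by (auto simp: is_zero_object_def Ch_simps)
qed

lemma shift_simps:
  "cob (fob (shift_functor C) X) n = cob X (n + 1)"
  "cdiff (fob (shift_functor C) X) n = hneg C (cob X (n + 1)) (cob X (n + 2)) (cdiff X (n + 1))"
  "fmor (shift_functor C) f n = f (n + 1)"
  by (simp_all add: shift_functor_def)

lemma shift_complex:
  assumes X: "is_complex C X"
  shows "is_complex C (fob (shift_functor C) X)"
proof (rule is_complexI)
  fix n :: int
  have e: "n + 1 + 1 = n + 2" "n + 1 + 2 = n + 3" "n + 2 + 1 = n + 3" by simp_all
  note d = complexD(2)[OF X, of "n + 1", unfolded e] and d' = complexD(2)[OF X, of "n + 2", unfolded e]
  show "arrow C (cob (fob (shift_functor C) X) n) (cob (fob (shift_functor C) X) (n + 1))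
      (cdiff (fob (shift_functor C) X) n)"
    using arrow_neg[OF d] by (simp add: shift_simps e)
  show "cdiff (fob (shift_functor C) X) (n + 1) \<cdot>\<^bsub>C\<^esub> cdiff (fob (shift_functor C) X) n =
      hzero C (cob (fob (shift_functor C) X) n) (cob (fob (shift_functor C) X) (n + 2))"
    using comp_neg_left[OF arrow_neg[OF d] d'] comp_neg_right[OF d d'] neg_neg[OF arrow_comp[OF d d']]
      complexD(4)[OF X, of "n + 1", unfolded e] by (simp add: shift_simps e add.assoc)
qed

lemma shift_chain_map:
  assumes X: "is_complex C X" and Y: "is_complex C Y" and f: "is_chain_map C X Y f"
  shows "is_chain_map C (fob (shift_functor C) X) (fob (shift_functor C) Y) (fmor (shift_functor C) f)"
proof (rule is_chain_mapI)
  fix n :: int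
  have e: "n + 1 + 1 = n + 2" by simp
  note F = chain_mapD[OF X Y f]
  note dX = complexD(2)[OF X, of "n + 1", unfolded e] and dY = complexD(2)[OF Y, of "n + 1", unfolded e]
  show "arrow C (cob (fob (shift_functor C) X) n) (cob (fob (shift_functor C) Y) n)
      (fmor (shift_functor C) f n)" using F(1) by (simp add: shift_simps)
  show "fmor (shift_functor C) f (n + 1) \<cdot>\<^bsub>C\<^esub> cdiff (fob (shift_functor C) X) n =
      cdiff (fob (shift_functor C) Y) n \<cdot>\<^bsub>C\<^esub> fmor (shift_functor C) f n"
    using comp_neg_right[OF dX F(1)] comp_neg_left[OF F(1) dY] F(2)[of "n + 1", unfolded e]
    by (simp add: shift_simps e)
qed

lemma is_functor_shift: "is_functor (Ch C) (Ch C) (shift_functor C)"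
  unfolding is_functor_def
  by (auto simp: Ch_simps shift_complex shift_chain_map) (auto simp: shift_functor_def)

text \<open>The same cohomology data serve one degree lower. The sign changes neither kernel nor
  cokernel; only the boundary arrow \<open>b\<close> becomes \<open>-b\<close>.\<close>

lemma shift_cohomology:
  assumes X: "is_complex C X" and H: "is_cohomology C X (n + 1) H"
  shows "is_cohomology C (fob (shift_functor C) X) n H"
proof -
  have e: "n + 1 + 1 = n + 2" "n + 1 - 1 = n" "n - 1 + 1 = n" "n - 1 + 2 = n + 1" by simp_all
  note k = is_cohomologyD[OF H, unfolded e]
  obtain b where b: "arrow C (cob X n) (cyc H) b" "cyc_in H \<cdot>\<^bsub>C\<^esub> b = cdiff X n"
    "is_cokernel C (cob X n) (cyc H) b (coh H) (coh_pr H)"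
    using H unfolding is_cohomology_def e by blast
  have "cyc_in H \<cdot>\<^bsub>C\<^esub> hneg C (cob X n) (cyc H) b = hneg C (cob X n) (cob X (n + 1)) (cdiff X n)"
    using comp_neg_right[OF b(1) k(2)] b(2) by simp
  then show ?thesis
    unfolding is_cohomology_def shift_simps e
    using kernel_neg[OF k(1)] arrow_neg[OF b(1)] cokernel_neg[OF b(3)] by blast
qed

text \<open>The sign leaves the cocycles unchanged, and a primitive \<open>s\<close> for one
  differential gives the primitive \<open>-s\<close> for the other.\<close>

lemma acyclic_shift_iff:
  assumes X: "is_complex C X"
  shows "acyclic_at C (fob (shift_functor C) X) n \<longleftrightarrow> acyclic_at C X (n + 1)"
proof -
  have e: "n + 1 + 1 = n + 2" "n + 1 - 1 = n" "n - 1 + 1 = n" "n - 1 + 2 = n + 1" by simp_all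
  note d = complexD(2)[OF X, of "n + 1", unfolded e] and d' = complexD(2)[OF X, of n]
  have 1: "hneg C (cob X (n + 1)) (cob X (n + 2)) (cdiff X (n + 1)) \<cdot>\<^bsub>C\<^esub> t = hzero C T (cob X (n + 2))
      \<longleftrightarrow> cdiff X (n + 1) \<cdot>\<^bsub>C\<^esub> t = hzero C T (cob X (n + 2))" if t: "arrow C T (cob X (n + 1)) t" for T t
    using comp_neg_left[OF t d] neg_neg[OF arrow_comp[OF t d]] neg_zero[OF arrowD(1)[OF t] arrowD(2)[OF d]]
    by metis
  have 2: "(\<exists>s. arrow C T (cob X n) s \<and> hneg C (cob X n) (cob X (n + 1)) (cdiff X n) \<cdot>\<^bsub>C\<^esub> s = u)
      \<longleftrightarrow> (\<exists>s. arrow C T (cob X n) s \<and> cdiff X n \<cdot>\<^bsub>C\<^esub> s = u)" for T u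
  proof -
    have "hneg C (cob X n) (cob X (n + 1)) (cdiff X n) \<cdot>\<^bsub>C\<^esub> hneg C T (cob X n) s = cdiff X n \<cdot>\<^bsub>C\<^esub> s"
      if s: "arrow C T (cob X n) s" for s
      using comp_neg_left[OF arrow_neg[OF s] d'] comp_neg_right[OF s d'] neg_neg[OF arrow_comp[OF s d']]
      by simp
    moreover have "cdiff X n \<cdot>\<^bsub>C\<^esub> hneg C T (cob X n) s =
        hneg C (cob X n) (cob X (n + 1)) (cdiff X n) \<cdot>\<^bsub>C\<^esub> s" if s: "arrow C T (cob X n) s" for s
      using comp_neg_left[OF s d'] comp_neg_right[OF s d'] by simp
    ultimately show ?thesis using arrow_neg by metis
  qed
  have "acyclic_at C (fob (shift_functor C) X) n \<longleftrightarrow> (\<forall>T t. arrow C T (cob X (n + 1)) t \<longrightarrow>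
     cdiff X (n + 1) \<cdot>\<^bsub>C\<^esub> t = hzero C T (cob X (n + 2)) \<longrightarrow>
     (\<exists>T' e. arrow C T' T e \<and> is_epi C T' T e \<and> (\<exists>s. arrow C T' (cob X n) s \<and>
        hneg C (cob X n) (cob X (n + 1)) (cdiff X n) \<cdot>\<^bsub>C\<^esub> s = t \<cdot>\<^bsub>C\<^esub> e)))"
    unfolding acyclic_at_def shift_simps e using 1 by blast
  also have "\<dots> \<longleftrightarrow> acyclic_at C X (n + 1)"
    unfolding acyclic_at_def 2 e by blast
  finally show ?thesis .
qed

end

section \<open>The chosen cone, its structure maps, and the shift of quasi-isomorphisms\<close>

context preabelian_category
begin

lemma is_biproduct_biprod: "\<lbrakk>X \<in> Obj C; Y \<in> Obj C\<rbrakk> \<Longrightarrow> is_biproduct C X Y (biprod C X Y)"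
  unfolding biprod_def using ex_biproduct by (rule someI_ex)

text \<open>The bridge from the chosen cone, whose differential is a sum of three composites, to the
  description by projections: the biproduct relations kill the cross terms.\<close>

lemma is_cone_cone:
  assumes X: "is_complex C X" and Y: "is_complex C Y" and f: "is_chain_map C X Y f"
  shows "is_cone C X Y f (cone C X Y f) (cone_sum C X Y)"
  unfolding is_cone_def
proof (intro allI)
  fix n :: int
  have e: "n + 1 + 1 = n + 2" by simp
  let ?P = "cone_sum C X Y n" and ?Q = "cone_sum C X Y (n + 1)" and ?K = "cone C X Y f"
  have bP: "is_biproduct C (cob X (n + 1)) (cob Y n) ?P"
    and bQ: "is_biproduct C (cob X (n + 2)) (cob Y (n + 1)) ?Q"
    using is_biproduct_biprod complexD(1) X Y by (simp_all add: cone_sum_def e)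
  note o = complexD(1)[OF X] complexD(1)[OF Y]
  note p = biproductD[OF bP o] and q = biproductD[OF bQ o]
  have dX: "arrow C (cob X (n + 1)) (cob X (n + 2)) (hneg C (cob X (n + 1)) (cob X (n + 2)) (cdiff X (n + 1)))"
    using arrow_neg[OF complexD(2)[OF X, of "n + 1", unfolded e]] .
  note dY = complexD(2)[OF Y, of n]
  note F = chain_mapD(1)[OF X Y f, of "n + 1"]
  define a b c where "a = hneg C (cob X (n + 1)) (cob X (n + 2)) (cdiff X (n + 1)) \<cdot>\<^bsub>C\<^esub> prj1 ?P"
    and "b = f (n + 1) \<cdot>\<^bsub>C\<^esub> prj1 ?P" and "c = cdiff Y n \<cdot>\<^bsub>C\<^esub> prj2 ?P"
  have a: "arrow C (vertex ?P) (cob X (n + 2)) a" unfolding a_def using arrow_comp[OF p(3) dX] .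
  have b: "arrow C (vertex ?P) (cob Y (n + 1)) b" unfolding b_def using arrow_comp[OF p(3) F] .
  have c: "arrow C (vertex ?P) (cob Y (n + 1)) c" unfolding c_def using arrow_comp[OF p(4) dY] .
  note ia = arrow_comp[OF a q(1)] and ib = arrow_comp[OF b q(2)] and ic = arrow_comp[OF c q(2)]
  have d: "cdiff ?K n = hadd C (vertex ?P) (vertex ?Q)
      (hadd C (vertex ?P) (vertex ?Q) (inj1 ?Q \<cdot>\<^bsub>C\<^esub> a) (inj2 ?Q \<cdot>\<^bsub>C\<^esub> b)) (inj2 ?Q \<cdot>\<^bsub>C\<^esub> c)"
    using assoc[OF p(3) dX q(1)] assoc[OF p(3) F q(2)] assoc[OF p(4) dY q(2)]
    by (simp add: cone_def Let_def shift_functor_def a_def b_def c_def)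
  have v: "vertex ?P = cob ?K n" "vertex ?Q = cob ?K (n + 1)" by (simp_all add: cone_def)
  note oP = arrowD(1)[OF a]
  have 1: "prj1 ?Q \<cdot>\<^bsub>C\<^esub> cdiff ?K n = a"
    unfolding d
    using comp_add_right[OF arrow_add[OF ia ib] ic q(3)] comp_add_right[OF ia ib q(3)]
      assoc[OF a q(1,3)] assoc[OF b q(2,3)] assoc[OF c q(2,3)] q(5,7) comp_id_left[OF a]
      comp_zero_left[OF b arrowD(2)[OF a]] comp_zero_left[OF c arrowD(2)[OF a]] add_zero_right[OF a]
    by simp
  have 2: "prj2 ?Q \<cdot>\<^bsub>C\<^esub> cdiff ?K n = hadd C (vertex ?P) (cob Y (n + 1)) b c"
    unfolding d
    using comp_add_right[OF arrow_add[OF ia ib] ic q(4)] comp_add_right[OF ia ib q(4)]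
      assoc[OF a q(1,4)] assoc[OF b q(2,4)] assoc[OF c q(2,4)] q(6,8) comp_id_left[OF b] comp_id_left[OF c]
      comp_zero_left[OF a arrowD(2)[OF b]] add_zero_left[OF b]
    by simp
  show "is_biproduct C (cob X (n + 1)) (cob Y n) ?P \<and> vertex ?P = cob ?K n \<and>
     arrow C (cob ?K n) (cob ?K (n + 1)) (cdiff ?K n) \<and>
     prj1 ?Q \<cdot>\<^bsub>C\<^esub> cdiff ?K n = hneg C (cob X (n + 1)) (cob X (n + 2)) (cdiff X (n + 1)) \<cdot>\<^bsub>C\<^esub> prj1 ?P \<and>
     prj2 ?Q \<cdot>\<^bsub>C\<^esub> cdiff ?K n =
       hadd C (cob ?K n) (cob Y (n + 1)) (f (n + 1) \<cdot>\<^bsub>C\<^esub> prj1 ?P) (cdiff Y n \<cdot>\<^bsub>C\<^esub> prj2 ?P)"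
    using bP v 1 2 arrow_add[OF arrow_add[OF ia ib] ic] d by (simp add: a_def b_def c_def)
qed

lemma cone_complex:
  "\<lbrakk>is_complex C X; is_complex C Y; is_chain_map C X Y f\<rbrakk> \<Longrightarrow> is_complex C (cone C X Y f)"
  using cone_is_complex is_cone_cone by blast

lemma cone_in_chain_map:
  assumes X: "is_complex C X" and Y: "is_complex C Y" and f: "is_chain_map C X Y f"
  shows "is_chain_map C Y (cone C X Y f) (cone_in C X Y)"
proof (rule is_chain_mapI)
  fix n :: int
  let ?P = "cone_sum C X Y" and ?K = "cone C X Y f"
  have e: "n + 1 + 1 = n + 2" by simp
  note K = is_cone_cone[OF X Y f] and o = complexD(1)[OF X] complexD(1)[OF Y]
  note k = is_coneD[OF K X Y, of n] and k1 = is_coneD[OF K X Y, of "n + 1"]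
  note p = biproductD[OF k(1) o] and q = biproductD[OF k1(1) o]
  have i: "arrow C (cob Y n) (cob ?K n) (inj2 (?P n))" "arrow C (cob Y (n + 1)) (cob ?K (n + 1)) (inj2 (?P (n + 1)))"
    using p(2) q(2) k(2) k1(2) by simp_all
  then show "arrow C (cob Y n) (cob ?K n) (cone_in C X Y n)" by (simp add: cone_in_def)
  note dY = complexD(2)[OF Y, of n]
  \<comment> \<open>\<open>inj2\<close> is the generalized element \<open>(0, 1)\<close> of the
    cone.\<close>
  note c = cone_diff_components[OF X Y f K i(1) p(7) p(6)]
  note dX = complexD(2)[OF X, of "n + 1", unfolded e]
  have 1: "prj1 (?P (n + 1)) \<cdot>\<^bsub>C\<^esub> (inj2 (?P (n + 1)) \<cdot>\<^bsub>C\<^esub> cdiff Y n) =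
      prj1 (?P (n + 1)) \<cdot>\<^bsub>C\<^esub> (cdiff ?K n \<cdot>\<^bsub>C\<^esub> inj2 (?P n))"
    using c(3) assoc[OF dY q(2,3)] q(7) comp_zero_left[OF dY complexD(1)[OF X]]
      comp_zero_right[OF complexD(1)[OF Y] dX] neg_zero[OF complexD(1)[OF Y] complexD(1)[OF X]]
    by (simp add: e)
  have 2: "prj2 (?P (n + 1)) \<cdot>\<^bsub>C\<^esub> (inj2 (?P (n + 1)) \<cdot>\<^bsub>C\<^esub> cdiff Y n) =
      prj2 (?P (n + 1)) \<cdot>\<^bsub>C\<^esub> (cdiff ?K n \<cdot>\<^bsub>C\<^esub> inj2 (?P n))"
    using c(4) assoc[OF dY q(2,4)] q(6) comp_id_left[OF dY] comp_id_right[OF dY] add_zero_left[OF dY]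
      comp_zero_right[OF complexD(1)[OF Y] chain_mapD(1)[OF X Y f]] by simp
  have "inj2 (?P (n + 1)) \<cdot>\<^bsub>C\<^esub> cdiff Y n = cdiff ?K n \<cdot>\<^bsub>C\<^esub> inj2 (?P n)"
    by (rule biproduct_eqI[OF k1(1) o _ _ 1 2])
      (use arrow_comp[OF dY i(2)] arrow_comp[OF i(1) k(3)] k1(2) in simp_all)
  then show "cone_in C X Y (n + 1) \<cdot>\<^bsub>C\<^esub> cdiff Y n = cdiff ?K n \<cdot>\<^bsub>C\<^esub> cone_in C X Y n"
    by (simp add: cone_in_def)
qed

lemma cone_out_chain_map:
  assumes X: "is_complex C X" and Y: "is_complex C Y" and f: "is_chain_map C X Y f"
  shows "is_chain_map C (cone C X Y f) (fob (shift_functor C) X) (cone_out C X Y)"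
proof (rule is_chain_mapI)
  fix n :: int
  note k = is_coneD[OF is_cone_cone[OF X Y f] X Y, of n]
  show "arrow C (cob (cone C X Y f) n) (cob (fob (shift_functor C) X) n) (cone_out C X Y n)"
    using k(4) by (simp add: cone_out_def shift_simps)
  show "cone_out C X Y (n + 1) \<cdot>\<^bsub>C\<^esub> cdiff (cone C X Y f) n =
      cdiff (fob (shift_functor C) X) n \<cdot>\<^bsub>C\<^esub> cone_out C X Y n"
    using k(6) by (simp add: cone_out_def shift_simps)
qed

lemma shift_quasi_iso:
  assumes X: "is_complex C X" and Y: "is_complex C Y" and f: "f \<in> quasi_isos C X Y"
  shows "fmor (shift_functor C) f \<in> quasi_isos C (fob (shift_functor C) X) (fob (shift_functor C) Y)"
proof -
  have f': "is_chain_map C X Y f" using f by (simp add: quasi_isos_def)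
  show ?thesis
  proof (rule quasi_isosI[OF shift_complex[OF X] shift_complex[OF Y] shift_chain_map[OF X Y f']])
    fix n
    let ?H = "chosen_cohomology C X (n + 1)" and ?K = "chosen_cohomology C Y (n + 1)"
    note c = chosen_cohomology[OF X] chosen_cohomology[OF Y]
    have m: "is_cohomology_map C ?H ?K (fmor (shift_functor C) f n) (cohomology_map C X Y f (n + 1))"
      using is_cohomology_map_cohomology_map[OF X Y f'] by (simp add: shift_simps)
    then show "\<exists>H H' h. is_cohomology C (fob (shift_functor C) X) n H \<and>
        is_cohomology C (fob (shift_functor C) Y) n H' \<and>
        is_cohomology_map C H H' (fmor (shift_functor C) f n) h \<and> is_iso C (coh H) (coh H') h"
      using shift_cohomology[OF X c(1)] shift_cohomology[OF Y c(2)]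
        quasi_isosD[OF X Y f c(1,2) is_cohomology_map_cohomology_map[OF X Y f']] by blast
  qed
qed

lemma localizing_shift:
  "localizing_functor (Ch C) (quasi_isos C) (Ch C) (quasi_isos C) (shift_functor C)"
  using localizing_quasi_isos is_functor_shift shift_quasi_iso
  by (simp add: localizing_functor_def localizing_functor_axioms_def Ch_simps)

text \<open>All cohomology objects vanish on both sides, and any arrow between zero objects is
  invertible.\<close>

lemma quasi_iso_acyclic:
  assumes X: "is_complex C X" "acyclic_complex C X" and Y: "is_complex C Y" "acyclic_complex C Y"
    and f: "is_chain_map C X Y f"
  shows "f \<in> quasi_isos C X Y"
proof (rule quasi_isosI[OF X(1) Y(1) f])
  fix n
  note c = chosen_cohomology[OF X(1), of n] chosen_cohomology[OF Y(1), of n]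
  note m = is_cohomology_map_cohomology_map[OF X(1) Y(1) f, of n]
  have "is_iso C (coh (chosen_cohomology C X n)) (coh (chosen_cohomology C Y n)) (cohomology_map C X Y f n)"
    using iso_if_zero_objects[OF acyclic_at_cohomology_zero[OF X(1) _ c(1)]
      acyclic_at_cohomology_zero[OF Y(1) _ c(2)]] X(2) Y(2) m by (simp add: is_cohomology_map_def)
  with c m show "\<exists>H H' h. is_cohomology C X n H \<and> is_cohomology C Y n H' \<and>
      is_cohomology_map C H H' (f n) h \<and> is_iso C (coh H) (coh H') h" by blast
qed

end

lemma abelian_is_preabelian:
  assumes "abelian_category R C"
  shows "preabelian_category R C"
proof -
  interpret abelian_category R C by fact
  show ?thesis
    by unfold_locales
      (auto simp: arrow_def intro: zero_object_exists biproduct_exists kernel_exists cokernel_exists)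
qed

sublocale abelian_category \<subseteq> preabelian_category R C
  by (rule abelian_is_preabelian) (rule abelian_category_axioms)

section \<open>Covers by pullback of epimorphisms in an abelian category\<close>

context abelian_category
begin

text \<open>Normality presents \<open>f\<close> as the cokernel of some \<open>g\<close>. As
  \<open>g\<close> factors through \<open>k\<close>, an arrow that kills \<open>k\<close> also kills
  \<open>g\<close> and hence extends along \<open>f\<close>.\<close>

lemma epi_is_cokernel_of_kernel:
  assumes f: "arrow C X Y f" "is_epi C X Y f" and k: "is_kernel C X Y f K k"
  shows "is_cokernel C K X k Y f"
proof -
  obtain W g where g: "is_cokernel C W X g Y f"
    using epi_normal[OF _ _ f(2)] f(1) by (auto simp: arrow_def)
  note dg = is_cokernelD[OF g] and dk = is_kernelD[OF k]
  obtain u where u: "arrow C W K u" "k \<cdot>\<^bsub>C\<^esub> u = g" using kernel_lift[OF k dg(1,3)] by blast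
  show ?thesis
  proof (rule is_cokernelI[OF dk(2) f(1) dk(3)])
    fix T t assume t: "arrow C X T t" "t \<cdot>\<^bsub>C\<^esub> k = hzero C K T"
    have "t \<cdot>\<^bsub>C\<^esub> g = hzero C W T"
      using assoc[OF u(1) dk(2) t(1)] u(2) t(2) comp_zero_left[OF u(1) arrowD(2)[OF t(1)]] by simp
    then show "\<exists>u. arrow C Y T u \<and> u \<cdot>\<^bsub>C\<^esub> f = t" using cokernel_extend[OF g t(1)] by blast
  next
    fix T u v assume "arrow C Y T u" "arrow C Y T v" "u \<cdot>\<^bsub>C\<^esub> f = v \<cdot>\<^bsub>C\<^esub> f"
    then show "u = v" using cokernel_cancel[OF g] by blast
  qed
qed

text \<open>The pullback of \<open>f\<close> and \<open>g\<close> is the kernel of \<open>g p\<^sub>1 - f p\<^sub>2\<close>, which is an epimorphism and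
  hence the cokernel of the pullback.\<close>

lemma epi_pullback:
  assumes g: "arrow C X Z g" and f: "arrow C Y Z f" "is_epi C Y Z f"
  obtains P a b where "arrow C P X a" "arrow C P Y b" "is_epi C P X a" "g \<cdot>\<^bsub>C\<^esub> a = f \<cdot>\<^bsub>C\<^esub> b"
proof -
  have o: "X \<in> Obj C" "Y \<in> Obj C" "Z \<in> Obj C" using g f by (auto simp: arrow_def)
  obtain B where B: "is_biproduct C X Y B" using ex_biproduct o by blast
  note p = biproductD[OF B o(1,2)]
  have fn: "arrow C Y Z (hneg C Y Z f)" using arrow_neg[OF f(1)] .
  let ?h = "hadd C (vertex B) Z (g \<cdot>\<^bsub>C\<^esub> prj1 B) (hneg C Y Z f \<cdot>\<^bsub>C\<^esub> prj2 B)"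
  note gp = arrow_comp[OF p(3) g] and fp = arrow_comp[OF p(4) fn]
  have h: "arrow C (vertex B) Z ?h" using arrow_add[OF gp fp] .
  have h2: "?h \<cdot>\<^bsub>C\<^esub> inj2 B = hneg C Y Z f"
    using comp_add_left[OF p(2) gp fp] assoc[OF p(2) p(3) g] assoc[OF p(2) p(4) fn] p(6,7)
      comp_zero_right[OF o(2) g] comp_id_right[OF fn] add_zero_left[OF fn] by simp
  have fne: "is_epi C Y Z (hneg C Y Z f)"
    unfolding is_epi_iff[OF fn]
  proof (intro allI impI)
    fix T s assume s: "arrow C Z T s" "s \<cdot>\<^bsub>C\<^esub> hneg C Y Z f = hzero C Y T"
    then have "s \<cdot>\<^bsub>C\<^esub> f = hzero C Y T"
      using comp_neg_right[OF f(1) s(1)] neg_neg[OF arrow_comp[OF f(1) s(1)]]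
        neg_zero[OF o(2) arrowD(2)[OF s(1)]] by simp
    then show "s = hzero C Z T" using f(2) s(1) is_epi_iff[OF f(1)] by blast
  qed
  \<comment> \<open>Restricted along \<open>inj2 B\<close>, \<open>?h\<close> is \<open>-f\<close>,
    which is epi.\<close>
  have he: "is_epi C (vertex B) Z ?h" using epi_right_factor[OF _ p(2) h] fne h2 by simp
  obtain P k where k: "is_kernel C (vertex B) Z ?h P k" using ex_kernel[OF h] by blast
  note ck = epi_is_cokernel_of_kernel[OF h he k] and dk = is_kernelD[OF k]
  note a = arrow_comp[OF dk(2) p(3)] and b = arrow_comp[OF dk(2) p(4)]
  have "hadd C P Z (g \<cdot>\<^bsub>C\<^esub> (prj1 B \<cdot>\<^bsub>C\<^esub> k)) (hneg C P Z (f \<cdot>\<^bsub>C\<^esub> (prj2 B \<cdot>\<^bsub>C\<^esub> k))) = hzero C P Z"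
    using dk(3) comp_add_left[OF dk(2) gp fp] assoc[OF dk(2) p(3) g] assoc[OF dk(2) p(4) fn]
      comp_neg_left[OF b f(1)] by simp
  then have 1: "g \<cdot>\<^bsub>C\<^esub> (prj1 B \<cdot>\<^bsub>C\<^esub> k) = f \<cdot>\<^bsub>C\<^esub> (prj2 B \<cdot>\<^bsub>C\<^esub> k)"
    using diff_zero_iff[OF arrow_comp[OF a g] arrow_comp[OF b f(1)]] by simp
  have 2: "is_epi C P X (prj1 B \<cdot>\<^bsub>C\<^esub> k)"
    unfolding is_epi_iff[OF a]
  proof (intro allI impI)
    fix T s assume s: "arrow C X T s" "s \<cdot>\<^bsub>C\<^esub> (prj1 B \<cdot>\<^bsub>C\<^esub> k) = hzero C P T"
    have oT: "T \<in> Obj C" using s(1) by (simp add: arrow_def)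
    \<comment> \<open>If \<open>s\<close> kills the candidate, then \<open>s\<close> after
      \<open>prj1 B\<close> factors as \<open>v\<close> after \<open>?h\<close>. Along
      \<open>inj2 B\<close> this says that \<open>v\<close> kills \<open>-f\<close>, so
      \<open>v = 0\<close>; along \<open>inj1 B\<close> it then gives \<open>s = 0\<close>.\<close>
    obtain v where v: "arrow C Z T v" "v \<cdot>\<^bsub>C\<^esub> ?h = s \<cdot>\<^bsub>C\<^esub> prj1 B"
      using cokernel_extend[OF ck arrow_comp[OF p(3) s(1)]] s(2) assoc[OF dk(2) p(3) s(1)] by auto
    have "v \<cdot>\<^bsub>C\<^esub> hneg C Y Z f = hzero C Y T"
      using assoc[OF p(2) h v(1)] h2 v(2) assoc[OF p(2,3) s(1)] p(7) comp_zero_right[OF o(2) s(1)] by simp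
    then have "v = hzero C Z T" using fne v(1) is_epi_iff[OF fn] by blast
    then have "s \<cdot>\<^bsub>C\<^esub> prj1 B = hzero C (vertex B) T" using v(2) comp_zero_left[OF h oT] by simp
    then show "s = hzero C X T"
      using assoc[OF p(1,3) s(1)] p(5) comp_id_right[OF s(1)] comp_zero_left[OF p(1) oT] by simp
  qed
  show thesis using that[OF a b 2 1] .
qed

text \<open>A cocycle factors through the kernel of the differential. Pulling the epimorphic
  boundary arrow back along this factor supplies both the cover and the primitive.\<close>

lemma acyclic_at_if_cohomology_zero:
  assumes X: "is_complex C X" and H: "is_cohomology C X n H" and Z: "is_zero_object C (coh H)"
  shows "acyclic_at C X n"
  unfolding acyclic_at_def
proof (intro allI impI)
  fix T t assume t: "arrow C T (cob X n) t" "cdiff X n \<cdot>\<^bsub>C\<^esub> t = hzero C T (cob X (n + 1))"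
  note k = is_cohomologyD[OF H]
  obtain b where b: "arrow C (cob X (n - 1)) (cyc H) b" "cyc_in H \<cdot>\<^bsub>C\<^esub> b = cdiff X (n - 1)"
    "is_cokernel C (cob X (n - 1)) (cyc H) b (coh H) (coh_pr H)"
    using H unfolding is_cohomology_def by blast
  have be: "is_epi C (cob X (n - 1)) (cyc H) b" using cokernel_zero_iff_epi[OF b(3)] Z by simp
  obtain u where u: "arrow C T (cyc H) u" "cyc_in H \<cdot>\<^bsub>C\<^esub> u = t" using kernel_lift[OF k(1) t] by blast
  obtain P e s where e: "arrow C P T e" "arrow C P (cob X (n - 1)) s" "is_epi C P T e"
    "u \<cdot>\<^bsub>C\<^esub> e = b \<cdot>\<^bsub>C\<^esub> s" using epi_pullback[OF u(1) b(1) be] by blast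
  have "cdiff X (n - 1) \<cdot>\<^bsub>C\<^esub> s = t \<cdot>\<^bsub>C\<^esub> e"
    using assoc[OF e(2) b(1) k(2)] b(2) assoc[OF e(1) u(1) k(2)] u(2) e(4) by simp
  with e show "\<exists>T' e s. arrow C T' T e \<and> is_epi C T' T e \<and> arrow C T' (cob X (n - 1)) s \<and>
        cdiff X (n - 1) \<cdot>\<^bsub>C\<^esub> s = t \<cdot>\<^bsub>C\<^esub> e" by blast
qed

text \<open>\<open>X\<close> and \<open>Y\<close> are linked only by a zigzag, perhaps by no single
  chain map. Evaluating the zigzag by cohomology makes the cohomology objects isomorphic, so they
  vanish together.\<close>

lemma acyclic_isomorphic:
  assumes X: "is_complex C X" and Y: "is_complex C Y"
    and iso: "isomorphic (localization (Ch C) (quasi_isos C)) X Y" and ac: "acyclic_complex C X"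
  shows "acyclic_complex C Y"
proof
  fix n
  interpret inverting_assignment "Ch C" "quasi_isos C" C "\<lambda>X. coh (chosen_cohomology C X n)"
    "\<lambda>X Y f. cohomology_map C X Y f n" by (rule inverting_cohomology)
  note c = chosen_cohomology[OF X, of n] chosen_cohomology[OF Y, of n]
  have "is_zero_object C (coh (chosen_cohomology C X n))"
    using acyclic_at_cohomology_zero[OF X _ c(1)] ac by blast
  then have "is_zero_object C (coh (chosen_cohomology C Y n))"
    using is_zero_object_isomorphic[OF isomorphic_value[OF iso]] is_cohomologyD(5)[OF c(1)]
      is_cohomologyD(5)[OF c(2)] by blast
  then show "acyclic_at C Y n" using acyclic_at_if_cohomology_zero[OF Y c(2)] by blast
qed

end

section \<open>Exact functors\<close>

text \<open>Exactness is preservation of all kernels and cokernels. Both ends are preabelian because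
  the glued category is source or target in every use.\<close>

locale exact_functor = S: preabelian_category R C + T: preabelian_category R D
  for R :: "('r, 'x) ring_scheme" and C :: "('o, 'm, 'r, 'y) lincat_scheme"
    and D :: "('p, 'n, 'r, 'z) lincat_scheme" +
  fixes F :: "('o, 'm, 'p, 'n) functor_data"
  assumes F: "is_functor C D F"
    and F_add: "\<lbrakk>arrow C X Y f; arrow C X Y g\<rbrakk>
      \<Longrightarrow> fmor F (hadd C X Y f g) = hadd D (fob F X) (fob F Y) (fmor F f) (fmor F g)"
    and F_kernel: "is_kernel C X Y f K k \<Longrightarrow> is_kernel D (fob F X) (fob F Y) (fmor F f) (fob F K) (fmor F k)"
    and F_cokernel: "is_cokernel C X Y f Q q \<Longrightarrow> is_cokernel D (fob F X) (fob F Y) (fmor F f) (fob F Q) (fmor F q)"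
begin

lemmas F_obj = is_functorD(1)[OF F] and F_ident = is_functorD(2)[OF F]
  and F_arrow = is_functorD(3)[OF F] and F_comp = is_functorD(4)[OF F]

lemma F_zero:
  assumes "X \<in> Obj C" "Y \<in> Obj C"
  shows "fmor F (hzero C X Y) = hzero D (fob F X) (fob F Y)"
  using T.add_self_zero[OF F_arrow[OF S.arrow_zero[OF assms]]]
    F_add[OF S.arrow_zero[OF assms] S.arrow_zero[OF assms]]
    S.add_zero_left[OF S.arrow_zero[OF assms]] by simp

lemma F_neg:
  assumes f: "arrow C X Y f"
  shows "fmor F (hneg C X Y f) = hneg D (fob F X) (fob F Y) (fmor F f)"
proof (rule T.neg_unique[OF F_arrow[OF f] F_arrow[OF S.arrow_neg[OF f]]])
  show "hadd D (fob F X) (fob F Y) (fmor F f) (fmor F (hneg C X Y f)) = hzero D (fob F X) (fob F Y)"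
    using F_add[OF f S.arrow_neg[OF f]] S.add_neg_right[OF f] F_zero arrowD[OF f] by simp
qed

abbreviation FC where "FC \<equiv> chain_functor F"

lemma chain_functor_simps:
  "cob (fob FC X) n = fob F (cob X n)" "cdiff (fob FC X) n = fmor F (cdiff X n)"
  "fmor FC f n = fmor F (f n)"
  by (simp_all add: chain_functor_def)

lemma chain_functor_complex:
  assumes X: "is_complex C X"
  shows "is_complex D (fob FC X)"
proof (rule T.is_complexI)
  fix n :: int
  have e: "n + 1 + 1 = n + 2" by simp
  note d = S.complexD(2)[OF X, of n] and d1 = S.complexD(2)[OF X, of "n + 1", unfolded e]
  show "arrow D (cob (fob FC X) n) (cob (fob FC X) (n + 1)) (cdiff (fob FC X) n)"
    using F_arrow[OF d] by (simp add: chain_functor_simps)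
  show "cdiff (fob FC X) (n + 1) \<cdot>\<^bsub>D\<^esub> cdiff (fob FC X) n = hzero D (cob (fob FC X) n) (cob (fob FC X) (n + 2))"
    using F_comp[OF d d1] S.complexD(4)[OF X, of n] F_zero[OF arrowD(1)[OF d] arrowD(2)[OF d1]]
    by (simp add: chain_functor_simps)
qed

lemma chain_functor_chain_map:
  assumes X: "is_complex C X" and Y: "is_complex C Y" and f: "is_chain_map C X Y f"
  shows "is_chain_map D (fob FC X) (fob FC Y) (fmor FC f)"
proof (rule T.is_chain_mapI)
  fix n :: int
  note c = S.chain_mapD[OF X Y f]
  show "arrow D (cob (fob FC X) n) (cob (fob FC Y) n) (fmor FC f n)"
    using F_arrow[OF c(1)] by (simp add: chain_functor_simps)
  show "fmor FC f (n + 1) \<cdot>\<^bsub>D\<^esub> cdiff (fob FC X) n = cdiff (fob FC Y) n \<cdot>\<^bsub>D\<^esub> fmor FC f n"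
    using F_comp[OF S.complexD(2)[OF X] c(1)] F_comp[OF c(1) S.complexD(2)[OF Y]] c(2)
    by (simp add: chain_functor_simps)
qed

lemma is_functor_chain: "is_functor (Ch C) (Ch D) FC"
proof -
  have "fmor FC (\<lambda>n. g n \<cdot>\<^bsub>C\<^esub> f n) = (\<lambda>n. fmor FC g n \<cdot>\<^bsub>D\<^esub> fmor FC f n)"
    if "is_complex C X" "is_complex C Y" "is_complex C Z" "is_chain_map C X Y f" "is_chain_map C Y Z g"
    for X Y Z f g
    using F_comp[OF S.chain_mapD(1)[OF that(1,2,4)] S.chain_mapD(1)[OF that(2,3,5)]]
    by (simp add: chain_functor_def)
  moreover have "fmor FC (\<lambda>n. Ident C (cob X n)) = (\<lambda>n. Ident D (cob (fob FC X) n))"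
    if "is_complex C X" for X
    using F_ident[OF S.complexD(1)[OF that]] by (simp add: chain_functor_def)
  ultimately show ?thesis
    unfolding is_functor_def
    using chain_functor_complex chain_functor_chain_map by (simp add: S.Ch_simps T.Ch_simps)
qed

definition map_cohomology :: "('o, 'm) cohomology_data \<Rightarrow> ('p, 'n) cohomology_data" where
  "map_cohomology H = \<lparr>cyc = fob F (cyc H), cyc_in = fmor F (cyc_in H),
     coh = fob F (coh H), coh_pr = fmor F (coh_pr H)\<rparr>"

lemma is_cohomology_map_cohomology:
  assumes X: "is_complex C X" and H: "is_cohomology C X n H"
  shows "is_cohomology D (fob FC X) n (map_cohomology H)"
proof -
  note k = S.is_cohomologyD[OF H]
  obtain b where b: "arrow C (cob X (n - 1)) (cyc H) b" "cyc_in H \<cdot>\<^bsub>C\<^esub> b = cdiff X (n - 1)"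
    "is_cokernel C (cob X (n - 1)) (cyc H) b (coh H) (coh_pr H)"
    using H unfolding is_cohomology_def by blast
  have "fmor F (cyc_in H) \<cdot>\<^bsub>D\<^esub> fmor F b = fmor F (cdiff X (n - 1))"
    using F_comp[OF b(1) k(2)] b(2) by simp
  then show ?thesis
    using F_kernel[OF k(1)] F_cokernel[OF b(3)] F_arrow[OF b(1)]
    unfolding is_cohomology_def map_cohomology_def by (auto simp: chain_functor_simps)
qed

lemma cohomology_map_map_cohomology:
  assumes H: "is_cohomology C X n H" and H': "is_cohomology C Y n H'"
    and f: "arrow C (cob X n) (cob Y n) f" and h: "is_cohomology_map C H H' f h"
  shows "is_cohomology_map D (map_cohomology H) (map_cohomology H') (fmor F f) (fmor F h)"
proof -
  note k = S.is_cohomologyD[OF H] and k' = S.is_cohomologyD[OF H']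
  obtain u where u: "arrow C (cyc H) (cyc H') u" "cyc_in H' \<cdot>\<^bsub>C\<^esub> u = f \<cdot>\<^bsub>C\<^esub> cyc_in H"
    "h \<cdot>\<^bsub>C\<^esub> coh_pr H = coh_pr H' \<cdot>\<^bsub>C\<^esub> u" using h unfolding is_cohomology_map_def by blast
  have h: "arrow C (coh H) (coh H') h" using h by (simp add: is_cohomology_map_def)
  have "fmor F (cyc_in H') \<cdot>\<^bsub>D\<^esub> fmor F u = fmor F f \<cdot>\<^bsub>D\<^esub> fmor F (cyc_in H)"
    using F_comp[OF u(1) k'(2)] F_comp[OF k(2) f] u(2) by simp
  moreover have "fmor F h \<cdot>\<^bsub>D\<^esub> fmor F (coh_pr H) = fmor F (coh_pr H') \<cdot>\<^bsub>D\<^esub> fmor F u"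
    using F_comp[OF u(1) k'(3)] F_comp[OF k(3) h] u(3) by simp
  ultimately show ?thesis
    using F_arrow[OF u(1)] F_arrow[OF h] unfolding is_cohomology_map_def map_cohomology_def by auto
qed

lemma F_iso:
  assumes "is_iso C X Y f" "X \<in> Obj C" "Y \<in> Obj C"
  shows "is_iso D (fob F X) (fob F Y) (fmor F f)"
proof -
  obtain g where g: "arrow C X Y f" "arrow C Y X g" "g \<cdot>\<^bsub>C\<^esub> f = Ident C X" "f \<cdot>\<^bsub>C\<^esub> g = Ident C Y"
    using S.is_isoE[OF assms] by blast
  have "fmor F g \<cdot>\<^bsub>D\<^esub> fmor F f = Ident D (fob F X)" "fmor F f \<cdot>\<^bsub>D\<^esub> fmor F g = Ident D (fob F Y)"
    using F_comp[OF g(1,2)] F_comp[OF g(2,1)] g(3,4) F_ident assms by auto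
  then show ?thesis using T.is_isoI[OF F_arrow[OF g(1)] F_arrow[OF g(2)]] by blast
qed

text \<open>Images of chosen cohomology data are cohomology data of the image complex, the image of
  an induced map is the induced map between them, and functors preserve isomorphisms.\<close>

lemma chain_functor_quasi_iso:
  assumes X: "is_complex C X" and Y: "is_complex C Y" and f: "f \<in> quasi_isos C X Y"
  shows "fmor FC f \<in> quasi_isos D (fob FC X) (fob FC Y)"
proof -
  have f': "is_chain_map C X Y f" using f by (simp add: quasi_isos_def)
  show ?thesis
  proof (rule T.quasi_isosI[OF chain_functor_complex[OF X] chain_functor_complex[OF Y]
        chain_functor_chain_map[OF X Y f']])
    fix n
    note c = S.chosen_cohomology[OF X, of n] S.chosen_cohomology[OF Y, of n]
    note m = S.is_cohomology_map_cohomology_map[OF X Y f', of n]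
    note i = S.quasi_isosD[OF X Y f c m]
    have "is_cohomology_map D (map_cohomology (chosen_cohomology C X n))
        (map_cohomology (chosen_cohomology C Y n)) (fmor FC f n) (fmor F (cohomology_map C X Y f n))"
      using cohomology_map_map_cohomology[OF c S.chain_mapD(1)[OF X Y f'] m]
      by (simp add: chain_functor_simps)
    moreover have "is_iso D (coh (map_cohomology (chosen_cohomology C X n)))
        (coh (map_cohomology (chosen_cohomology C Y n))) (fmor F (cohomology_map C X Y f n))"
      using F_iso[OF i S.is_cohomologyD(5)[OF c(1)] S.is_cohomologyD(5)[OF c(2)]]
      by (simp add: map_cohomology_def)
    ultimately show "\<exists>H H' h. is_cohomology D (fob FC X) n H \<and> is_cohomology D (fob FC Y) n H' \<and>
        is_cohomology_map D H H' (fmor FC f n) h \<and> is_iso D (coh H) (coh H') h"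
      using is_cohomology_map_cohomology[OF X c(1)] is_cohomology_map_cohomology[OF Y c(2)] by blast
  qed
qed

lemma localizing_chain:
  "localizing_functor (Ch C) (quasi_isos C) (Ch D) (quasi_isos D) FC"
  using S.localizing_quasi_isos T.localizing_quasi_isos is_functor_chain chain_functor_quasi_iso
  by (simp add: localizing_functor_def localizing_functor_axioms_def S.Ch_simps)

end

section \<open>The glued category\<close>

lemma linear_map_zero:
  assumes "linear_map R M N h" "module R M" "module R N"
  shows "h \<zero>\<^bsub>M\<^esub> = \<zero>\<^bsub>N\<^esub>"
proof -
  interpret M: abelian_group M by (rule module.axioms(2)[OF assms(2)])
  interpret N: abelian_group N by (rule module.axioms(2)[OF assms(3)])
  have c: "h \<zero>\<^bsub>M\<^esub> \<in> carrier N" using assms(1) M.zero_closed unfolding linear_map_def by blast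
  have "h (\<zero>\<^bsub>M\<^esub> \<oplus>\<^bsub>M\<^esub> \<zero>\<^bsub>M\<^esub>) = h \<zero>\<^bsub>M\<^esub> \<oplus>\<^bsub>N\<^esub> h \<zero>\<^bsub>M\<^esub>"
    using assms(1) M.zero_closed unfolding linear_map_def by blast
  then have "h \<zero>\<^bsub>M\<^esub> \<oplus>\<^bsub>N\<^esub> h \<zero>\<^bsub>M\<^esub> = h \<zero>\<^bsub>M\<^esub>"
    using M.l_zero[OF M.zero_closed] by simp
  then show ?thesis using N.a_assoc[OF N.a_inv_closed[OF c] c c] N.l_neg[OF c] N.l_zero[OF c] by simp
qed

locale gluing = left_exact_bifunctor R A B M + A: abelian_category R A + B: abelian_category R B
  for R :: "('r, 'x) ring_scheme"
    and A :: "('oa, 'ma, 'r) lincat" and B :: "('ob, 'mb, 'r) lincat"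
    and M :: "('oa, 'ma, 'ob, 'mb, 'r, 'v) bifunctor_data"
begin

abbreviation push :: "'oa \<Rightarrow> 'mb \<Rightarrow> 'v \<Rightarrow> 'v" where "push X g \<mu> \<equiv> bmap M (Ident A X) g \<mu>"
abbreviation pull :: "'ma \<Rightarrow> 'ob \<Rightarrow> 'v \<Rightarrow> 'v" where "pull f Y \<mu> \<equiv> bmap M f (Ident B Y) \<mu>"
abbreviation cM where "cM X Y \<equiv> carrier (bmod M X Y)"
abbreviation zM where "zM X Y \<equiv> \<zero>\<^bsub>bmod M X Y\<^esub>"

lemma bmod_group: "\<lbrakk>X \<in> Obj A; Y \<in> Obj B\<rbrakk> \<Longrightarrow> abelian_group (bmod M X Y)"
  using bmod_module module.axioms(2) by blast

lemma zM_closed: "\<lbrakk>X \<in> Obj A; Y \<in> Obj B\<rbrakk> \<Longrightarrow> zM X Y \<in> cM X Y"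
  using abelian_group.axioms(1)[OF bmod_group, THEN abelian_monoid.zero_closed] .

lemma push_linear:
  "\<lbrakk>X \<in> Obj A; arrow B Y Y' g\<rbrakk> \<Longrightarrow> linear_map R (bmod M X Y) (bmod M X Y') (push X g)"
  using bmap_linear[of X X Y Y'] A.ident_closed by (simp add: arrow_def)

lemma pull_linear:
  "\<lbrakk>Y \<in> Obj B; arrow A X X' f\<rbrakk> \<Longrightarrow> linear_map R (bmod M X' Y) (bmod M X Y) (pull f Y)"
  using bmap_linear[of X X' Y Y] B.ident_closed by (simp add: arrow_def)

lemma push_linear_arrow:
  "\<lbrakk>X \<in> Obj A; Y \<in> Obj B; Y' \<in> Obj B; x \<in> cM X Y\<rbrakk>
    \<Longrightarrow> linear_map R (Hom_mod B Y Y') (bmod M X Y') (\<lambda>g. push X g x)"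
  using bmap_linear_snd[of X X Y Y'] A.ident_closed by simp

lemma pull_linear_arrow:
  "\<lbrakk>X \<in> Obj A; X' \<in> Obj A; Y \<in> Obj B; x \<in> cM X' Y\<rbrakk>
    \<Longrightarrow> linear_map R (Hom_mod A X X') (bmod M X Y) (\<lambda>f. pull f Y x)"
  using bmap_linear_fst[of X X' Y Y] B.ident_closed by simp

lemma push_closed: "\<lbrakk>X \<in> Obj A; arrow B Y Y' g; x \<in> cM X Y\<rbrakk> \<Longrightarrow> push X g x \<in> cM X Y'"
  using push_linear[of X Y Y' g] unfolding linear_map_def by blast

lemma pull_closed: "\<lbrakk>Y \<in> Obj B; arrow A X X' f; x \<in> cM X' Y\<rbrakk> \<Longrightarrow> pull f Y x \<in> cM X Y"
  using pull_linear[of Y X X' f] unfolding linear_map_def by blast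

lemma push_zero: "\<lbrakk>X \<in> Obj A; arrow B Y Y' g\<rbrakk> \<Longrightarrow> push X g (zM X Y) = zM X Y'"
  using linear_map_zero[OF push_linear bmod_module bmod_module] by (simp add: arrow_def)

lemma pull_zero: "\<lbrakk>Y \<in> Obj B; arrow A X X' f\<rbrakk> \<Longrightarrow> pull f Y (zM X' Y) = zM X Y"
  using linear_map_zero[OF pull_linear bmod_module bmod_module] by (simp add: arrow_def)

lemma push_zero_arrow:
  "\<lbrakk>X \<in> Obj A; Y \<in> Obj B; Y' \<in> Obj B; x \<in> cM X Y\<rbrakk> \<Longrightarrow> push X (hzero B Y Y') x = zM X Y'"
  using linear_map_zero[OF push_linear_arrow B.Hom_module bmod_module] by simp

lemma pull_zero_arrow:
  "\<lbrakk>X \<in> Obj A; X' \<in> Obj A; Y \<in> Obj B; x \<in> cM X' Y\<rbrakk> \<Longrightarrow> pull (hzero A X X') Y x = zM X Y"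
  using linear_map_zero[OF pull_linear_arrow A.Hom_module bmod_module] by simp

lemma push_ident: "\<lbrakk>X \<in> Obj A; Y \<in> Obj B; x \<in> cM X Y\<rbrakk> \<Longrightarrow> push X (Ident B Y) x = x"
  by (rule bmap_ident)

lemma push_comp:
  assumes "X \<in> Obj A" "arrow B Y Y' g" "arrow B Y' Y'' g'" "x \<in> cM X Y"
  shows "push X (g' \<cdot>\<^bsub>B\<^esub> g) x = push X g' (push X g x)"
  using bmap_comp[of X X X Y Y' Y'' "Ident A X" "Ident A X" g g' x] assms A.ident_closed[of X]
    A.comp_id_left[OF A.arrow_ident] by (simp add: arrow_def)

lemma pull_comp:
  assumes "Y \<in> Obj B" "arrow A X X' f" "arrow A X' X'' f'" "x \<in> cM X'' Y"
  shows "pull (f' \<cdot>\<^bsub>A\<^esub> f) Y x = pull f Y (pull f' Y x)"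
  using bmap_comp[of X X' X'' Y Y Y f f' "Ident B Y" "Ident B Y" x] assms B.ident_closed[of Y]
    B.comp_id_left[OF B.arrow_ident] by (simp add: arrow_def)

text \<open>Both sides equal \<open>bmap M f g x\<close>. This interchange moves the gluing
  condition through composites, inverses, kernels, cokernels and biproducts.\<close>

lemma push_pull:
  assumes f: "arrow A X X' f" and g: "arrow B Y Y' g" and x: "x \<in> cM X' Y"
  shows "push X g (pull f Y x) = pull f Y' (push X' g x)"
proof -
  have o: "X \<in> Obj A" "X' \<in> Obj A" "Y \<in> Obj B" "Y' \<in> Obj B" using f g by (auto simp: arrow_def)
  note i = A.ident_closed[OF o(1)] A.ident_closed[OF o(2)] B.ident_closed[OF o(3)] B.ident_closed[OF o(4)]
  have h: "f \<in> Hom A X X'" "g \<in> Hom B Y Y'" using f g by (auto simp: arrow_def)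
  have "bmap M f g x = push X g (pull f Y x)"
    using bmap_comp[OF o(1,1,2,3,3,4) i(1) h(1) i(3) h(2) x] A.comp_id_right[OF f] B.comp_id_right[OF g]
    by simp
  moreover have "bmap M f g x = pull f Y' (push X' g x)"
    using bmap_comp[OF o(1,2,2,3,4,4) h(1) i(2) h(2) i(4) x] A.comp_id_left[OF f] B.comp_id_left[OF g]
    by simp
  ultimately show ?thesis by simp
qed

text \<open>Pulling along the identity of \<open>Z\<close> fixes \<open>x\<close>, but this identity
  is the zero arrow and sends \<open>x\<close> to zero.\<close>

lemma trivial_fst:
  assumes "is_zero_object A Z" "Y \<in> Obj B" "x \<in> cM Z Y"
  shows "x = zM Z Y"
  using push_ident[of Z Y x] pull_zero_arrow[of Z Z Y x] assms
  by (simp add: A.is_zero_object_iff)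

lemma trivial_snd:
  assumes "is_zero_object B Z" "X \<in> Obj A" "x \<in> cM X Z"
  shows "x = zM X Z"
  using push_ident[of X Z x] push_zero_arrow[of X Z Z x] assms
  by (simp add: B.is_zero_object_iff)

abbreviation G where "G \<equiv> glued A B M"
abbreviation oA :: "'oa \<times> 'ob \<times> 'v \<Rightarrow> 'oa" where "oA P \<equiv> fst P"
abbreviation oB :: "'oa \<times> 'ob \<times> 'v \<Rightarrow> 'ob" where "oB P \<equiv> fst (snd P)"
abbreviation oM :: "'oa \<times> 'ob \<times> 'v \<Rightarrow> 'v" where "oM P \<equiv> snd (snd P)"

lemma Obj_G: "P \<in> Obj G \<longleftrightarrow> oA P \<in> Obj A \<and> oB P \<in> Obj B \<and> oM P \<in> cM (oA P) (oB P)"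
  by (auto simp: glued_def)

lemma G_simps:
  "Ident G P = (Ident A (oA P), Ident B (oB P))"
  "h' \<cdot>\<^bsub>G\<^esub> h = (fst h' \<cdot>\<^bsub>A\<^esub> fst h, snd h' \<cdot>\<^bsub>B\<^esub> snd h)"
  "hzero G P Q = (hzero A (oA P) (oA Q), hzero B (oB P) (oB Q))"
  "hadd G P Q h h' = (hadd A (oA P) (oA Q) (fst h) (fst h'), hadd B (oB P) (oB Q) (snd h) (snd h'))"
  "hsmult G P Q r h = (hsmult A (oA P) (oA Q) r (fst h), hsmult B (oB P) (oB Q) r (snd h))"
  by (simp_all add: glued_def case_prod_beta)

lemma arrow_G: "arrow G P Q h \<longleftrightarrow> P \<in> Obj G \<and> Q \<in> Obj G \<and>
    arrow A (oA P) (oA Q) (fst h) \<and> arrow B (oB P) (oB Q) (snd h) \<and>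
    push (oA P) (snd h) (oM P) = pull (fst h) (oB Q) (oM Q)"
  by (auto simp: glued_def arrow_def case_prod_beta)

lemma arrow_GD:
  assumes "arrow G P Q h"
  shows "P \<in> Obj G" "Q \<in> Obj G" "arrow A (oA P) (oA Q) (fst h)" "arrow B (oB P) (oB Q) (snd h)"
    "push (oA P) (snd h) (oM P) = pull (fst h) (oB Q) (oM Q)"
    "oM P \<in> cM (oA P) (oB P)" "oM Q \<in> cM (oA Q) (oB Q)"
  using assms by (auto simp: arrow_G Obj_G)

lemma arrow_G_ident: "P \<in> Obj G \<Longrightarrow> arrow G P P (Ident G P)"
  by (simp add: arrow_G G_simps Obj_G A.arrow_ident B.arrow_ident)

lemma arrow_G_comp:
  assumes h: "arrow G P Q h" and h': "arrow G Q S h'"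
  shows "arrow G P S (h' \<cdot>\<^bsub>G\<^esub> h)"
proof -
  note d = arrow_GD[OF h] and d' = arrow_GD[OF h']
  have o: "oA P \<in> Obj A" "oA Q \<in> Obj A" "oB S \<in> Obj B" "oB Q \<in> Obj B"
    using d d' by (auto simp: Obj_G)
  have "push (oA P) (snd h' \<cdot>\<^bsub>B\<^esub> snd h) (oM P) = push (oA P) (snd h') (pull (fst h) (oB Q) (oM Q))"
    using push_comp[OF o(1) d(4) d'(4) d(6)] d(5) by simp
  also have "\<dots> = pull (fst h) (oB S) (push (oA Q) (snd h') (oM Q))"
    using push_pull[OF d(3) d'(4) d(7)] .
  also have "\<dots> = pull (fst h' \<cdot>\<^bsub>A\<^esub> fst h) (oB S) (oM S)"
    using d'(5) pull_comp[OF o(3) d(3) d'(3) d'(7)] by simp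
  finally show ?thesis
    using d d' A.arrow_comp[OF d(3) d'(3)] B.arrow_comp[OF d(4) d'(4)] by (simp add: arrow_G G_simps)
qed

lemma arrow_G_zero:
  assumes "P \<in> Obj G" "Q \<in> Obj G"
  shows "arrow G P Q (hzero G P Q)"
  using assms push_zero_arrow[of "oA P" "oB P" "oB Q" "oM P"] pull_zero_arrow[of "oA P" "oA Q" "oB Q" "oM Q"]
  by (simp add: arrow_G G_simps Obj_G A.arrow_zero B.arrow_zero)

lemma arrow_G_add:
  assumes h: "arrow G P Q h" and h': "arrow G P Q h'"
  shows "arrow G P Q (hadd G P Q h h')"
proof -
  note d = arrow_GD[OF h] and d' = arrow_GD[OF h']
  have o: "oA P \<in> Obj A" "oA Q \<in> Obj A" "oB P \<in> Obj B" "oB Q \<in> Obj B" using d by (auto simp: Obj_G)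
  show ?thesis
    using push_linear_arrow[OF o(1,3,4) d(6)] pull_linear_arrow[OF o(1,2,4) d(7)] d d'
      A.arrow_add[OF d(3) d'(3)] B.arrow_add[OF d(4) d'(4)]
    unfolding arrow_G G_simps by (auto simp: linear_map_def arrow_def)
qed

lemma arrow_G_smult:
  assumes h: "arrow G P Q h" and r: "r \<in> carrier R"
  shows "arrow G P Q (hsmult G P Q r h)"
proof -
  note d = arrow_GD[OF h]
  have o: "oA P \<in> Obj A" "oA Q \<in> Obj A" "oB P \<in> Obj B" "oB Q \<in> Obj B" using d by (auto simp: Obj_G)
  show ?thesis
    using push_linear_arrow[OF o(1,3,4) d(6)] pull_linear_arrow[OF o(1,2,4) d(7)] d r
      module.smult_closed[OF A.Hom_module[OF o(1,2)] r] module.smult_closed[OF B.Hom_module[OF o(3,4)] r]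
    unfolding arrow_G G_simps by (auto simp: linear_map_def arrow_def)
qed

text \<open>Negation is multiplication by the scalar \<open>-1\<close>, for which the gluing
  condition is already known. The inverse is spelled out by components because the hom sets of the
  glued category are not yet known to be groups.\<close>

lemma arrow_G_neg:
  assumes h: "arrow G P Q h"
  shows "arrow G P Q (hneg A (oA P) (oA Q) (fst h), hneg B (oB P) (oB Q) (snd h))"
proof -
  note d = arrow_GD[OF h]
  have o: "oA P \<in> Obj A" "oA Q \<in> Obj A" "oB P \<in> Obj B" "oB Q \<in> Obj B" using d by (auto simp: Obj_G)
  have r: "\<ominus>\<^bsub>R\<^esub> \<one>\<^bsub>R\<^esub> \<in> carrier R" by simp
  have "hsmult A (oA P) (oA Q) (\<ominus>\<^bsub>R\<^esub> \<one>\<^bsub>R\<^esub>) (fst h) = hneg A (oA P) (oA Q) (fst h)"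
    using module.smult_l_minus[OF A.Hom_module[OF o(1,2)], of "\<one>\<^bsub>R\<^esub>" "fst h"]
      module.smult_one[OF A.Hom_module[OF o(1,2)], of "fst h"] d(3) by (simp add: arrow_def)
  moreover have "hsmult B (oB P) (oB Q) (\<ominus>\<^bsub>R\<^esub> \<one>\<^bsub>R\<^esub>) (snd h) = hneg B (oB P) (oB Q) (snd h)"
    using module.smult_l_minus[OF B.Hom_module[OF o(3,4)], of "\<one>\<^bsub>R\<^esub>" "snd h"]
      module.smult_one[OF B.Hom_module[OF o(3,4)], of "snd h"] d(4) by (simp add: arrow_def)
  ultimately show ?thesis using arrow_G_smult[OF h r] by (simp add: G_simps)
qed

lemma linear_category_G: "linear_category R G"
proof -
  have iH: "h \<in> Hom G P Q \<longleftrightarrow> arrow G P Q h" if "P \<in> Obj G" "Q \<in> Obj G" for P Q h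
    using that by (simp add: arrow_def)
  have cat: "category G"
  proof
    fix P assume "P \<in> Obj G"
    then show "Ident G P \<in> Hom G P P" using arrow_G_ident iH by blast
  next
    fix P Q S h h' assume "P \<in> Obj G" "Q \<in> Obj G" "S \<in> Obj G" "h \<in> Hom G P Q" "h' \<in> Hom G Q S"
    then show "h' \<cdot>\<^bsub>G\<^esub> h \<in> Hom G P S" using arrow_G_comp iH by blast
  next
    fix P Q h assume "P \<in> Obj G" "Q \<in> Obj G" "h \<in> Hom G P Q"
    then have "arrow G P Q h" using iH by blast
    note d = arrow_GD(3,4)[OF this]
    show "h \<cdot>\<^bsub>G\<^esub> Ident G P = h" "Ident G Q \<cdot>\<^bsub>G\<^esub> h = h"
      by (simp_all add: G_simps A.comp_id_right[OF d(1)] B.comp_id_right[OF d(2)]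
          A.comp_id_left[OF d(1)] B.comp_id_left[OF d(2)])
  next
    fix O' P Q S f g h assume "O' \<in> Obj G" "P \<in> Obj G" "Q \<in> Obj G" "S \<in> Obj G"
      "f \<in> Hom G O' P" "g \<in> Hom G P Q" "h \<in> Hom G Q S"
    then have a: "arrow G O' P f" "arrow G P Q g" "arrow G Q S h" using iH by blast+
    show "h \<cdot>\<^bsub>G\<^esub> g \<cdot>\<^bsub>G\<^esub> f = h \<cdot>\<^bsub>G\<^esub> (g \<cdot>\<^bsub>G\<^esub> f)"
      using A.assoc[OF arrow_GD(3)[OF a(1)] arrow_GD(3)[OF a(2)] arrow_GD(3)[OF a(3)]]
        B.assoc[OF arrow_GD(4)[OF a(1)] arrow_GD(4)[OF a(2)] arrow_GD(4)[OF a(3)]]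
      by (simp add: G_simps)
  qed
  have mod: "module R (Hom_mod G P Q)" if PQ: "P \<in> Obj G" "Q \<in> Obj G" for P Q
  proof -
    have o: "oA P \<in> Obj A" "oA Q \<in> Obj A" "oB P \<in> Obj B" "oB Q \<in> Obj B" using PQ by (auto simp: Obj_G)
    note mA = A.Hom_module[OF o(1,2)] and mB = B.Hom_module[OF o(3,4)]
    have c: "fst h \<in> Hom A (oA P) (oA Q)" "snd h \<in> Hom B (oB P) (oB Q)"
      "arrow A (oA P) (oA Q) (fst h)" "arrow B (oB P) (oB Q) (snd h)" if "h \<in> Hom G P Q" for h
    proof -
      have "arrow G P Q h" using that iH[OF PQ] by blast
      note d = arrow_GD(3,4)[OF this]
      show "fst h \<in> Hom A (oA P) (oA Q)" "snd h \<in> Hom B (oB P) (oB Q)"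
        "arrow A (oA P) (oA Q) (fst h)" "arrow B (oB P) (oB Q) (snd h)"
        using d arrowD(3)[OF d(1)] arrowD(3)[OF d(2)] by simp_all
    qed
    show ?thesis
    proof (rule moduleI)
      show "cring R" by (rule A.R.is_cring)
      show "abelian_group (Hom_mod G P Q)"
      proof (rule abelian_groupI, simp_all only: Hom_mod_simps)
        show "hzero G P Q \<in> Hom G P Q" using arrow_G_zero[OF PQ] iH[OF PQ] by blast
      next
        fix x y assume x: "x \<in> Hom G P Q" "y \<in> Hom G P Q"
        then show "hadd G P Q x y \<in> Hom G P Q" using arrow_G_add iH[OF PQ] by blast
        show "hadd G P Q x y = hadd G P Q y x"
          using A.add_comm[OF c(3)[OF x(1)] c(3)[OF x(2)]] B.add_comm[OF c(4)[OF x(1)] c(4)[OF x(2)]]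
          by (simp add: G_simps)
        fix z assume z: "z \<in> Hom G P Q"
        show "hadd G P Q (hadd G P Q x y) z = hadd G P Q x (hadd G P Q y z)"
          using A.add_assoc[OF c(3)[OF x(1)] c(3)[OF x(2)] c(3)[OF z]]
            B.add_assoc[OF c(4)[OF x(1)] c(4)[OF x(2)] c(4)[OF z]] by (simp add: G_simps)
      next
        fix x assume x: "x \<in> Hom G P Q"
        show "hadd G P Q (hzero G P Q) x = x"
          using A.add_zero_left[OF c(3)[OF x]] B.add_zero_left[OF c(4)[OF x]] by (simp add: G_simps)
        have n: "(hneg A (oA P) (oA Q) (fst x), hneg B (oB P) (oB Q) (snd x)) \<in> Hom G P Q"
          using arrow_G_neg iH[OF PQ] x by blast
        show "\<exists>y\<in>Hom G P Q. hadd G P Q y x = hzero G P Q"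
          by (rule bexI[OF _ n]) (simp add: G_simps A.add_neg_left[OF c(3)[OF x]] B.add_neg_left[OF c(4)[OF x]])
      qed
    next
      fix r h assume "r \<in> carrier R" "h \<in> carrier (Hom_mod G P Q)"
      then show "r \<odot>\<^bsub>Hom_mod G P Q\<^esub> h \<in> carrier (Hom_mod G P Q)"
        using arrow_G_smult[of P Q h r] iH[OF PQ] by simp
    next
      fix r s h assume r: "r \<in> carrier R" "s \<in> carrier R" and h: "h \<in> carrier (Hom_mod G P Q)"
      then have h: "h \<in> Hom G P Q" by simp
      show "(r \<oplus>\<^bsub>R\<^esub> s) \<odot>\<^bsub>Hom_mod G P Q\<^esub> h = r \<odot>\<^bsub>Hom_mod G P Q\<^esub> h \<oplus>\<^bsub>Hom_mod G P Q\<^esub> s \<odot>\<^bsub>Hom_mod G P Q\<^esub> h"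
        using module.smult_l_distr[OF mA r, of "fst h"] module.smult_l_distr[OF mB r, of "snd h"] c[OF h]
        by (simp add: G_simps)
      show "(r \<otimes>\<^bsub>R\<^esub> s) \<odot>\<^bsub>Hom_mod G P Q\<^esub> h = r \<odot>\<^bsub>Hom_mod G P Q\<^esub> (s \<odot>\<^bsub>Hom_mod G P Q\<^esub> h)"
        using module.smult_assoc1[OF mA r, of "fst h"] module.smult_assoc1[OF mB r, of "snd h"] c[OF h]
        by (simp add: G_simps)
    next
      fix r h h' assume r: "r \<in> carrier R" and h: "h \<in> carrier (Hom_mod G P Q)" "h' \<in> carrier (Hom_mod G P Q)"
      then have h: "h \<in> Hom G P Q" "h' \<in> Hom G P Q" by simp_all
      show "r \<odot>\<^bsub>Hom_mod G P Q\<^esub> (h \<oplus>\<^bsub>Hom_mod G P Q\<^esub> h') =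
          r \<odot>\<^bsub>Hom_mod G P Q\<^esub> h \<oplus>\<^bsub>Hom_mod G P Q\<^esub> r \<odot>\<^bsub>Hom_mod G P Q\<^esub> h'"
        using module.smult_r_distr[OF mA r, of "fst h" "fst h'"]
          module.smult_r_distr[OF mB r, of "snd h" "snd h'"] c[OF h(1)] c[OF h(2)]
        by (simp add: G_simps)
    next
      fix h assume "h \<in> carrier (Hom_mod G P Q)"
      then have h: "h \<in> Hom G P Q" by simp
      show "\<one>\<^bsub>R\<^esub> \<odot>\<^bsub>Hom_mod G P Q\<^esub> h = h"
        using module.smult_one[OF mA, of "fst h"] module.smult_one[OF mB, of "snd h"] c[OF h]
        by (simp add: G_simps)
    qed
  qed
  show ?thesis
  proof (intro linear_category.intro linear_category_axioms.intro cat mod)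
    show "cring R" by (rule A.R.is_cring)
  next
    fix P Q S h assume o: "P \<in> Obj G" "Q \<in> Obj G" "S \<in> Obj G" and h: "h \<in> Hom G P Q"
    have h: "arrow G P Q h" using h iH[OF o(1,2)] by simp
    note d = arrow_GD[OF h]
    have o': "oA P \<in> Obj A" "oA Q \<in> Obj A" "oA S \<in> Obj A" "oB P \<in> Obj B" "oB Q \<in> Obj B" "oB S \<in> Obj B"
      using o by (auto simp: Obj_G)
    show "linear_map R (Hom_mod G Q S) (Hom_mod G P S) (\<lambda>g. g \<cdot>\<^bsub>G\<^esub> h)"
      unfolding linear_map_def Hom_mod_simps
    proof (intro conjI ballI funcsetI)
      fix g assume g: "g \<in> Hom G Q S"
      then have g: "arrow G Q S g" using iH o by blast
      then show "g \<cdot>\<^bsub>G\<^esub> h \<in> Hom G P S" using arrow_G_comp[OF h] iH o by blast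
      note e = arrow_GD[OF g]
      { fix g' assume "g' \<in> Hom G Q S"
        then have g': "arrow G Q S g'" using iH o by blast
        show "hadd G Q S g g' \<cdot>\<^bsub>G\<^esub> h = hadd G P S (g \<cdot>\<^bsub>G\<^esub> h) (g' \<cdot>\<^bsub>G\<^esub> h)"
          using A.comp_add_left[OF d(3) e(3) arrow_GD(3)[OF g']]
            B.comp_add_left[OF d(4) e(4) arrow_GD(4)[OF g']] by (simp add: G_simps) }
      fix r assume r: "r \<in> carrier R"
      show "hsmult G Q S r g \<cdot>\<^bsub>G\<^esub> h = hsmult G P S r (g \<cdot>\<^bsub>G\<^esub> h)"
        using A.comp_linear_left[OF o'(1-3) arrowD(3)[OF d(3)]] B.comp_linear_left[OF o'(4-6) arrowD(3)[OF d(4)]]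
          arrowD(3)[OF e(3)] arrowD(3)[OF e(4)] r by (simp add: G_simps linear_map_def)
    qed
  next
    fix P Q S h assume o: "P \<in> Obj G" "Q \<in> Obj G" "S \<in> Obj G" and h: "h \<in> Hom G Q S"
    have h: "arrow G Q S h" using h iH[OF o(2,3)] by simp
    note d = arrow_GD[OF h]
    have o': "oA P \<in> Obj A" "oA Q \<in> Obj A" "oA S \<in> Obj A" "oB P \<in> Obj B" "oB Q \<in> Obj B" "oB S \<in> Obj B"
      using o by (auto simp: Obj_G)
    show "linear_map R (Hom_mod G P Q) (Hom_mod G P S) (\<lambda>g. h \<cdot>\<^bsub>G\<^esub> g)"
      unfolding linear_map_def Hom_mod_simps
    proof (intro conjI ballI funcsetI)
      fix g assume g: "g \<in> Hom G P Q"
      then have g: "arrow G P Q g" using iH o by blast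
      then show "h \<cdot>\<^bsub>G\<^esub> g \<in> Hom G P S" using arrow_G_comp[OF _ h] iH o by blast
      note e = arrow_GD[OF g]
      { fix g' assume "g' \<in> Hom G P Q"
        then have g': "arrow G P Q g'" using iH o by blast
        show "h \<cdot>\<^bsub>G\<^esub> hadd G P Q g g' = hadd G P S (h \<cdot>\<^bsub>G\<^esub> g) (h \<cdot>\<^bsub>G\<^esub> g')"
          using A.comp_add_right[OF e(3) arrow_GD(3)[OF g'] d(3)]
            B.comp_add_right[OF e(4) arrow_GD(4)[OF g'] d(4)] by (simp add: G_simps) }
      fix r assume r: "r \<in> carrier R"
      show "h \<cdot>\<^bsub>G\<^esub> hsmult G P Q r g = hsmult G P S r (h \<cdot>\<^bsub>G\<^esub> g)"
        using A.comp_linear_right[OF o'(1-3) arrowD(3)[OF d(3)]] B.comp_linear_right[OF o'(4-6) arrowD(3)[OF d(4)]]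
          arrowD(3)[OF e(3)] arrowD(3)[OF e(4)] r by (simp add: G_simps linear_map_def)
    qed
  qed
qed

section \<open>Isomorphisms, kernels, cokernels and biproducts of the glued category\<close>

sublocale G: linear_category R G
  by (rule linear_category_G)

lemma is_zero_object_G_iff:
  "is_zero_object G P \<longleftrightarrow> P \<in> Obj G \<and> is_zero_object A (oA P) \<and> is_zero_object B (oB P)"
  by (auto simp: G.is_zero_object_iff A.is_zero_object_iff B.is_zero_object_iff G_simps Obj_G)

text \<open>Inverses \<open>f\<close>, \<open>g\<close> of the components satisfy the gluing
  condition by themselves: push the condition of \<open>h\<close> along \<open>g\<close> and pull it
  along \<open>f\<close>. This makes quasi-isomorphisms of glued complexes testable on
  components.\<close>

lemma is_iso_G_iff:
  assumes h: "arrow G P Q h"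
  shows "is_iso G P Q h \<longleftrightarrow> is_iso A (oA P) (oA Q) (fst h) \<and> is_iso B (oB P) (oB Q) (snd h)"
proof
  note d = arrow_GD[OF h]
  assume "is_iso G P Q h"
  then obtain k where k: "arrow G Q P k" "k \<cdot>\<^bsub>G\<^esub> h = Ident G P" "h \<cdot>\<^bsub>G\<^esub> k = Ident G Q"
    using G.is_isoE d(1,2) by blast
  then show "is_iso A (oA P) (oA Q) (fst h) \<and> is_iso B (oB P) (oB Q) (snd h)"
    using A.is_isoI[OF d(3) arrow_GD(3)[OF k(1)]] B.is_isoI[OF d(4) arrow_GD(4)[OF k(1)]]
    by (simp add: G_simps)
next
  note d = arrow_GD[OF h]
  have o: "oA P \<in> Obj A" "oA Q \<in> Obj A" "oB P \<in> Obj B" "oB Q \<in> Obj B" using d by (auto simp: Obj_G)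
  assume "is_iso A (oA P) (oA Q) (fst h) \<and> is_iso B (oB P) (oB Q) (snd h)"
  then obtain f g where f: "arrow A (oA Q) (oA P) f" "f \<cdot>\<^bsub>A\<^esub> fst h = Ident A (oA P)"
      "fst h \<cdot>\<^bsub>A\<^esub> f = Ident A (oA Q)"
    and g: "arrow B (oB Q) (oB P) g" "g \<cdot>\<^bsub>B\<^esub> snd h = Ident B (oB P)" "snd h \<cdot>\<^bsub>B\<^esub> g = Ident B (oB Q)"
    using A.is_isoE o(1,2) B.is_isoE o(3,4) by metis
  have "oM Q = pull f (oB Q) (pull (fst h) (oB Q) (oM Q))"
    using pull_comp[OF o(4) f(1) d(3) d(7)] f(3) bmap_ident[OF o(2,4) d(7)] by simp
  then have "push (oA Q) g (oM Q) = push (oA Q) g (pull f (oB Q) (push (oA P) (snd h) (oM P)))"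
    using d(5) by simp
  also have "\<dots> = pull f (oB P) (push (oA P) g (push (oA P) (snd h) (oM P)))"
    using push_pull[OF f(1) g(1) push_closed[OF o(1) d(4) d(6)]] .
  also have "\<dots> = pull f (oB P) (oM P)"
    using push_comp[OF o(1) d(4) g(1) d(6)] g(2) bmap_ident[OF o(1,3) d(6)] by simp
  finally have "arrow G Q P (f, g)" using f(1) g(1) d(1,2) by (simp add: arrow_G)
  then show "is_iso G P Q h" using G.is_isoI[OF h] f(2,3) g(2,3) by (simp add: G_simps)
qed

text \<open>The gluing element of the kernel must solve
  \<open>push K l nu = pull k (oB P) (oM P)\<close>. The right side dies under
  \<open>push K (snd h)\<close>, since the gluing condition of \<open>h\<close> turns it into a
  pullback along \<open>fst h\<close> after \<open>k\<close>, which is zero; left exactness in the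
  second variable then provides the solution.\<close>

lemma kernel_G:
  assumes h: "arrow G P Q h"
    and k: "is_kernel A (oA P) (oA Q) (fst h) K k" and l: "is_kernel B (oB P) (oB Q) (snd h) L l"
  shows "\<exists>\<nu>. is_kernel G P Q h (K, L, \<nu>) (k, l)"
proof -
  note d = arrow_GD[OF h] and dk = A.is_kernelD[OF k] and dl = B.is_kernelD[OF l]
  have o: "oA P \<in> Obj A" "oA Q \<in> Obj A" "oB P \<in> Obj B" "oB Q \<in> Obj B" "K \<in> Obj A" "L \<in> Obj B"
    using d dk dl by (auto simp: Obj_G arrow_def)
  have ex: "left_exact_seq (bmod M X L) (push X l) (bmod M X (oB P)) (push X (snd h)) (bmod M X (oB Q))"
    if "X \<in> Obj A" for X using left_exact_snd[OF that l] .
  note c = pull_closed[OF o(3) dk(2) d(6)]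
  have "push K (snd h) (pull k (oB P) (oM P)) = pull k (oB Q) (pull (fst h) (oB Q) (oM Q))"
    using push_pull[OF dk(2) d(4) d(6)] d(5) by simp
  also have "\<dots> = zM K (oB Q)"
    using pull_comp[OF o(4) dk(2) d(3) d(7)] dk(3) pull_zero_arrow[OF o(5,2,4) d(7)] by simp
  finally have "pull k (oB P) (oM P) \<in> push K l ` cM K L"
    using ex[OF o(5)] c unfolding left_exact_seq_def by blast
  then obtain \<nu> where \<nu>: "\<nu> \<in> cM K L" "push K l \<nu> = pull k (oB P) (oM P)" by force
  let ?K = "(K, L, \<nu>)"
  have "is_kernel G P Q h ?K (k, l)"
  proof (rule G.is_kernelI[OF h])
    show "arrow G ?K P (k, l)" using \<nu> o dk dl d(1) by (simp add: arrow_G Obj_G)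
    show "h \<cdot>\<^bsub>G\<^esub> (k, l) = hzero G ?K Q" using dk(3) dl(3) by (simp add: G_simps)
  next
    fix T t assume t: "arrow G T P t" "h \<cdot>\<^bsub>G\<^esub> t = hzero G T Q"
    note e = arrow_GD[OF t(1)]
    have oT: "oA T \<in> Obj A" "oB T \<in> Obj B" using e by (auto simp: Obj_G)
    obtain u where u: "arrow A (oA T) K u" "k \<cdot>\<^bsub>A\<^esub> u = fst t"
      using A.kernel_lift[OF k e(3)] t(2) by (auto simp: G_simps)
    obtain v where v: "arrow B (oB T) L v" "l \<cdot>\<^bsub>B\<^esub> v = snd t"
      using B.kernel_lift[OF l e(4)] t(2) by (auto simp: G_simps)
    \<comment> \<open>The gluing condition of the lift \<open>(u, v)\<close> is checked after
      pushing along \<open>l\<close>, which is injective on \<open>M(oA T, L)\<close> by left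
      exactness.\<close>
    have "push (oA T) l (push (oA T) v (oM T)) = pull u (oB P) (pull k (oB P) (oM P))"
      using push_comp[OF oT(1) v(1) dl(2) e(6)] v(2) e(5) pull_comp[OF o(3) u(1) dk(2) e(7)] u(2) by simp
    also have "\<dots> = push (oA T) l (pull u L \<nu>)"
      using push_pull[OF u(1) dl(2) \<nu>(1)] \<nu>(2) by simp
    finally have "push (oA T) v (oM T) = pull u L \<nu>"
      using ex[OF oT(1)] push_closed[OF oT(1) v(1) e(6)] pull_closed[OF o(6) u(1) \<nu>(1)]
      unfolding left_exact_seq_def inj_on_def by blast
    then have "arrow G T ?K (u, v)" using u v e(1) \<nu>(1) o by (simp add: arrow_G Obj_G)
    then show "\<exists>w. arrow G T ?K w \<and> (k, l) \<cdot>\<^bsub>G\<^esub> w = t"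
      using u(2) v(2) by (intro exI[of _ "(u, v)"]) (simp add: G_simps)
  next
    fix T u v assume "arrow G T ?K u" "arrow G T ?K v" "(k, l) \<cdot>\<^bsub>G\<^esub> u = (k, l) \<cdot>\<^bsub>G\<^esub> v"
    then show "u = v"
      using A.kernel_cancel[OF k, of "oA T" "fst u" "fst v"] B.kernel_cancel[OF l, of "oB T" "snd u" "snd v"]
      by (simp add: G_simps arrow_G prod_eq_iff)
  qed
  then show ?thesis by blast
qed

text \<open>Contravariance turns the cokernel in \<open>A\<close> into a left exact sequence of
  modules, so \<open>pull k\<close> is injective with image the elements killed by
  \<open>pull (fst h)\<close>. This provides the gluing element and the condition for induced
  arrows, as \<open>push l\<close> did for kernels.\<close>

lemma cokernel_G:
  assumes h: "arrow G P Q h"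
    and k: "is_cokernel A (oA P) (oA Q) (fst h) K k" and l: "is_cokernel B (oB P) (oB Q) (snd h) L l"
  shows "\<exists>\<nu>. is_cokernel G P Q h (K, L, \<nu>) (k, l)"
proof -
  note d = arrow_GD[OF h] and dk = A.is_cokernelD[OF k] and dl = B.is_cokernelD[OF l]
  have o: "oA P \<in> Obj A" "oA Q \<in> Obj A" "oB P \<in> Obj B" "oB Q \<in> Obj B" "K \<in> Obj A" "L \<in> Obj B"
    using d dk dl by (auto simp: Obj_G arrow_def)
  have ex: "left_exact_seq (bmod M K Y) (pull k Y) (bmod M (oA Q) Y) (pull (fst h) Y) (bmod M (oA P) Y)"
    if "Y \<in> Obj B" for Y using left_exact_fst[OF that k] .
  note c = push_closed[OF o(2) dl(2) d(7)]
  have "pull (fst h) L (push (oA Q) l (oM Q)) = push (oA P) l (push (oA P) (snd h) (oM P))"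
    using push_pull[OF d(3) dl(2) d(7)] d(5) by simp
  also have "\<dots> = zM (oA P) L"
    using push_comp[OF o(1) d(4) dl(2) d(6)] dl(3) push_zero_arrow[OF o(1,3,6) d(6)] by simp
  finally have "push (oA Q) l (oM Q) \<in> pull k L ` cM K L"
    using ex[OF o(6)] c unfolding left_exact_seq_def by blast
  then obtain \<nu> where \<nu>: "\<nu> \<in> cM K L" "pull k L \<nu> = push (oA Q) l (oM Q)" by force
  let ?K = "(K, L, \<nu>)"
  have "is_cokernel G P Q h ?K (k, l)"
  proof (rule G.is_cokernelI[OF h])
    show "arrow G Q ?K (k, l)" using \<nu> o dk dl d(2) by (simp add: arrow_G Obj_G)
    show "(k, l) \<cdot>\<^bsub>G\<^esub> h = hzero G P ?K" using dk(3) dl(3) by (simp add: G_simps)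
  next
    fix T t assume t: "arrow G Q T t" "t \<cdot>\<^bsub>G\<^esub> h = hzero G P T"
    note e = arrow_GD[OF t(1)]
    have oT: "oA T \<in> Obj A" "oB T \<in> Obj B" using e by (auto simp: Obj_G)
    obtain u where u: "arrow A K (oA T) u" "u \<cdot>\<^bsub>A\<^esub> k = fst t"
      using A.cokernel_extend[OF k e(3)] t(2) by (auto simp: G_simps)
    obtain v where v: "arrow B L (oB T) v" "v \<cdot>\<^bsub>B\<^esub> l = snd t"
      using B.cokernel_extend[OF l e(4)] t(2) by (auto simp: G_simps)
    have "pull k (oB T) (push K v \<nu>) = push (oA Q) v (push (oA Q) l (oM Q))"
      using push_pull[OF dk(2) v(1) \<nu>(1)] \<nu>(2) by simp
    also have "\<dots> = pull k (oB T) (pull u (oB T) (oM T))"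
      using push_comp[OF o(2) dl(2) v(1) d(7)] v(2) e(5) pull_comp[OF oT(2) dk(2) u(1) e(7)] u(2) by simp
    finally have "push K v \<nu> = pull u (oB T) (oM T)"
      using ex[OF oT(2)] push_closed[OF o(5) v(1) \<nu>(1)] pull_closed[OF oT(2) u(1) e(7)]
      unfolding left_exact_seq_def inj_on_def by blast
    then have "arrow G ?K T (u, v)" using u v e(2) \<nu>(1) o by (simp add: arrow_G Obj_G)
    then show "\<exists>w. arrow G ?K T w \<and> w \<cdot>\<^bsub>G\<^esub> (k, l) = t"
      using u(2) v(2) by (intro exI[of _ "(u, v)"]) (simp add: G_simps)
  next
    fix T u v assume "arrow G ?K T u" "arrow G ?K T v" "u \<cdot>\<^bsub>G\<^esub> (k, l) = v \<cdot>\<^bsub>G\<^esub> (k, l)"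
    then show "u = v"
      using A.cokernel_cancel[OF k, of "oA T" "fst u" "fst v"] B.cokernel_cancel[OF l, of "oB T" "snd u" "snd v"]
      by (simp add: G_simps arrow_G prod_eq_iff)
  qed
  then show ?thesis by blast
qed

text \<open>The gluing element is block diagonal: each given element is pulled along its projection
  in \<open>A\<close> and pushed along its injection in \<open>B\<close>, and the two results are
  added.\<close>

lemma biproduct_G:
  assumes PQ: "P \<in> Obj G" "Q \<in> Obj G"
  shows "\<exists>S. is_biproduct G P Q S"
proof -
  have o: "oA P \<in> Obj A" "oA Q \<in> Obj A" "oB P \<in> Obj B" "oB Q \<in> Obj B"
    and m: "oM P \<in> cM (oA P) (oB P)" "oM Q \<in> cM (oA Q) (oB Q)" using PQ by (auto simp: Obj_G)
  obtain U where U: "is_biproduct A (oA P) (oA Q) U" using A.ex_biproduct o by blast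
  obtain V where V: "is_biproduct B (oB P) (oB Q) V" using B.ex_biproduct o by blast
  note u = A.biproductD[OF U o(1,2)] and v = B.biproductD[OF V o(3,4)]
  let ?X = "vertex U" and ?Y = "vertex V"
  have oV: "?X \<in> Obj A" "?Y \<in> Obj B" using u v by (auto simp: arrow_def)
  define a where "a = pull (prj1 U) ?Y (push (oA P) (inj1 V) (oM P))"
  define b where "b = pull (prj2 U) ?Y (push (oA Q) (inj2 V) (oM Q))"
  note ia = push_closed[OF o(1) v(1) m(1)] and ib = push_closed[OF o(2) v(2) m(2)]
  have ab: "a \<in> cM ?X ?Y" "b \<in> cM ?X ?Y"
    unfolding a_def b_def using pull_closed[OF oV(2) u(3) ia] pull_closed[OF oV(2) u(4) ib] .
  define \<nu> where "\<nu> = a \<oplus>\<^bsub>bmod M ?X ?Y\<^esub> b"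
  have \<nu>: "\<nu> \<in> cM ?X ?Y" unfolding \<nu>_def
    using abelian_monoid.a_closed[OF abelian_group.axioms(1)[OF bmod_group[OF oV]] ab] .
  \<comment> \<open>The biproduct relations preserve the diagonal terms and send the mixed ones to
    zero.\<close>
  have a2: "push ?X (prj1 V) a = pull (prj1 U) (oB P) (oM P)"
      "push ?X (prj2 V) a = zM ?X (oB Q)"
      "pull (inj1 U) ?Y a = push (oA P) (inj1 V) (oM P)"
      "pull (inj2 U) ?Y a = zM (oA Q) ?Y"
    unfolding a_def
    using push_pull[OF u(3) v(3) ia] push_comp[OF o(1) v(1,3) m(1)] v(5) bmap_ident[OF o(1,3) m(1)]
      push_pull[OF u(3) v(4) ia] push_comp[OF o(1) v(1,4) m(1)] v(8) push_zero_arrow[OF o(1,3,4) m(1)]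
      pull_zero[OF o(4) u(3)]
      pull_comp[OF oV(2) u(1,3) ia] u(5) bmap_ident[OF o(1) oV(2) ia]
      pull_comp[OF oV(2) u(2,3) ia] u(7) pull_zero_arrow[OF o(2,1) oV(2) ia] by simp_all
  have b2: "push ?X (prj2 V) b = pull (prj2 U) (oB Q) (oM Q)"
      "push ?X (prj1 V) b = zM ?X (oB P)"
      "pull (inj2 U) ?Y b = push (oA Q) (inj2 V) (oM Q)"
      "pull (inj1 U) ?Y b = zM (oA P) ?Y"
    unfolding b_def
    using push_pull[OF u(4) v(4) ib] push_comp[OF o(2) v(2,4) m(2)] v(6) bmap_ident[OF o(2,4) m(2)]
      push_pull[OF u(4) v(3) ib] push_comp[OF o(2) v(2,3) m(2)] v(7) push_zero_arrow[OF o(2,4,3) m(2)]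
      pull_zero[OF o(3) u(4)]
      pull_comp[OF oV(2) u(2,4) ib] u(6) bmap_ident[OF o(2) oV(2) ib]
      pull_comp[OF oV(2) u(1,4) ib] u(8) pull_zero_arrow[OF o(1,2) oV(2) ib] by simp_all
  have pushn: "push ?X g \<nu> = push ?X g a \<oplus>\<^bsub>bmod M ?X Y'\<^esub> push ?X g b" if "arrow B ?Y Y' g" for g Y'
    using push_linear[OF oV(1) that] ab unfolding linear_map_def \<nu>_def by blast
  have pulln: "pull f ?Y \<nu> = pull f ?Y a \<oplus>\<^bsub>bmod M X' ?Y\<^esub> pull f ?Y b" if "arrow A X' ?X f" for f X'
    using pull_linear[OF oV(2) that] ab unfolding linear_map_def \<nu>_def by blast
  note gm = abelian_group.axioms(1)[OF bmod_group]
  note z = abelian_monoid.l_zero[OF gm] abelian_monoid.r_zero[OF gm]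
  let ?S = "(?X, ?Y, \<nu>)"
  let ?P = "\<lparr>vertex = ?S, inj1 = (inj1 U, inj1 V), inj2 = (inj2 U, inj2 V),
    prj1 = (prj1 U, prj1 V), prj2 = (prj2 U, prj2 V)\<rparr>"
  have S: "?S \<in> Obj G" using oV \<nu> by (simp add: Obj_G)
  have "arrow G P ?S (inj1 U, inj1 V)"
    using PQ S u(1) v(1) pulln[OF u(1)] a2(3) b2(4) z(2)[OF o(1) oV(2) ia] by (simp add: arrow_G)
  moreover have "arrow G Q ?S (inj2 U, inj2 V)"
    using PQ S u(2) v(2) pulln[OF u(2)] a2(4) b2(3) z(1)[OF o(2) oV(2) ib] by (simp add: arrow_G)
  moreover have "arrow G ?S P (prj1 U, prj1 V)"
    using PQ S u(3) v(3) pushn[OF v(3)] a2(1) b2(2) z(2)[OF oV(1) o(3) pull_closed[OF o(3) u(3) m(1)]]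
    by (simp add: arrow_G)
  moreover have "arrow G ?S Q (prj2 U, prj2 V)"
    using PQ S u(4) v(4) pushn[OF v(4)] a2(2) b2(1) z(1)[OF oV(1) o(4) pull_closed[OF o(4) u(4) m(2)]]
    by (simp add: arrow_G)
  ultimately have "is_biproduct G P Q ?P"
    using u(5-9) v(5-9) S unfolding is_biproduct_def by (simp add: arrow_def G_simps)
  then show ?thesis by blast
qed

lemma zero_object_G: "is_zero_object G (zero_object A, zero_object B, zM (zero_object A) (zero_object B))"
proof -
  have "zero_object A \<in> Obj A" "zero_object B \<in> Obj B"
    using A.is_zero_object_zero_object B.is_zero_object_zero_object by (auto simp: is_zero_object_def)
  then show ?thesis
    using A.is_zero_object_zero_object B.is_zero_object_zero_object zM_closed
    by (simp add: is_zero_object_G_iff Obj_G)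
qed

sublocale G: preabelian_category R G
proof
  show "\<exists>Z. is_zero_object G Z" using zero_object_G by blast
  show "\<exists>S. is_biproduct G P Q S" if "P \<in> Obj G" "Q \<in> Obj G" for P Q using biproduct_G that .
  show "\<exists>K k. is_kernel G P Q h K k" if h: "arrow G P Q h" for P Q h
    using kernel_G[OF h] A.ex_kernel[OF arrow_GD(3)[OF h]] B.ex_kernel[OF arrow_GD(4)[OF h]] by blast
  show "\<exists>K k. is_cokernel G P Q h K k" if h: "arrow G P Q h" for P Q h
    using cokernel_G[OF h] A.ex_cokernel[OF arrow_GD(3)[OF h]] B.ex_cokernel[OF arrow_GD(4)[OF h]] by blast
qed

text \<open>An arbitrary kernel differs from the one assembled from component kernels by an
  isomorphism, and the components of that isomorphism are isomorphisms. This is what exactness of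
  the projections amounts to on kernels.\<close>

lemma kernel_G_components:
  assumes k: "is_kernel G P Q h K k"
  shows "is_kernel A (oA P) (oA Q) (fst h) (oA K) (fst k)"
    and "is_kernel B (oB P) (oB Q) (snd h) (oB K) (snd k)"
proof -
  have h: "arrow G P Q h" using G.is_kernelD(1)[OF k] .
  obtain U u where u: "is_kernel A (oA P) (oA Q) (fst h) U u" using A.ex_kernel[OF arrow_GD(3)[OF h]] by blast
  obtain V v where v: "is_kernel B (oB P) (oB Q) (snd h) V v" using B.ex_kernel[OF arrow_GD(4)[OF h]] by blast
  obtain \<nu> where n: "is_kernel G P Q h (U, V, \<nu>) (u, v)" using kernel_G[OF h u v] by blast
  obtain p where p: "arrow G K (U, V, \<nu>) p" "is_iso G K (U, V, \<nu>) p" "(u, v) \<cdot>\<^bsub>G\<^esub> p = k"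
    using G.kernel_unique[OF k n] by blast
  note i = p(2)[unfolded is_iso_G_iff[OF p(1)]] and d = arrow_GD(3,4)[OF p(1)]
  show "is_kernel A (oA P) (oA Q) (fst h) (oA K) (fst k)"
    "is_kernel B (oB P) (oB Q) (snd h) (oB K) (snd k)"
    using A.kernel_precompose_iso[OF u, of "oA K" "fst p"] B.kernel_precompose_iso[OF v, of "oB K" "snd p"]
      i d p(3) by (auto simp: G_simps)
qed

lemma cokernel_G_components:
  assumes k: "is_cokernel G P Q h K k"
  shows "is_cokernel A (oA P) (oA Q) (fst h) (oA K) (fst k)"
    and "is_cokernel B (oB P) (oB Q) (snd h) (oB K) (snd k)"
proof -
  have h: "arrow G P Q h" using G.is_cokernelD(1)[OF k] .
  obtain U u where u: "is_cokernel A (oA P) (oA Q) (fst h) U u" using A.ex_cokernel[OF arrow_GD(3)[OF h]] by blast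
  obtain V v where v: "is_cokernel B (oB P) (oB Q) (snd h) V v" using B.ex_cokernel[OF arrow_GD(4)[OF h]] by blast
  obtain \<nu> where n: "is_cokernel G P Q h (U, V, \<nu>) (u, v)" using cokernel_G[OF h u v] by blast
  obtain p where p: "arrow G (U, V, \<nu>) K p" "is_iso G (U, V, \<nu>) K p" "p \<cdot>\<^bsub>G\<^esub> (u, v) = k"
    using G.cokernel_unique[OF n k] by blast
  note i = p(2)[unfolded is_iso_G_iff[OF p(1)]] and d = arrow_GD(3,4)[OF p(1)]
  show "is_cokernel A (oA P) (oA Q) (fst h) (oA K) (fst k)"
    "is_cokernel B (oB P) (oB Q) (snd h) (oB K) (snd k)"
    using A.cokernel_postcompose_iso[OF u, of "oA K" "fst p"] B.cokernel_postcompose_iso[OF v, of "oB K" "snd p"]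
      i d p(3) by (auto simp: G_simps)
qed

end

section \<open>Derived categories\<close>

lemma derived_category_simps:
  "Obj (derived_category C) = Obj (localization (Ch C) (quasi_isos C))"
  "Hom (derived_category C) X Y = Hom (localization (Ch C) (quasi_isos C)) X Y"
  "Ident (derived_category C) = Ident (localization (Ch C) (quasi_isos C))"
  "Comp (derived_category C) = Comp (localization (Ch C) (quasi_isos C))"
  "shift (derived_category C) = derived_shift C"
  "dist (derived_category C) = derived_triangles C"
  by (simp_all add: derived_category_def derived_cat_def cat.defs)

lemma isomorphic_derived_category:
  "isomorphic (derived_category C) = isomorphic (localization (Ch C) (quasi_isos C))"
  by (intro ext) (simp add: isomorphic_def is_iso_def is_inverse_def derived_category_simps)

lemma is_zero_object_derived_category:
  "is_zero_object (derived_category C) = is_zero_object (localization (Ch C) (quasi_isos C))"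
  by (intro ext) (simp add: is_zero_object_def derived_category_simps)

lemma is_zero_morphism_derived_category:
  "is_zero_morphism (derived_category C) = is_zero_morphism (localization (Ch C) (quasi_isos C))"
  by (intro ext) (simp add: is_zero_morphism_def is_zero_object_derived_category derived_category_simps)

lemma fully_faithful_derived_category:
  "fully_faithful (derived_category C) (derived_category D) F \<longleftrightarrow>
     fully_faithful (localization (Ch C) (quasi_isos C)) (localization (Ch D) (quasi_isos D)) F"
  by (simp add: fully_faithful_def is_functor_def derived_category_simps)

section \<open>Full faithfulness on localizations from a strict retraction\<close>

definition id_functor :: "('o, 'm, 'o, 'm) functor_data" where
  "id_functor = \<lparr>fob = (\<lambda>X. X), fmor = (\<lambda>f. f)\<rparr>"

definition comp_functor ::
  "('p, 'n, 'q, 'k) functor_data \<Rightarrow> ('o, 'm, 'p, 'n) functor_data \<Rightarrow> ('o, 'm, 'q, 'k) functor_data" where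
  "comp_functor F P = \<lparr>fob = (\<lambda>X. fob F (fob P X)), fmor = (\<lambda>f. fmor F (fmor P f))\<rparr>"

lemma functor_simps:
  "fob id_functor X = X" "fmor id_functor f = f"
  "fob (comp_functor F P) X = fob F (fob P X)" "fmor (comp_functor F P) f = fmor F (fmor P f)"
  by (simp_all add: id_functor_def comp_functor_def)

lemma map_zz_step_id: "map (map_zz_step id_functor) p = p"
proof -
  have "map_zz_step id_functor s = s" for s :: "('a, 'b) step"
    by (cases s) (simp_all add: functor_simps)
  then show ?thesis by (simp add: map_idI)
qed

lemma map_zz_step_comp:
  "map (map_zz_step (comp_functor F P)) p = map (map_zz_step F) (map (map_zz_step P) p)"
proof -
  have "map_zz_step (comp_functor F P) s = map_zz_step F (map_zz_step P s)" for s
    by (cases s) (simp_all add: functor_simps)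
  then show ?thesis by simp
qed

lemma localizing_functor_id: "localizing C W \<Longrightarrow> localizing_functor C W C W id_functor"
  by (simp add: localizing_functor_def localizing_functor_axioms_def is_functor_def id_functor_def)

lemma localizing_functor_comp:
  assumes "localizing_functor C W D V P" "localizing_functor D V E U F"
  shows "localizing_functor C W E U (comp_functor F P)"
proof -
  interpret P: localizing_functor C W D V P by fact
  interpret F: localizing_functor D V E U F by fact
  show ?thesis
  proof
    show "is_functor C E (comp_functor F P)"
      unfolding is_functor_def comp_functor_def functor_data.simps
    proof (intro conjI ballI)
      fix X assume X: "X \<in> Obj C"
      show "fob F (fob P X) \<in> Obj E" using P.F_obj[OF X] F.F_obj by blast
      show "fmor F (fmor P (Ident C X)) = Ident E (fob F (fob P X))"
        using P.F_ident[OF X] F.F_ident[OF P.F_obj[OF X]] by simp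
    next
      fix X Y f assume "X \<in> Obj C" "Y \<in> Obj C" "f \<in> Hom C X Y"
      then have "arrow C X Y f" by (simp add: arrow_def)
      then show "fmor F (fmor P f) \<in> Hom E (fob F (fob P X)) (fob F (fob P Y))"
        using arrowD(3)[OF F.F_arrow[OF P.F_arrow]] by blast
    next
      fix X Y Z f g assume "X \<in> Obj C" "Y \<in> Obj C" "Z \<in> Obj C" "f \<in> Hom C X Y" "g \<in> Hom C Y Z"
      then have a: "arrow C X Y f" "arrow C Y Z g" by (simp_all add: arrow_def)
      show "fmor F (fmor P (g \<cdot>\<^bsub>C\<^esub> f)) = fmor F (fmor P g) \<cdot>\<^bsub>E\<^esub> fmor F (fmor P f)"
        using P.F_comp[OF a] F.F_comp[OF P.F_arrow[OF a(1)] P.F_arrow[OF a(2)]] by simp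
    qed
    show "fmor (comp_functor F P) w \<in> U (fob (comp_functor F P) X) (fob (comp_functor F P) Y)"
      if "X \<in> Obj C" "Y \<in> Obj C" "w \<in> W X Y" for X Y w
      using F.F_W[OF P.F_obj[OF that(1)] P.F_obj[OF that(2)] P.F_W[OF that]]
      by (simp add: comp_functor_def)
  qed
qed

text \<open>Faithfulness: \<open>P\<close> carries an equivalence of images back to the original
  zigzags. Fullness: \<open>full\<close> presents each zigzag between images as the image of its own
  retraction.\<close>

lemma fully_faithful_localized:
  assumes "localizing_functor C W D V F" "localizing_functor D V C W P"
    and retr: "\<And>X. X \<in> Obj C \<Longrightarrow> fob P (fob F X) = X"
      "\<And>X Y f. arrow C X Y f \<Longrightarrow> fmor P (fmor F f) = f"
    and full: "\<And>X Y q. \<lbrakk>X \<in> Obj C; Y \<in> Obj C; zigzag D V (fob F X) q (fob F Y)\<rbrakk>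
      \<Longrightarrow> zz_eq D V (fob F X) (fob F Y) q (map (map_zz_step F) (map (map_zz_step P) q))"
  shows "fully_faithful (localization C W) (localization D V) (localized_functor D V F)"
proof -
  interpret F: localizing_functor C W D V F by fact
  interpret P: localizing_functor D V C W P by fact
  have id: "P.Fz (F.Fz p) = p" if "zigzag C W X p Y" for X p Y
    using that
  proof (induction rule: zigzag.induct)
    case (zz_fwd X Y f p Z)
    then have "arrow C X Y f" by (simp add: arrow_def)
    then show ?case using zz_fwd retr by simp
  next
    case (zz_bwd X Y w p Z)
    then show ?case using retr(1) retr(2)[OF F.S.W_arrow[OF zz_bwd(1-3)]] by simp
  qed simp
  have "bij_betw (fmor F.LF) (Hom F.S.L X Y) (Hom F.T.L (fob F X) (fob F Y))"
    if X: "X \<in> Obj C" and Y: "Y \<in> Obj C" for X Y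
  proof (intro bij_betwI')
    fix \<alpha> \<beta> assume "\<alpha> \<in> Hom F.S.L X Y" "\<beta> \<in> Hom F.S.L X Y"
    then obtain p q where p: "zigzag C W X p Y" "\<alpha> = zz_class C W X p Y"
      and q: "zigzag C W X q Y" "\<beta> = zz_class C W X q Y"
      by (auto elim!: F.S.Hom_localizationE)
    have "fmor F.LF \<alpha> = fmor F.LF \<beta> \<longleftrightarrow> zz_eq D V (fob F X) (fob F Y) (F.Fz p) (F.Fz q)"
      using F.fmor_localized p q F.T.zz_class_eq_iff[OF F.zigzag_map[OF p(1)]] by simp
    also have "\<dots> \<longleftrightarrow> zz_eq C W X Y p q"
      using P.zz_eq_map[of "fob F X" "fob F Y" "F.Fz p" "F.Fz q"] F.zz_eq_map id[OF p(1)] id[OF q(1)]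
        retr(1)[OF X] retr(1)[OF Y] by auto
    also have "\<dots> \<longleftrightarrow> \<alpha> = \<beta>" using F.S.zz_class_eq_iff[OF p(1)] p q by simp
    finally show "fmor F.LF \<alpha> = fmor F.LF \<beta> \<longleftrightarrow> \<alpha> = \<beta>" .
  next
    fix \<alpha> assume "\<alpha> \<in> Hom F.S.L X Y"
    then show "fmor F.LF \<alpha> \<in> Hom F.T.L (fob F X) (fob F Y)"
      by (elim F.S.Hom_localizationE) (simp add: F.fmor_localized F.T.zz_class_Hom F.zigzag_map)
  next
    fix \<beta> assume "\<beta> \<in> Hom F.T.L (fob F X) (fob F Y)"
    then obtain q where q: "zigzag D V (fob F X) q (fob F Y)" "\<beta> = zz_class D V (fob F X) q (fob F Y)"
      by (rule F.T.Hom_localizationE)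
    have z: "zigzag C W X (P.Fz q) Y" using P.zigzag_map[OF q(1)] retr(1) X Y by simp
    have "\<beta> = fmor F.LF (zz_class C W X (P.Fz q) Y)"
      using F.fmor_localized[OF z] iffD2[OF F.T.zz_class_eq_iff[OF q(1)] full[OF X Y q(1)]] q(2) by simp
    then show "\<exists>\<alpha>\<in>Hom F.S.L X Y. \<beta> = fmor F.LF \<alpha>" using F.S.zz_class_Hom[OF z] by blast
  qed
  then show ?thesis
    unfolding fully_faithful_def using F.is_functor_localized
    by (simp add: F.fob_localized F.S.Obj_localization)
qed

text \<open>Strips the identities from a naturality square whose components at both endpoints are
  identities.\<close>

lemma (in localizing) zz_conjugate_ident:
  assumes o: "X \<in> Obj C" "Y \<in> Obj C" and q: "zigzag C W X q Y" and q': "zigzag C W X q' Y"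
    and e: "zz_eq C W X Y (q @ [Fwd Y (Ident C Y) Y]) ([Fwd X (Ident C X) X] @ q')"
  shows "zz_eq C W X Y q q'"
proof -
  have iX: "zz_eq C W X X [Fwd X (Ident C X) X] []" and iY: "zz_eq C W Y Y [Fwd Y (Ident C Y) Y] []"
    using o by (auto intro: zz_ident)
  have "zz_eq C W X Y q (q @ [Fwd Y (Ident C Y) Y])"
    using zz_sym[OF zz_cong_right[OF q iY]] by simp
  moreover have "zz_eq C W X Y ([Fwd X (Ident C X) X] @ q') q'"
    using zz_cong_left[OF iX q'] by simp
  ultimately show ?thesis using e by (blast intro: zz_trans)
qed

text \<open>Along a zigzag \<open>q\<close> between images, naturality of \<open>eta\<close> relates
  \<open>q\<close> to \<open>F (P q)\<close>, and \<open>eta\<close> is the identity at both ends.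
  In between, \<open>q\<close> may pass through objects where \<open>eta\<close> is far from
  invertible.\<close>

lemma fully_faithful_reflective:
  fixes C :: "('o, 'm, 'z) cat_scheme" and D :: "('p, 'n, 'y) cat_scheme"
  assumes "localizing_functor C W D V F" "localizing_functor D V C W P"
    and retr: "\<And>X. X \<in> Obj C \<Longrightarrow> fob P (fob F X) = X"
      "\<And>X Y f. arrow C X Y f \<Longrightarrow> fmor P (fmor F f) = f"
    and eta: "\<And>X. X \<in> Obj D \<Longrightarrow> arrow D X (fob F (fob P X)) (\<eta> X)"
      "\<And>X Y f. arrow D X Y f \<Longrightarrow> \<eta> Y \<cdot>\<^bsub>D\<^esub> f = fmor F (fmor P f) \<cdot>\<^bsub>D\<^esub> \<eta> X"
      "\<And>X. X \<in> Obj C \<Longrightarrow> \<eta> (fob F X) = Ident D (fob F X)"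
  shows "fully_faithful (localization C W) (localization D V) (localized_functor D V F)"
proof (rule fully_faithful_localized[OF assms(1,2) retr])
  interpret F: localizing_functor C W D V F by fact
  interpret P: localizing_functor D V C W P by fact
  fix X Y q assume X: "X \<in> Obj C" and Y: "Y \<in> Obj C" and q: "zigzag D V (fob F X) q (fob F Y)"
  have q': "zigzag D V (fob F X) (F.Fz (P.Fz q)) (fob F Y)"
    using F.zigzag_map[OF P.zigzag_map[OF q]] retr(1) X Y by simp
  let ?I = "id_functor :: ('p, 'n, 'p, 'n) functor_data"
  have "zz_eq D V (fob ?I (fob F X)) (fob (comp_functor F P) (fob F Y))
     (map (map_zz_step ?I) q @ [Fwd (fob ?I (fob F Y)) (\<eta> (fob F Y)) (fob (comp_functor F P) (fob F Y))])
     ([Fwd (fob ?I (fob F X)) (\<eta> (fob F X)) (fob (comp_functor F P) (fob F X))] @ map (map_zz_step (comp_functor F P)) q)"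
    by (rule zigzag_natural[where \<eta> = \<eta>, OF localizing_functor_id[OF F.T.localizing_axioms]
          localizing_functor_comp[OF assms(2,1)] _ _ q])
       (simp_all add: functor_simps eta)
  then show "zz_eq D V (fob F X) (fob F Y) q (F.Fz (P.Fz q))"
    using F.T.zz_conjugate_ident[OF F.F_obj[OF X] F.F_obj[OF Y] q q'] retr(1) X Y eta(3)
    by (simp add: functor_simps map_zz_step_id map_zz_step_comp)
qed

text \<open>The same argument with the transformation running from \<open>F P\<close> to the
  identity, so the equivalence comes out reversed.\<close>

lemma fully_faithful_coreflective:
  fixes C :: "('o, 'm, 'z) cat_scheme" and D :: "('p, 'n, 'y) cat_scheme"
  assumes "localizing_functor C W D V F" "localizing_functor D V C W P"
    and retr: "\<And>X. X \<in> Obj C \<Longrightarrow> fob P (fob F X) = X"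
      "\<And>X Y f. arrow C X Y f \<Longrightarrow> fmor P (fmor F f) = f"
    and eps: "\<And>X. X \<in> Obj D \<Longrightarrow> arrow D (fob F (fob P X)) X (\<epsilon> X)"
      "\<And>X Y f. arrow D X Y f \<Longrightarrow> \<epsilon> Y \<cdot>\<^bsub>D\<^esub> fmor F (fmor P f) = f \<cdot>\<^bsub>D\<^esub> \<epsilon> X"
      "\<And>X. X \<in> Obj C \<Longrightarrow> \<epsilon> (fob F X) = Ident D (fob F X)"
  shows "fully_faithful (localization C W) (localization D V) (localized_functor D V F)"
proof (rule fully_faithful_localized[OF assms(1,2) retr])
  interpret F: localizing_functor C W D V F by fact
  interpret P: localizing_functor D V C W P by fact
  fix X Y q assume X: "X \<in> Obj C" and Y: "Y \<in> Obj C" and q: "zigzag D V (fob F X) q (fob F Y)"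
  have q': "zigzag D V (fob F X) (F.Fz (P.Fz q)) (fob F Y)"
    using F.zigzag_map[OF P.zigzag_map[OF q]] retr(1) X Y by simp
  let ?I = "id_functor :: ('p, 'n, 'p, 'n) functor_data"
  have "zz_eq D V (fob (comp_functor F P) (fob F X)) (fob ?I (fob F Y))
     (map (map_zz_step (comp_functor F P)) q @ [Fwd (fob (comp_functor F P) (fob F Y)) (\<epsilon> (fob F Y)) (fob ?I (fob F Y))])
     ([Fwd (fob (comp_functor F P) (fob F X)) (\<epsilon> (fob F X)) (fob ?I (fob F X))] @ map (map_zz_step ?I) q)"
    by (rule zigzag_natural[where \<eta> = \<epsilon>, OF localizing_functor_comp[OF assms(2,1)]
          localizing_functor_id[OF F.T.localizing_axioms] _ _ q])
       (simp_all add: functor_simps eps)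
  then have "zz_eq D V (fob F X) (fob F Y) (F.Fz (P.Fz q)) q"
    using F.T.zz_conjugate_ident[OF F.F_obj[OF X] F.F_obj[OF Y] q' q] retr(1) X Y eps(3)
    by (simp add: functor_simps map_zz_step_id map_zz_step_comp)
  then show "zz_eq D V (fob F X) (fob F Y) q (F.Fz (P.Fz q))" by (rule zz_sym)
qed

section \<open>Distinguished triangles of the derived category\<close>

context preabelian_category
begin

lemma shift_derived: "fob (shift (derived_category C)) X = fob (shift_functor C) X"
  by (simp add: derived_category_simps derived_shift_def localized_functor_def)

text \<open>Closure of a full subcategory concerns objects alone, so only the three isomorphisms
  with a cone triangle are kept; the one at the cone is reversed, to lead from the cone to
  \<open>Z\<close>.\<close>

lemma derived_trianglesD:
  assumes "(X, Y, Z, u, v, w) \<in> derived_triangles C"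
  obtains X' Y' f where "is_complex C X'" "is_complex C Y'" "is_chain_map C X' Y' f"
    "isomorphic (localization (Ch C) (quasi_isos C)) X X'"
    "isomorphic (localization (Ch C) (quasi_isos C)) Y Y'"
    "isomorphic (localization (Ch C) (quasi_isos C)) (cone C X' Y' f) Z"
    "is_complex C X" "is_complex C Y" "is_complex C Z"
proof -
  interpret localizing "Ch C" "quasi_isos C" by (rule localizing_quasi_isos)
  interpret L: category L by (rule category_localization)
  have o: "is_complex C X" "is_complex C Y" "is_complex C Z"
    using assms by (auto simp: derived_triangles_def derived_cat_def Obj_localization Ch_simps)
  obtain X' Y' f a b c where t: "is_complex C X'" "is_complex C Y'" "is_chain_map C X' Y' f"
    "is_iso L X X' a" "is_iso L Y Y' b" "is_iso L Z (cone C X' Y' f) c"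
    using assms unfolding derived_triangles_def derived_cat_def by blast
  have "isomorphic L X X'" "isomorphic L Y Y'" "isomorphic L Z (cone C X' Y' f)"
    using t(4-6) by (auto simp: isomorphic_def)
  then show thesis using that[OF t(1-3) _ _ L.isomorphic_sym o] by blast
qed

text \<open>The triangle is compared with itself along identities; the last square uses that the
  shift preserves them.\<close>

lemma cone_triangle:
  assumes X: "is_complex C X" and Y: "is_complex C Y" and f: "is_chain_map C X Y f"
  shows "\<exists>u v w. (X, Y, cone C X Y f, u, v, w) \<in> derived_triangles C"
proof -
  interpret localizing "Ch C" "quasi_isos C" by (rule localizing_quasi_isos)
  interpret L: category L by (rule category_localization)
  interpret s: localizing_functor "Ch C" "quasi_isos C" "Ch C" "quasi_isos C" "shift_functor C"
    by (rule localizing_shift)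
  let ?K = "cone C X Y f" and ?S = "fob (shift_functor C) X"
  let ?u = "in_derived C X f Y" and ?v = "in_derived C Y (cone_in C X Y) ?K"
    and ?w = "in_derived C ?K (cone_out C X Y) ?S"
  have o: "X \<in> Obj L" "Y \<in> Obj L" "?K \<in> Obj L" "?S \<in> Obj L"
    using X Y cone_complex[OF X Y f] shift_complex[OF X] by (simp_all add: Obj_localization Ch_simps)
  have a: "arrow L X Y ?u" "arrow L Y ?K ?v" "arrow L ?K ?S ?w"
    using o X Y f cone_complex[OF X Y f] shift_complex[OF X] cone_in_chain_map[OF X Y f]
      cone_out_chain_map[OF X Y f] unfolding in_derived_def
    by (auto simp: arrow_def[of L] intro!: zz_class_Hom zigzag_Fwd simp: arrow_Ch)
  have sh: "fmor (derived_shift C) (Ident L X) = Ident L ?S" "fob (derived_shift C) X = ?S"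
    using is_functorD(2)[OF s.is_functor_localized o(1)] by (simp_all add: derived_shift_def s.fob_localized)
  have "(X, Y, ?K, ?u, ?v, ?w) \<in> derived_triangles C"
    unfolding derived_triangles_def derived_cat_def mem_Collect_eq case_prod_conv
  proof (intro conjI exI)
    show "is_complex C X" "is_complex C Y" "is_chain_map C X Y f" by fact+
    show "is_iso L X X (Ident L X)" "is_iso L Y Y (Ident L Y)" "is_iso L ?K ?K (Ident L ?K)"
      using L.is_iso_ident o by blast+
  qed (use o a arrowD(3)[OF a(1)] arrowD(3)[OF a(2)] arrowD(3)[OF a(3)] sh
        L.comp_id_left[OF a(1)] L.comp_id_right[OF a(1)] L.comp_id_left[OF a(2)] L.comp_id_right[OF a(2)]
        L.comp_id_left[OF a(3)] L.comp_id_right[OF a(3)] in simp_all)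
  then show ?thesis by blast
qed

definition zero_complex :: "('o, 'm) cochain" where
  "zero_complex = \<lparr>cob = (\<lambda>n. zero_object C), cdiff = (\<lambda>n. hzero C (zero_object C) (zero_object C))\<rparr>"

lemma zero_complex: "is_complex C zero_complex" "is_zero_object C (cob zero_complex n)"
proof -
  show z: "is_zero_object C (cob zero_complex n)" for n
    using is_zero_object_zero_object by (simp add: zero_complex_def)
  show "is_complex C zero_complex"
    using zero_complex_is_complex[OF z] arrow_zero is_zero_object_zero_object
    by (simp add: zero_complex_def is_zero_object_def)
qed

end

section \<open>Exact functors on cones, and triangulated kernels\<close>

context exact_functor
begin

lemma F_zero_object: "is_zero_object C Z \<Longrightarrow> is_zero_object D (fob F Z)"
  using F_obj[of Z] F_ident[of Z] F_zero[of Z Z]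
  by (simp add: S.is_zero_object_iff T.is_zero_object_iff)

lemma F_biproduct:
  assumes P: "is_biproduct C X Y P" and o: "X \<in> Obj C" "Y \<in> Obj C"
  shows "is_biproduct D (fob F X) (fob F Y) \<lparr>vertex = fob F (vertex P), inj1 = fmor F (inj1 P),
    inj2 = fmor F (inj2 P), prj1 = fmor F (prj1 P), prj2 = fmor F (prj2 P)\<rparr>"
proof -
  note p = S.biproductD[OF P o]
  note d = arrowD(3)[OF F_arrow[OF p(1)]] arrowD(3)[OF F_arrow[OF p(2)]]
    arrowD(3)[OF F_arrow[OF p(3)]] arrowD(3)[OF F_arrow[OF p(4)]]
  have v: "vertex P \<in> Obj C" using p(1) by (simp add: arrow_def)
  show ?thesis
    unfolding is_biproduct_def
    using d F_obj[OF v] F_comp[OF p(1,3)] F_comp[OF p(2,4)] F_comp[OF p(2,3)] F_comp[OF p(1,4)] p(5-9)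
      F_ident[OF o(1)] F_ident[OF o(2)] F_ident[OF v] F_zero[OF o] F_zero[OF o(2,1)]
      F_comp[OF p(3,1)] F_comp[OF p(4,2)] F_add[OF S.arrow_comp[OF p(3,1)] S.arrow_comp[OF p(4,2)]]
    by simp
qed

text \<open>Additivity preserves biproducts and the formula for the differential, so the images of
  the structure biproducts exhibit the image as a cone, possibly not the chosen one.\<close>

lemma chain_functor_cone:
  assumes X: "is_complex C X" and Y: "is_complex C Y" and f: "is_chain_map C X Y f"
    and K: "is_cone C X Y f K P"
  shows "\<exists>Q. is_cone D (fob FC X) (fob FC Y) (fmor FC f) (fob FC K) Q"
proof -
  let ?Q = "\<lambda>n. \<lparr>vertex = fob F (vertex (P n)), inj1 = fmor F (inj1 (P n)),
    inj2 = fmor F (inj2 (P n)), prj1 = fmor F (prj1 (P n)), prj2 = fmor F (prj2 (P n))\<rparr>"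
  have "is_cone D (fob FC X) (fob FC Y) (fmor FC f) (fob FC K) ?Q"
    unfolding is_cone_def chain_functor_simps
  proof (intro allI)
    fix n :: int
    have e: "n + 1 + 1 = n + 2" by simp
    note k = S.is_coneD[OF K X Y, of n] and k1 = S.is_coneD[OF K X Y, of "n + 1", unfolded e]
    note o = S.complexD(1)[OF X] S.complexD(1)[OF Y]
    note dX = S.complexD(2)[OF X, of "n + 1", unfolded e] and dY = S.complexD(2)[OF Y, of n]
    note fn = S.chain_mapD(1)[OF X Y f, of "n + 1"]
    show "is_biproduct D (fob F (cob X (n + 1))) (fob F (cob Y n)) (?Q n) \<and>
         vertex (?Q n) = fob F (cob K n) \<and>
         arrow D (fob F (cob K n)) (fob F (cob K (n + 1))) (fmor F (cdiff K n)) \<and>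
         prj1 (?Q (n + 1)) \<cdot>\<^bsub>D\<^esub> fmor F (cdiff K n) =
         hneg D (fob F (cob X (n + 1))) (fob F (cob X (n + 2))) (fmor F (cdiff X (n + 1))) \<cdot>\<^bsub>D\<^esub> prj1 (?Q n) \<and>
         prj2 (?Q (n + 1)) \<cdot>\<^bsub>D\<^esub> fmor F (cdiff K n) =
         hadd D (fob F (cob K n)) (fob F (cob Y (n + 1))) (fmor F (f (n + 1)) \<cdot>\<^bsub>D\<^esub> prj1 (?Q n))
          (fmor F (cdiff Y n) \<cdot>\<^bsub>D\<^esub> prj2 (?Q n))"
      using F_biproduct[OF k(1) o] k(2) F_arrow[OF k(3)]
        F_comp[OF k(3) k1(4)] F_comp[OF k(3) k1(5)] k(6,7) F_comp[OF k(4) S.arrow_neg[OF dX]] F_neg[OF dX]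
        F_comp[OF k(4) fn] F_comp[OF k(5) dY] F_add[OF S.arrow_comp[OF k(4) fn] S.arrow_comp[OF k(5) dY]]
      by simp
  qed
  then show ?thesis by blast
qed

lemma chain_functor_shift:
  assumes X: "is_complex C X"
  shows "fob FC (fob (shift_functor C) X) = fob (shift_functor D) (fob FC X)"
proof -
  have e: "n + 1 + 1 = n + (2::int)" for n by simp
  show ?thesis
    using F_neg[OF S.complexD(2)[OF X], of "_ + 1", unfolded e]
    by (simp add: chain_functor_def shift_functor_def)
qed

text \<open>Serves both halves of the decomposition, as the kernels of the two projections.
  Acyclicity is tested in the abelian target \<open>D\<close>, which lets \<open>C\<close> be the
  glued category.\<close>

lemma triangulated_kernel:
  assumes D: "abelian_category R D"
  shows "triangulated_subcategory (derived_category C) {X. is_complex C X \<and> acyclic_complex D (fob FC X)}"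
    (is "triangulated_subcategory _ ?S")
proof -
  interpret D: abelian_category R D by (rule D)
  interpret L: localizing_functor "Ch C" "quasi_isos C" "Ch D" "quasi_isos D" FC
    by (rule localizing_chain)
  have iso: "Y \<in> ?S" if "X \<in> ?S" "is_complex C Y" "isomorphic L.S.L X Y" for X Y
    using that D.acyclic_isomorphic[OF chain_functor_complex chain_functor_complex L.isomorphic_map[OF that(3)]]
    by blast
  show ?thesis
    unfolding triangulated_subcategory_def
  proof (intro conjI allI ballI impI)
    show "?S \<subseteq> Obj (derived_category C)"
      by (auto simp: derived_category_simps L.S.Obj_localization S.Ch_simps)
    have "is_zero_object D (cob (fob FC S.zero_complex) n)" for n
      using F_zero_object[OF S.zero_complex(2)] by (simp add: chain_functor_simps)
    then have "S.zero_complex \<in> ?S"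
      using S.zero_complex(1) T.acyclic_if_zero_objects[OF chain_functor_complex[OF S.zero_complex(1)]]
      by blast
    moreover have "is_zero_object (derived_category C) S.zero_complex"
      unfolding is_zero_object_derived_category
      using L.S.zero_object_localization S.zero_object_Ch S.zero_complex by blast
    ultimately show "\<exists>Z\<in>?S. is_zero_object (derived_category C) Z" by blast
  next
    fix X Y assume "X \<in> ?S" "Y \<in> Obj (derived_category C)" "isomorphic (derived_category C) X Y"
    then show "Y \<in> ?S"
      using iso by (simp add: derived_category_simps L.S.Obj_localization S.Ch_simps isomorphic_derived_category)
  next
    fix X assume "X \<in> Obj (derived_category C)"
    then have X: "is_complex C X" by (simp add: derived_category_simps L.S.Obj_localization S.Ch_simps)
    \<comment> \<open>The shift moves exactness at \<open>n\<close> to exactness at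
      \<open>n + 1\<close>; with all degrees quantified, the two conditions agree.\<close>
    have "acyclic_complex D (fob (shift_functor D) (fob FC X)) \<longleftrightarrow> acyclic_complex D (fob FC X)"
      unfolding T.acyclic_shift_iff[OF chain_functor_complex[OF X]] by (metis diff_add_cancel)
    then show "X \<in> ?S \<longleftrightarrow> fob (shift (derived_category C)) X \<in> ?S"
      using X S.shift_complex[OF X] chain_functor_shift[OF X] by (simp add: S.shift_derived)
  next
    fix X Y Z u v w
    assume a: "(X, Y, Z, u, v, w) \<in> dist (derived_category C) \<and> X \<in> ?S \<and> Y \<in> ?S"
    \<comment> \<open>The chain map joins \<open>X'\<close> and \<open>Y'\<close> rather than
      \<open>X\<close> and \<open>Y\<close>, so membership travels along isomorphisms from
      \<open>X\<close>, \<open>Y\<close> to \<open>X'\<close>, \<open>Y'\<close>, through the cone,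
      and on to \<open>Z\<close>.\<close>
    obtain X' Y' f where t: "is_complex C X'" "is_complex C Y'" "is_chain_map C X' Y' f"
      "isomorphic L.S.L X X'" "isomorphic L.S.L Y Y'" "isomorphic L.S.L (cone C X' Y' f) Z"
      "is_complex C X" "is_complex C Y" "is_complex C Z"
      using a S.derived_trianglesD unfolding derived_category_simps by blast
    have s: "X' \<in> ?S" "Y' \<in> ?S" using iso a t by blast+
    obtain Q where "is_cone D (fob FC X') (fob FC Y') (fmor FC f) (fob FC (cone C X' Y' f)) Q"
      using chain_functor_cone[OF t(1-3) S.is_cone_cone[OF t(1-3)]] by blast
    then have "cone C X' Y' f \<in> ?S"
      using T.acyclic_cone[OF chain_functor_complex[OF t(1)] chain_functor_complex[OF t(2)]
        chain_functor_chain_map[OF t(1-3)]] s S.cone_complex[OF t(1-3)] by blast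
    then show "Z \<in> ?S" using iso t by blast
  qed
qed

end

section \<open>The semiorthogonal decomposition\<close>

definition glued_prj_fst :: "('oa \<times> 'ob \<times> 'v, 'ma \<times> 'mb, 'oa, 'ma) functor_data" where
  "glued_prj_fst = \<lparr>fob = fst, fmor = fst\<rparr>"

definition glued_prj_snd :: "('oa \<times> 'ob \<times> 'v, 'ma \<times> 'mb, 'ob, 'mb) functor_data" where
  "glued_prj_snd = \<lparr>fob = (\<lambda>P. fst (snd P)), fmor = snd\<rparr>"

lemma glued_prj_simps:
  "fob glued_prj_fst P = fst P" "fmor glued_prj_fst h = fst h"
  "fob glued_prj_snd P = fst (snd P)" "fmor glued_prj_snd h = snd h"
  by (simp_all add: glued_prj_fst_def glued_prj_snd_def)

lemma is_functorI:
  assumes "\<And>X. X \<in> Obj C \<Longrightarrow> fob F X \<in> Obj D"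
    and "\<And>X. X \<in> Obj C \<Longrightarrow> fmor F (Ident C X) = Ident D (fob F X)"
    and "\<And>X Y f. arrow C X Y f \<Longrightarrow> arrow D (fob F X) (fob F Y) (fmor F f)"
    and "\<And>X Y Z f g. \<lbrakk>arrow C X Y f; arrow C Y Z g\<rbrakk> \<Longrightarrow> fmor F (g \<cdot>\<^bsub>C\<^esub> f) = fmor F g \<cdot>\<^bsub>D\<^esub> fmor F f"
  shows "is_functor C D F"
  unfolding is_functor_def
proof (intro conjI ballI)
  fix X Y f assume "X \<in> Obj C" "Y \<in> Obj C" "f \<in> Hom C X Y"
  then show "fmor F f \<in> Hom D (fob F X) (fob F Y)"
    using arrowD(3)[OF assms(3)[OF arrowI]] by blast
next
  fix X Y Z f g assume "X \<in> Obj C" "Y \<in> Obj C" "Z \<in> Obj C" "f \<in> Hom C X Y" "g \<in> Hom C Y Z"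
  then show "fmor F (g \<cdot>\<^bsub>C\<^esub> f) = fmor F g \<cdot>\<^bsub>D\<^esub> fmor F f"
    using assms(4)[OF arrowI arrowI] by blast
qed (use assms(1,2) in blast)+

context linear_category
begin

text \<open>Supplies the trivial component of the kernel of an included arrow.\<close>

lemma kernel_zero_object:
  assumes Z: "is_zero_object C Z"
  shows "is_kernel C Z Z (hzero C Z Z) Z (hzero C Z Z)"
proof -
  have o: "Z \<in> Obj C" using Z by (simp add: is_zero_object_def)
  note z = arrow_zero[OF o o]
  show ?thesis
  proof (rule is_kernelI[OF z z comp_zero_left[OF z o]])
    fix T t assume t: "arrow C T Z t"
    show "\<exists>u. arrow C T Z u \<and> hzero C Z Z \<cdot>\<^bsub>C\<^esub> u = t"
      using t arrow_to_zero[OF Z arrow_comp[OF t z]] arrow_to_zero[OF Z t] by auto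
  qed (use to_zero_object_unique[OF Z] in blast)
qed

lemma cokernel_zero_object:
  assumes Z: "is_zero_object C Z"
  shows "is_cokernel C Z Z (hzero C Z Z) Z (hzero C Z Z)"
proof -
  have o: "Z \<in> Obj C" using Z by (simp add: is_zero_object_def)
  note z = arrow_zero[OF o o]
  show ?thesis
  proof (rule is_cokernelI[OF z z comp_zero_left[OF z o]])
    fix T t assume t: "arrow C Z T t"
    show "\<exists>u. arrow C Z T u \<and> u \<cdot>\<^bsub>C\<^esub> hzero C Z Z = t"
      using t arrow_from_zero[OF Z arrow_comp[OF z t]] arrow_from_zero[OF Z t] by auto
  next
    fix T u v assume u: "arrow C Z T u" "arrow C Z T v"
    show "u = v" using arrow_from_zero[OF Z u(1)] arrow_from_zero[OF Z u(2)] by simp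
  qed
qed

end

section \<open>Inclusions and projections of the glued category, with unit and counit\<close>

context gluing
begin

abbreviation ZA where "ZA \<equiv> zero_object A"
abbreviation ZB where "ZB \<equiv> zero_object B"
abbreviation iA where "iA \<equiv> glued_incl_fst A B M"
abbreviation iB where "iB \<equiv> glued_incl_snd A B M"

lemma zero_objects: "is_zero_object A ZA" "is_zero_object B ZB" "ZA \<in> Obj A" "ZB \<in> Obj B"
  using A.is_zero_object_zero_object B.is_zero_object_zero_object by (auto simp: is_zero_object_def)

lemma incl_simps:
  "fob iA X = (X, ZB, zM X ZB)" "fmor iA f = (f, hzero B ZB ZB)"
  "fob iB Y = (ZA, Y, zM ZA Y)" "fmor iB g = (hzero A ZA ZA, g)"
  by (simp_all add: glued_incl_fst_def glued_incl_snd_def)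

lemma exact_prj_fst: "exact_functor R G A glued_prj_fst"
proof
  show "is_functor G A glued_prj_fst"
    by (rule is_functorI) (auto simp: glued_prj_simps Obj_G G_simps arrow_G)
  show "is_kernel A (fob glued_prj_fst P) (fob glued_prj_fst Q) (fmor glued_prj_fst h)
      (fob glued_prj_fst K) (fmor glued_prj_fst k)" if "is_kernel G P Q h K k" for P Q h K k
    using kernel_G_components(1)[OF that] by (simp add: glued_prj_simps)
  show "is_cokernel A (fob glued_prj_fst P) (fob glued_prj_fst Q) (fmor glued_prj_fst h)
      (fob glued_prj_fst K) (fmor glued_prj_fst k)" if "is_cokernel G P Q h K k" for P Q h K k
    using cokernel_G_components(1)[OF that] by (simp add: glued_prj_simps)
qed (simp add: glued_prj_simps G_simps)

lemma exact_prj_snd: "exact_functor R G B glued_prj_snd"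
proof
  show "is_functor G B glued_prj_snd"
    by (rule is_functorI) (auto simp: glued_prj_simps Obj_G G_simps arrow_G)
  show "is_kernel B (fob glued_prj_snd P) (fob glued_prj_snd Q) (fmor glued_prj_snd h)
      (fob glued_prj_snd K) (fmor glued_prj_snd k)" if "is_kernel G P Q h K k" for P Q h K k
    using kernel_G_components(2)[OF that] by (simp add: glued_prj_simps)
  show "is_cokernel B (fob glued_prj_snd P) (fob glued_prj_snd Q) (fmor glued_prj_snd h)
      (fob glued_prj_snd K) (fmor glued_prj_snd k)" if "is_cokernel G P Q h K k" for P Q h K k
    using cokernel_G_components(2)[OF that] by (simp add: glued_prj_simps)
qed (simp add: glued_prj_simps G_simps)

lemma incl_fst_arrow: "arrow A X Y f \<Longrightarrow> arrow G (fob iA X) (fob iA Y) (fmor iA f)"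
  using zero_objects(4) zM_closed B.arrow_zero[OF zero_objects(4,4)]
  by (auto simp: arrow_G incl_simps Obj_G push_zero pull_zero dest: arrowD)

lemma incl_snd_arrow: "arrow B X Y g \<Longrightarrow> arrow G (fob iB X) (fob iB Y) (fmor iB g)"
  using zero_objects(3) zM_closed A.arrow_zero[OF zero_objects(3,3)]
  by (auto simp: arrow_G incl_simps Obj_G push_zero pull_zero dest: arrowD)

text \<open>The gluing element lies in \<open>M(K, 0)\<close>, which vanishes, so a kernel or
  cokernel assembled from components is itself an included object. A kernel occurs as the source of
  its arrow and a cokernel as the target, hence the disjunction.\<close>

lemma incl_fst_trivial:
  "arrow G (K, ZB, \<nu>) P h \<or> arrow G P (K, ZB, \<nu>) h \<Longrightarrow> (K, ZB, \<nu>) = fob iA K"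
  using trivial_snd[OF zero_objects(2), of K \<nu>] by (auto simp: arrow_G Obj_G incl_simps)

lemma incl_snd_trivial:
  "arrow G (ZA, L, \<nu>) P h \<or> arrow G P (ZA, L, \<nu>) h \<Longrightarrow> (ZA, L, \<nu>) = fob iB L"
  using trivial_fst[OF zero_objects(1), of L \<nu>] by (auto simp: arrow_G Obj_G incl_simps)

lemma exact_incl_fst: "exact_functor R A G iA"
proof
  note z = B.arrow_zero[OF zero_objects(4,4)]
  show "is_functor A G iA"
  proof (rule is_functorI)
    show "fmor iA (Ident A X) = Ident G (fob iA X)" for X
      using zero_objects(2) by (simp add: incl_simps G_simps B.is_zero_object_iff)
    show "fmor iA (g \<cdot>\<^bsub>A\<^esub> f) = fmor iA g \<cdot>\<^bsub>G\<^esub> fmor iA f" for g f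
      using B.comp_zero_left[OF z zero_objects(4)] by (simp add: incl_simps G_simps)
  qed (use incl_fst_arrow zM_closed zero_objects in \<open>auto simp: incl_simps Obj_G\<close>)
  show "fmor iA (hadd A X Y f g) = hadd G (fob iA X) (fob iA Y) (fmor iA f) (fmor iA g)" for X Y f g
    using B.add_zero_left[OF z] by (simp add: incl_simps G_simps)
  show "is_kernel G (fob iA X) (fob iA Y) (fmor iA f) (fob iA K) (fmor iA k)"
    if k: "is_kernel A X Y f K k" for X Y f K k
  proof -
    obtain \<nu> where n: "is_kernel G (fob iA X) (fob iA Y) (fmor iA f) (K, ZB, \<nu>) (k, hzero B ZB ZB)"
      using kernel_G[OF incl_fst_arrow[OF A.is_kernelD(1)[OF k]], of K k ZB "hzero B ZB ZB"] k
        B.kernel_zero_object[OF zero_objects(2)] by (auto simp: incl_simps)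
    note t = incl_fst_trivial[OF disjI1[OF G.is_kernelD(2)[OF n]]]
    show ?thesis using n unfolding t by (simp add: incl_simps(2))
  qed
  show "is_cokernel G (fob iA X) (fob iA Y) (fmor iA f) (fob iA K) (fmor iA k)"
    if k: "is_cokernel A X Y f K k" for X Y f K k
  proof -
    obtain \<nu> where n: "is_cokernel G (fob iA X) (fob iA Y) (fmor iA f) (K, ZB, \<nu>) (k, hzero B ZB ZB)"
      using cokernel_G[OF incl_fst_arrow[OF A.is_cokernelD(1)[OF k]], of K k ZB "hzero B ZB ZB"] k
        B.cokernel_zero_object[OF zero_objects(2)] by (auto simp: incl_simps)
    note t = incl_fst_trivial[OF disjI2[OF G.is_cokernelD(2)[OF n]]]
    show ?thesis using n unfolding t by (simp add: incl_simps(2))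
  qed
qed

lemma exact_incl_snd: "exact_functor R B G iB"
proof
  note z = A.arrow_zero[OF zero_objects(3,3)]
  show "is_functor B G iB"
  proof (rule is_functorI)
    show "fmor iB (Ident B X) = Ident G (fob iB X)" for X
      using zero_objects(1) by (simp add: incl_simps G_simps A.is_zero_object_iff)
    show "fmor iB (g \<cdot>\<^bsub>B\<^esub> f) = fmor iB g \<cdot>\<^bsub>G\<^esub> fmor iB f" for g f
      using A.comp_zero_left[OF z zero_objects(3)] by (simp add: incl_simps G_simps)
  qed (use incl_snd_arrow zM_closed zero_objects in \<open>auto simp: incl_simps Obj_G\<close>)
  show "fmor iB (hadd B X Y f g) = hadd G (fob iB X) (fob iB Y) (fmor iB f) (fmor iB g)" for X Y f g
    using A.add_zero_left[OF z] by (simp add: incl_simps G_simps)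
  show "is_kernel G (fob iB X) (fob iB Y) (fmor iB f) (fob iB K) (fmor iB k)"
    if k: "is_kernel B X Y f K k" for X Y f K k
  proof -
    obtain \<nu> where n: "is_kernel G (fob iB X) (fob iB Y) (fmor iB f) (ZA, K, \<nu>) (hzero A ZA ZA, k)"
      using kernel_G[OF incl_snd_arrow[OF B.is_kernelD(1)[OF k]], of ZA "hzero A ZA ZA" K k] k
        A.kernel_zero_object[OF zero_objects(1)] by (auto simp: incl_simps)
    note t = incl_snd_trivial[OF disjI1[OF G.is_kernelD(2)[OF n]]]
    show ?thesis using n unfolding t by (simp add: incl_simps(4))
  qed
  show "is_cokernel G (fob iB X) (fob iB Y) (fmor iB f) (fob iB K) (fmor iB k)"
    if k: "is_cokernel B X Y f K k" for X Y f K k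
  proof -
    obtain \<nu> where n: "is_cokernel G (fob iB X) (fob iB Y) (fmor iB f) (ZA, K, \<nu>) (hzero A ZA ZA, k)"
      using cokernel_G[OF incl_snd_arrow[OF B.is_cokernelD(1)[OF k]], of ZA "hzero A ZA ZA" K k] k
        A.cokernel_zero_object[OF zero_objects(1)] by (auto simp: incl_simps)
    note t = incl_snd_trivial[OF disjI2[OF G.is_cokernelD(2)[OF n]]]
    show ?thesis using n unfolding t by (simp add: incl_simps(4))
  qed
qed

interpretation pA: exact_functor R G A glued_prj_fst by (rule exact_prj_fst)
interpretation pB: exact_functor R G B glued_prj_snd by (rule exact_prj_snd)
interpretation iA: exact_functor R A G iA by (rule exact_incl_fst)
interpretation iB: exact_functor R B G iB by (rule exact_incl_snd)

text \<open>The exact projections carry cohomology data of the glued category to data in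
  \<open>A\<close> and \<open>B\<close>. Thus both components of the induced map are isomorphisms,
  and these assemble to one.\<close>

lemma quasi_iso_G:
  assumes X: "is_complex G X" and Y: "is_complex G Y" and f: "is_chain_map G X Y f"
    and fA: "fmor pA.FC f \<in> quasi_isos A (fob pA.FC X) (fob pA.FC Y)"
    and fB: "fmor pB.FC f \<in> quasi_isos B (fob pB.FC X) (fob pB.FC Y)"
  shows "f \<in> quasi_isos G X Y"
proof (rule G.quasi_isosI[OF X Y f])
  fix n
  let ?H = "chosen_cohomology G X n" and ?K = "chosen_cohomology G Y n"
    and ?h = "cohomology_map G X Y f n"
  note c = G.chosen_cohomology[OF X, of n] G.chosen_cohomology[OF Y, of n]
  note m = G.is_cohomology_map_cohomology_map[OF X Y f, of n]
  have h: "arrow G (coh ?H) (coh ?K) ?h" using m by (simp add: is_cohomology_map_def)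
  note fn = G.chain_mapD(1)[OF X Y f, of n]
  have "is_iso A (oA (coh ?H)) (oA (coh ?K)) (fst ?h)"
    using A.quasi_isosD[OF pA.chain_functor_complex[OF X] pA.chain_functor_complex[OF Y] fA
        pA.is_cohomology_map_cohomology[OF X c(1)] pA.is_cohomology_map_cohomology[OF Y c(2)]]
      pA.cohomology_map_map_cohomology[OF c fn m]
    by (simp add: pA.chain_functor_simps pA.map_cohomology_def glued_prj_simps)
  moreover have "is_iso B (oB (coh ?H)) (oB (coh ?K)) (snd ?h)"
    using B.quasi_isosD[OF pB.chain_functor_complex[OF X] pB.chain_functor_complex[OF Y] fB
        pB.is_cohomology_map_cohomology[OF X c(1)] pB.is_cohomology_map_cohomology[OF Y c(2)]]
      pB.cohomology_map_map_cohomology[OF c fn m]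
    by (simp add: pB.chain_functor_simps pB.map_cohomology_def glued_prj_simps)
  ultimately have "is_iso G (coh ?H) (coh ?K) ?h" using is_iso_G_iff[OF h] by simp
  with c m show "\<exists>H H' h. is_cohomology G X n H \<and> is_cohomology G Y n H' \<and>
      is_cohomology_map G H H' (f n) h \<and> is_iso G (coh H) (coh H') h" by blast
qed

text \<open>The unit \<open>(X, Y, \<mu>) \<rightarrow> (X, 0, 0)\<close> and the counit \<open>(0, Y, 0) \<rightarrow> (X, Y, \<mu>)\<close>.\<close>

definition unit :: "('oa \<times> 'ob \<times> 'v, 'ma \<times> 'mb) cochain \<Rightarrow> int \<Rightarrow> 'ma \<times> 'mb" where
  "unit X n = (Ident A (oA (cob X n)), hzero B (oB (cob X n)) ZB)"

definition counit :: "('oa \<times> 'ob \<times> 'v, 'ma \<times> 'mb) cochain \<Rightarrow> int \<Rightarrow> 'ma \<times> 'mb" where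
  "counit X n = (hzero A ZA (oA (cob X n)), Ident B (oB (cob X n)))"

lemma chain_prj_simps:
  "cob (fob pA.FC X) n = oA (cob X n)" "cdiff (fob pA.FC X) n = fst (cdiff X n)" "fmor pA.FC f n = fst (f n)"
  "cob (fob pB.FC X) n = oB (cob X n)" "cdiff (fob pB.FC X) n = snd (cdiff X n)" "fmor pB.FC f n = snd (f n)"
  "cob (fob iA.FC Y) n = (cob Y n, ZB, zM (cob Y n) ZB)" "cdiff (fob iA.FC Y) n = (cdiff Y n, hzero B ZB ZB)"
  "fmor iA.FC g n = (g n, hzero B ZB ZB)"
  "cob (fob iB.FC Z) n = (ZA, cob Z n, zM ZA (cob Z n))" "cdiff (fob iB.FC Z) n = (hzero A ZA ZA, cdiff Z n)"
  "fmor iB.FC h n = (hzero A ZA ZA, h n)"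
  by (simp_all add: pA.chain_functor_simps pB.chain_functor_simps iA.chain_functor_simps
      iB.chain_functor_simps glued_prj_simps incl_simps)

lemma retractions:
  "fob pA.FC (fob iA.FC X) = X" "fmor pA.FC (fmor iA.FC f) = f"
  "fob pB.FC (fob iB.FC Y) = Y" "fmor pB.FC (fmor iB.FC g) = g"
  by (simp_all add: chain_functor_def glued_prj_simps incl_simps)

text \<open>Both sides of the gluing condition are zero in \<open>M(oA P, ZB)\<close>: one is pushed
  along a zero arrow, the other is pulled back from the zero element.\<close>

lemma arrow_unit:
  assumes P: "P \<in> Obj G"
  shows "arrow G P (oA P, ZB, zM (oA P) ZB) (Ident A (oA P), hzero B (oB P) ZB)"
  using P push_zero_arrow[of "oA P" "oB P" ZB "oM P"] pull_zero[OF zero_objects(4) A.arrow_ident, of "oA P"]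
    zM_closed[OF _ zero_objects(4), of "oA P"] zero_objects(4)
  by (simp add: arrow_G Obj_G A.arrow_ident B.arrow_zero)

lemma arrow_counit:
  assumes P: "P \<in> Obj G"
  shows "arrow G (ZA, oB P, zM ZA (oB P)) P (hzero A ZA (oA P), Ident B (oB P))"
  using P pull_zero_arrow[of ZA "oA P" "oB P" "oM P"] push_zero[OF zero_objects(3) B.arrow_ident, of "oB P"]
    zM_closed[OF zero_objects(3), of "oB P"] zero_objects(3)
  by (simp add: arrow_G Obj_G B.arrow_ident A.arrow_zero)

lemma unit_natural:
  assumes h: "arrow G P Q h"
  shows "(Ident A (oA Q), hzero B (oB Q) ZB) \<cdot>\<^bsub>G\<^esub> h =
    (fst h, hzero B ZB ZB) \<cdot>\<^bsub>G\<^esub> (Ident A (oA P), hzero B (oB P) ZB)"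
  using arrow_GD(1)[OF h] A.comp_id_left[OF arrow_GD(3)[OF h]] A.comp_id_right[OF arrow_GD(3)[OF h]]
    B.comp_zero_left[OF arrow_GD(4)[OF h] zero_objects(4)]
    B.comp_zero_left[OF B.arrow_zero[OF _ zero_objects(4)] zero_objects(4), of "oB P"]
  by (simp add: G_simps Obj_G)

lemma counit_natural:
  assumes h: "arrow G P Q h"
  shows "(hzero A ZA (oA Q), Ident B (oB Q)) \<cdot>\<^bsub>G\<^esub> (hzero A ZA ZA, snd h) =
    h \<cdot>\<^bsub>G\<^esub> (hzero A ZA (oA P), Ident B (oB P))"
  using arrow_GD(2)[OF h] B.comp_id_left[OF arrow_GD(4)[OF h]] B.comp_id_right[OF arrow_GD(4)[OF h]]
    A.comp_zero_right[OF zero_objects(3) arrow_GD(3)[OF h]]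
    A.comp_zero_right[OF zero_objects(3) A.arrow_zero[OF zero_objects(3)], of "oA Q"]
  by (simp add: G_simps Obj_G)

lemma unit_chain_map:
  assumes X: "is_complex G X"
  shows "is_chain_map G X (fob iA.FC (fob pA.FC X)) (unit X)"
  by (rule G.is_chain_mapI)
    (use arrow_unit[OF G.complexD(1)[OF X]] unit_natural[OF G.complexD(2)[OF X]] in
      \<open>simp_all add: unit_def chain_prj_simps\<close>)

lemma counit_chain_map:
  assumes X: "is_complex G X"
  shows "is_chain_map G (fob iB.FC (fob pB.FC X)) X (counit X)"
  by (rule G.is_chain_mapI)
    (use arrow_counit[OF G.complexD(1)[OF X]] counit_natural[OF G.complexD(2)[OF X]] in
      \<open>simp_all add: counit_def chain_prj_simps\<close>)

lemma unit_natural_Ch: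
  assumes "arrow (Ch G) X Y f"
  shows "unit Y \<cdot>\<^bsub>Ch G\<^esub> f = fmor iA.FC (fmor pA.FC f) \<cdot>\<^bsub>Ch G\<^esub> unit X"
proof -
  have f: "arrow G (cob X n) (cob Y n) (f n)" for n
    using assms G.chain_mapD(1) by (simp add: G.arrow_Ch)
  show ?thesis using unit_natural[OF f] by (simp add: G.Ch_simps unit_def chain_prj_simps)
qed

lemma counit_natural_Ch:
  assumes "arrow (Ch G) X Y f"
  shows "counit Y \<cdot>\<^bsub>Ch G\<^esub> fmor iB.FC (fmor pB.FC f) = f \<cdot>\<^bsub>Ch G\<^esub> counit X"
proof -
  have f: "arrow G (cob X n) (cob Y n) (f n)" for n
    using assms G.chain_mapD(1) by (simp add: G.arrow_Ch)
  show ?thesis using counit_natural[OF f] by (simp add: G.Ch_simps counit_def chain_prj_simps)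
qed

lemma fully_faithful_incl_fst:
  "fully_faithful (derived_category A) (derived_category G) (derived_functor G iA)"
  unfolding fully_faithful_derived_category derived_functor_def
proof (rule fully_faithful_reflective[OF iA.localizing_chain pA.localizing_chain, where \<eta> = unit])
  \<comment> \<open>The \<open>B\<close>-component of the unit at an included object is the zero
    endomorphism of \<open>ZB\<close>, which is its identity.\<close>
  show "unit (fob iA.FC X) = Ident (Ch G) (fob iA.FC X)" for X
    using zero_objects(2)
    by (auto simp: unit_def chain_prj_simps G.Ch_simps G_simps B.is_zero_object_iff)
  show "unit Y \<cdot>\<^bsub>Ch G\<^esub> f = fmor iA.FC (fmor pA.FC f) \<cdot>\<^bsub>Ch G\<^esub> unit X" if "arrow (Ch G) X Y f" for X Y f
    by (rule unit_natural_Ch[OF that])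
qed (simp_all add: retractions G.arrow_Ch G.Ch_simps unit_chain_map
    iA.chain_functor_complex pA.chain_functor_complex)

lemma fully_faithful_incl_snd:
  "fully_faithful (derived_category B) (derived_category G) (derived_functor G iB)"
  unfolding fully_faithful_derived_category derived_functor_def
proof (rule fully_faithful_coreflective[OF iB.localizing_chain pB.localizing_chain, where \<epsilon> = counit])
  show "counit (fob iB.FC X) = Ident (Ch G) (fob iB.FC X)" for X
    using zero_objects(1)
    by (auto simp: counit_def chain_prj_simps G.Ch_simps G_simps A.is_zero_object_iff)
  show "counit Y \<cdot>\<^bsub>Ch G\<^esub> fmor iB.FC (fmor pB.FC f) = f \<cdot>\<^bsub>Ch G\<^esub> counit X" if "arrow (Ch G) X Y f" for X Y f
    by (rule counit_natural_Ch[OF that])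
qed (simp_all add: retractions G.arrow_Ch G.Ch_simps counit_chain_map
    iB.chain_functor_complex pB.chain_functor_complex)

text \<open>The letters cross: \<open>SA\<close> is cut out by the \<open>B\<close>-component and
  \<open>SB\<close> by the \<open>A\<close>-component.\<close>

abbreviation SA where "SA \<equiv> {X. is_complex G X \<and> acyclic_complex B (fob pB.FC X)}"
abbreviation SB where "SB \<equiv> {X. is_complex G X \<and> acyclic_complex A (fob pA.FC X)}"

lemma acyclic_prj_snd_incl_fst:
  assumes X: "is_complex A X"
  shows "acyclic_complex B (fob pB.FC (fob iA.FC X))"
  using B.acyclic_if_zero_objects[OF pB.chain_functor_complex[OF iA.chain_functor_complex[OF X]]]
    zero_objects(2) by (simp add: chain_prj_simps)

lemma acyclic_prj_fst_incl_snd: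
  assumes X: "is_complex B X"
  shows "acyclic_complex A (fob pA.FC (fob iB.FC X))"
  using A.acyclic_if_zero_objects[OF pA.chain_functor_complex[OF iB.chain_functor_complex[OF X]]]
    zero_objects(1) by (simp add: chain_prj_simps)

text \<open>The \<open>A\<close>-component is an identity. The \<open>B\<close>-component runs
  between acyclic complexes, the source being acyclic by assumption and the target having zero
  terms.\<close>

lemma unit_quasi_iso:
  assumes "X \<in> SA"
  shows "unit X \<in> quasi_isos G X (fob iA.FC (fob pA.FC X))"
proof (rule quasi_iso_G)
  show X: "is_complex G X" using assms by blast
  note pX = pA.chain_functor_complex[OF X]
  show Y: "is_complex G (fob iA.FC (fob pA.FC X))" by (rule iA.chain_functor_complex[OF pX])
  show u: "is_chain_map G X (fob iA.FC (fob pA.FC X)) (unit X)" by (rule unit_chain_map[OF X])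
  have "fmor pA.FC (unit X) = (\<lambda>n. Ident A (cob (fob pA.FC X) n))"
    by (auto simp: chain_prj_simps unit_def)
  then show "fmor pA.FC (unit X) \<in> quasi_isos A (fob pA.FC X) (fob pA.FC (fob iA.FC (fob pA.FC X)))"
    using A.quasi_isos_ident[OF pX] by (simp add: retractions)
  show "fmor pB.FC (unit X) \<in> quasi_isos B (fob pB.FC X) (fob pB.FC (fob iA.FC (fob pA.FC X)))"
    using B.quasi_iso_acyclic[OF pB.chain_functor_complex[OF X] _ pB.chain_functor_complex[OF Y]
      acyclic_prj_snd_incl_fst[OF pX] pB.chain_functor_chain_map[OF X Y u]] assms by blast
qed

lemma counit_quasi_iso:
  assumes "X \<in> SB"
  shows "counit X \<in> quasi_isos G (fob iB.FC (fob pB.FC X)) X"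
proof (rule quasi_iso_G)
  show X: "is_complex G X" using assms by blast
  note pX = pB.chain_functor_complex[OF X]
  show Y: "is_complex G (fob iB.FC (fob pB.FC X))" by (rule iB.chain_functor_complex[OF pX])
  show u: "is_chain_map G (fob iB.FC (fob pB.FC X)) X (counit X)" by (rule counit_chain_map[OF X])
  have "fmor pB.FC (counit X) = (\<lambda>n. Ident B (cob (fob pB.FC X) n))"
    by (auto simp: chain_prj_simps counit_def)
  then show "fmor pB.FC (counit X) \<in> quasi_isos B (fob pB.FC (fob iB.FC (fob pB.FC X))) (fob pB.FC X)"
    using B.quasi_isos_ident[OF pX] by (simp add: retractions)
  show "fmor pA.FC (counit X) \<in> quasi_isos A (fob pA.FC (fob iB.FC (fob pB.FC X))) (fob pA.FC X)"
    using A.quasi_iso_acyclic[OF pA.chain_functor_complex[OF Y] acyclic_prj_fst_incl_snd[OF pX]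
      pA.chain_functor_complex[OF X] _ pA.chain_functor_chain_map[OF Y X u]] assms by blast
qed

section \<open>Essential images, orthogonality and the decomposition triangle\<close>

interpretation LG: localizing "Ch G" "quasi_isos G" by (rule G.localizing_quasi_isos)
interpretation LGc: category LG.L by (rule LG.category_localization)
interpretation LpA: localizing_functor "Ch G" "quasi_isos G" "Ch A" "quasi_isos A" pA.FC
  by (rule pA.localizing_chain)
interpretation LpB: localizing_functor "Ch G" "quasi_isos G" "Ch B" "quasi_isos B" pB.FC
  by (rule pB.localizing_chain)

text \<open>One inclusion projects the isomorphism to \<open>B\<close>, where acyclicity is
  invariant under isomorphism in the derived category; for the other, the unit is the required
  isomorphism.\<close>

lemma ess_image_fst: "ess_image (derived_category A) (derived_category G) (derived_functor G iA) = SA"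
proof -
  have "Y \<in> SA" if X: "is_complex A X" and Y: "is_complex G Y" and i: "isomorphic LG.L (fob iA.FC X) Y" for X Y
    using B.acyclic_isomorphic[OF pB.chain_functor_complex[OF iA.chain_functor_complex[OF X]]
        pB.chain_functor_complex[OF Y] LpB.isomorphic_map[OF i] acyclic_prj_snd_incl_fst[OF X]] Y by blast
  moreover have "\<exists>X. is_complex A X \<and> isomorphic LG.L (fob iA.FC X) Y" if Y: "Y \<in> SA" for Y
  proof -
    have c: "is_complex A (fob pA.FC Y)" using Y pA.chain_functor_complex by blast
    then have "isomorphic LG.L Y (fob iA.FC (fob pA.FC Y))"
      using LG.isomorphic_if_W[OF _ _ unit_quasi_iso[OF Y]] Y iA.chain_functor_complex
      by (simp add: G.Ch_simps)
    with c show ?thesis using LGc.isomorphic_sym by blast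
  qed
  ultimately show ?thesis
    unfolding ess_image_def isomorphic_derived_category derived_category_simps LG.Obj_localization
      LpA.T.Obj_localization G.Ch_simps A.Ch_simps
    by (auto simp: derived_functor_def localized_functor_def)
qed

lemma ess_image_snd: "ess_image (derived_category B) (derived_category G) (derived_functor G iB) = SB"
proof -
  have "Y \<in> SB" if X: "is_complex B X" and Y: "is_complex G Y" and i: "isomorphic LG.L (fob iB.FC X) Y" for X Y
    using A.acyclic_isomorphic[OF pA.chain_functor_complex[OF iB.chain_functor_complex[OF X]]
        pA.chain_functor_complex[OF Y] LpA.isomorphic_map[OF i] acyclic_prj_fst_incl_snd[OF X]] Y by blast
  moreover have "\<exists>X. is_complex B X \<and> isomorphic LG.L (fob iB.FC X) Y" if Y: "Y \<in> SB" for Y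
  proof -
    have c: "is_complex B (fob pB.FC Y)" using Y pB.chain_functor_complex by blast
    then have "isomorphic LG.L (fob iB.FC (fob pB.FC Y)) Y"
      using LG.isomorphic_if_W[OF _ _ counit_quasi_iso[OF Y]] Y iB.chain_functor_complex
      by (simp add: G.Ch_simps)
    with c show ?thesis by blast
  qed
  ultimately show ?thesis
    unfolding ess_image_def isomorphic_derived_category derived_category_simps LG.Obj_localization
      LpB.T.Obj_localization G.Ch_simps B.Ch_simps
    by (auto simp: derived_functor_def localized_functor_def)
qed

text \<open>Up to the isomorphism \<open>unit Y\<close>, a zigzag \<open>X \<rightarrow> Y\<close> factors through \<open>unit X\<close>, whose target
  is acyclic.\<close>

lemma hom_SB_SA_zero:
  assumes X: "X \<in> SB" and Y: "Y \<in> SA" and f: "f \<in> Hom LG.L X Y"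
  shows "is_zero_morphism LG.L X Y f"
proof -
  let ?IP = "comp_functor iA.FC pA.FC" and ?O = "G.zero_complex"
    and ?X' = "fob iA.FC (fob pA.FC X)" and ?Y' = "fob iA.FC (fob pA.FC Y)"
  let ?I = "id_functor :: (('oa \<times> 'ob \<times> 'v, 'ma \<times> 'mb) cochain, int \<Rightarrow> 'ma \<times> 'mb, _, _) functor_data"
  interpret IP: localizing_functor "Ch G" "quasi_isos G" "Ch G" "quasi_isos G" ?IP
    by (rule localizing_functor_comp[OF pA.localizing_chain iA.localizing_chain])
  have c: "is_complex G X" "is_complex G Y" using X Y by auto
  note cp = pA.chain_functor_complex[OF c(1)] pA.chain_functor_complex[OF c(2)]
  note c' = iA.chain_functor_complex[OF cp(1)] iA.chain_functor_complex[OF cp(2)]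
  note cO = G.zero_complex(1)
  have zO: "is_zero_object (Ch G) ?O" using G.zero_object_Ch G.zero_complex by blast
  have o: "X \<in> Obj (Ch G)" "Y \<in> Obj (Ch G)" "?X' \<in> Obj (Ch G)" "?Y' \<in> Obj (Ch G)" "?O \<in> Obj (Ch G)"
    using c c' cO by (simp_all add: G.Ch_simps)
  obtain q where q: "zigzag (Ch G) (quasi_isos G) X q Y" "f = zz_class (Ch G) (quasi_isos G) X q Y"
    using f by (rule LG.Hom_localizationE)
  obtain z where z: "arrow (Ch G) ?O ?X' z" using LG.ex_arrow_from_zero_object[OF zO o(3)] by blast
  have z': "is_chain_map G ?O ?X' z" using z by (simp add: G.arrow_Ch)
  have aO: "acyclic_complex A (fob pA.FC ?O)" "acyclic_complex B (fob pB.FC ?O)"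
    using A.acyclic_if_zero_objects[OF pA.chain_functor_complex[OF cO]]
      B.acyclic_if_zero_objects[OF pB.chain_functor_complex[OF cO]] G.zero_complex(2)
    by (simp_all add: chain_prj_simps is_zero_object_G_iff)
  \<comment> \<open>The \<open>A\<close>-component of \<open>?X'\<close> is that of
    \<open>X\<close>, acyclic because \<open>X\<close> lies in \<open>SB\<close>, and its
    \<open>B\<close>-component has zero terms; so \<open>?X'\<close> is quasi-isomorphic to the zero
    complex.\<close>
  have zq: "z \<in> quasi_isos G ?O ?X'"
  proof (rule quasi_iso_G[OF cO c'(1) z'])
    show "fmor pA.FC z \<in> quasi_isos A (fob pA.FC ?O) (fob pA.FC ?X')"
      using A.quasi_iso_acyclic[OF pA.chain_functor_complex[OF cO] aO(1) pA.chain_functor_complex[OF c'(1)]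
          _ pA.chain_functor_chain_map[OF cO c'(1) z']] X by (simp add: retractions)
    show "fmor pB.FC z \<in> quasi_isos B (fob pB.FC ?O) (fob pB.FC ?X')"
      using B.quasi_iso_acyclic[OF pB.chain_functor_complex[OF cO] aO(2) pB.chain_functor_complex[OF c'(1)]
          acyclic_prj_snd_incl_fst[OF cp(1)] pB.chain_functor_chain_map[OF cO c'(1) z']] .
  qed
  note uY = unit_quasi_iso[OF Y]
  have uX: "arrow (Ch G) X ?X' (unit X)" using c c' unit_chain_map by (simp add: G.arrow_Ch)
  let ?uX = "Fwd X (unit X) ?X'" and ?uY = "Fwd Y (unit Y) ?Y'" and ?bY = "Bwd Y (unit Y) ?Y'"
    and ?z = "Fwd ?O z ?X'" and ?bz = "Bwd ?O z ?X'"
  let ?q' = "map (map_zz_step ?IP) q"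
  have "zz_eq (Ch G) (quasi_isos G) (fob ?I X) (fob ?IP Y)
      (map (map_zz_step ?I) q @ [Fwd (fob ?I Y) (unit Y) (fob ?IP Y)])
      ([Fwd (fob ?I X) (unit X) (fob ?IP X)] @ ?q')"
    by (rule zigzag_natural[where \<eta> = unit, OF localizing_functor_id[OF LG.localizing_axioms]
          IP.localizing_functor_axioms _ _ q(1)])
      (simp_all add: functor_simps unit_natural_Ch, simp add: G.arrow_Ch G.Ch_simps unit_chain_map
        iA.chain_functor_complex pA.chain_functor_complex)
  then have n: "zz_eq (Ch G) (quasi_isos G) X ?Y' (q @ [?uY]) ([?uX] @ ?q')"
    by (simp add: functor_simps map_zz_step_id)
  have q': "zigzag (Ch G) (quasi_isos G) ?X' ?q' ?Y'" using IP.zigzag_map[OF q(1)] by (simp add: functor_simps)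
  note bY = LG.zigzag_Bwd[OF o(2,4) uY] and bz = LG.zigzag_Bwd[OF o(5,3) zq]
    and zf = LG.zigzag_Fwd[OF z] and uXf = LG.zigzag_Fwd[OF uX]
  have 1: "zigzag (Ch G) (quasi_isos G) X ([?uX] @ [?bz]) ?O" by (rule LG.zigzag_append[OF uXf bz])
  have 2: "zigzag (Ch G) (quasi_isos G) ?O ([?z] @ ?q' @ [?bY]) Y"
    by (rule LG.zigzag_append[OF zf LG.zigzag_append[OF q' bY]])
  \<comment> \<open>Insert \<open>unit Y\<close> and its inverse at the end, slide the unit to the
    front by naturality, and insert a detour from \<open>?X'\<close> to the zero complex and
    back.\<close>
  have "zz_eq (Ch G) (quasi_isos G) X Y (q @ []) (q @ [?uY, ?bY])"
    by (rule LG.zz_cong_right[OF q(1) zz_sym[OF LG.W_fwd_bwd[OF o(2,4) uY]]])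
  moreover have "zz_eq (Ch G) (quasi_isos G) X Y ((q @ [?uY]) @ [?bY]) (([?uX] @ ?q') @ [?bY])"
    by (rule LG.zz_cong_left[OF n bY])
  moreover have "zz_eq (Ch G) (quasi_isos G) X Y ([?uX] @ [] @ (?q' @ [?bY])) ([?uX] @ [?bz, ?z] @ (?q' @ [?bY]))"
    by (rule LG.zz_cong_mid[OF uXf zz_sym[OF LG.W_bwd_fwd[OF o(5,3) zq]] LG.zigzag_append[OF q' bY]])
  ultimately have "zz_eq (Ch G) (quasi_isos G) X Y q (([?uX] @ [?bz]) @ ([?z] @ ?q' @ [?bY]))"
    by (auto intro: zz_trans)
  then have "f = zz_class (Ch G) (quasi_isos G) ?O ([?z] @ ?q' @ [?bY]) Y \<cdot>\<^bsub>LG.L\<^esub>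
      zz_class (Ch G) (quasi_isos G) X ([?uX] @ [?bz]) ?O"
    using iffD2[OF LG.zz_class_eq_iff[OF q(1)]] LG.Comp_localization[OF 1 2] q(2) by simp
  then show ?thesis
    unfolding is_zero_morphism_def
    using LG.zero_object_localization[OF zO] LG.zz_class_Hom[OF 1] LG.zz_class_Hom[OF 2] by blast
qed

lemma decomposition_triangle:
  assumes X: "is_complex G X"
  shows "\<exists>S\<in>SA. \<exists>T\<in>SB. \<exists>u v w. (T, X, S, u, v, w) \<in> derived_triangles G"
proof -
  let ?T = "fob iB.FC (fob pB.FC X)"
  note pX = pB.chain_functor_complex[OF X]
  have T: "is_complex G ?T" by (rule iB.chain_functor_complex[OF pX])
  have f: "is_chain_map G ?T X (counit X)" by (rule counit_chain_map[OF X])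
  have "fmor pB.FC (counit X) = (\<lambda>n. Ident B (cob (fob pB.FC X) n))"
    by (auto simp: chain_prj_simps counit_def)
  then obtain Q where "is_cone B (fob pB.FC X) (fob pB.FC X) (\<lambda>n. Ident B (cob (fob pB.FC X) n))
      (fob pB.FC (cone G ?T X (counit X))) Q"
    using pB.chain_functor_cone[OF T X f G.is_cone_cone[OF T X f]] by (auto simp: retractions)
  then have "cone G ?T X (counit X) \<in> SA"
    using B.acyclic_cone_ident[OF pX] G.cone_complex[OF T X f] by blast
  moreover have "?T \<in> SB" using T acyclic_prj_fst_incl_snd[OF pX] by blast
  ultimately show ?thesis using G.cone_triangle[OF T X f] by blast
qed

lemma semiorthogonal_decomposition_glued:
  "semiorthogonal_decomposition (derived_category G) SA SB"
  unfolding semiorthogonal_decomposition_def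
proof (intro conjI ballI)
  show "triangulated_subcategory (derived_category G) SA"
    by (rule pB.triangulated_kernel[OF B.abelian_category_axioms])
  show "triangulated_subcategory (derived_category G) SB"
    by (rule pA.triangulated_kernel[OF A.abelian_category_axioms])
  show "is_zero_morphism (derived_category G) X Y f"
    if "X \<in> SB" "Y \<in> SA" "f \<in> Hom (derived_category G) X Y" for X Y f
    using hom_SB_SA_zero[OF that(1,2)] that(3)
    unfolding is_zero_morphism_derived_category derived_category_simps by blast
  show "\<exists>S\<in>SA. \<exists>T\<in>SB. \<exists>u v w. (T, X, S, u, v, w) \<in> dist (derived_category G)"
    if "X \<in> Obj (derived_category G)" for X
    using decomposition_triangle that
    unfolding derived_category_simps LG.Obj_localization G.Ch_simps by blast
qed

end

text \<open>Full faithfulness expresses that \<open>I_A\<close> and \<open>I_B\<close> are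
  embeddings; essential images appear because the subcategories have to be closed under
  isomorphism.\<close>

theorem proposition2p10:
  fixes R :: "('r, 'x) ring_scheme"
    and A :: "('oa, 'ma, 'r) lincat"
    and B :: "('ob, 'mb, 'r) lincat"
    and M :: "('oa, 'ma, 'ob, 'mb, 'r, 'v) bifunctor_data"
  assumes "cring R"
    and "abelian_category R A"
    and "abelian_category R B"
    and "left_exact_bifunctor R A B M"
  shows "let G = glued A B M;
             I_A = derived_functor G (glued_incl_fst A B M);
             I_B = derived_functor G (glued_incl_snd A B M)
         in fully_faithful (derived_category A) (derived_category G) I_A \<and>
            fully_faithful (derived_category B) (derived_category G) I_B \<and>
            semiorthogonal_decomposition (derived_category G)
              (ess_image (derived_category A) (derived_category G) I_A)
              (ess_image (derived_category B) (derived_category G) I_B)"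
proof -
  interpret gluing R A B M using assms by (simp add: gluing_def)
  show ?thesis
    using fully_faithful_incl_fst fully_faithful_incl_snd semiorthogonal_decomposition_glued
    by (simp only: Let_def ess_image_fst ess_image_snd simp_thms)
qed

end
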